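(* Let $q\in\mathbb{C}$ with $0<|q|<1$ and let $\omega$ be a primitive third root of unity. Then $$\chi(q^9)+q^{2}\,\frac{X(\omega q)-X(\omega^2 q)}{\omega - \omega^2}=-q^3\,\frac{\overline{J}_{1,4}}{\overline{J}_{3,12}}\cdot\frac{J_{6,30}J_{3}}{J_{6}}.$$
   Context: For a complex number $p$ with $0<|p|<1$ and $x\in\mathbb{C}^*=\mathbb{C}\setminus\{0\}$: $(x;p)_n=\prod_{i=0}^{n-1}(1-p^ix)$, $(x;p)_\infty=\prod_{i\ge0}(1-p^ix)$, and $j(x;p)=(x;p)_\infty(p/x;p)_\infty(p;p)_\infty=\sum_{n\in\mathbb{Z}}(-1)^np^{\binom n2}x^n$. For integers $a,m$ with $m\ge1$: $J_{a,m}=j(q^a;q^m)$, $\overline{J}_{a,m}=j(-q^a;q^m)$ and $J_m=J_{m,3m}=\prod_{i\ge1}(1-q^{mi})$. The tenth-order mock theta functions $X,\chi$ are, for $|q|<1$, $X(q)=\sum_{n\ge0}\frac{(-1)^nq^{n^2}}{(-q;q)_{2n}}$ and $\chi(q)=\sum_{n\ge0}\frac{(-1)^nq^{(n+1)^2}}{(-q;q)_{2n+1}}$. *)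

theory Defs
  imports "HOL-Analysis.Analysis"
begin

definition qpoch :: "complex \<Rightarrow> complex \<Rightarrow> nat \<Rightarrow> complex" where
  "qpoch x p n = (\<Prod>i<n. 1 - p ^ i * x)"

definition qpoch_inf :: "complex \<Rightarrow> complex \<Rightarrow> complex" where
  "qpoch_inf x p = (\<Prod>i. 1 - p ^ i * x)"

text \<open>The theta function \<open>j(x;p)\<close>, meaningful for \<open>0 < |p| < 1\<close> and \<open>x \<noteq> 0\<close>; the product
  is taken as the definition, the equality with the series being Jacobi's triple product.\<close>

definition theta_j :: "complex \<Rightarrow> complex \<Rightarrow> complex" where
  "theta_j x p = qpoch_inf x p * qpoch_inf (p / x) p * qpoch_inf p p"

text \<open>\<open>J\<^bsub>a,m\<^esub>\<close>, its barred variant and \<open>J\<^bsub>m\<^esub>\<close> (for \<open>m \<ge> 1\<close>), with the base \<open>q\<close> explicit.\<close>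

definition theta_J :: "complex \<Rightarrow> int \<Rightarrow> nat \<Rightarrow> complex" where
  "theta_J q a m = theta_j (q powi a) (q ^ m)"

definition theta_Jbar :: "complex \<Rightarrow> int \<Rightarrow> nat \<Rightarrow> complex" where
  "theta_Jbar q a m = theta_j (- (q powi a)) (q ^ m)"

definition theta_J1 :: "complex \<Rightarrow> nat \<Rightarrow> complex" where
  "theta_J1 q m = theta_J q (int m) (3 * m)"

text \<open>The tenth-order mock theta functions \<open>X\<close> and \<open>\<chi>\<close>, for \<open>|q| < 1\<close>.\<close>

definition mock_X :: "complex \<Rightarrow> complex" where
  "mock_X q = (\<Sum>n. (-1) ^ n * q ^ (n ^ 2) / qpoch (- q) q (2 * n))"

definition mock_chi :: "complex \<Rightarrow> complex" where
  "mock_chi q = (\<Sum>n. (-1) ^ n * q ^ ((n + 1) ^ 2) / qpoch (- q) q (2 * n + 1))"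

definition primitive_root_of_unity :: "nat \<Rightarrow> complex \<Rightarrow> bool" where
  "primitive_root_of_unity n z \<longleftrightarrow> n > 0 \<and> z ^ n = 1 \<and> (\<forall>k\<in>{0<..<n}. z ^ k \<noteq> 1)"

end

theory Submission
  imports Defs
begin

text \<open>Write \<open>g(n) = 2n\<^sup>2 + n\<close>, let \<open>\<psi>(q) = \<Sum>q\<^bsup>g(n)\<^esup>\<close> over all integers \<open>n\<close>, and let \<open>S(q)\<close> be the sum
  of \<open>\<plusminus>q\<^bsup>g(r) + g(s) + 6rs\<^esup>\<close> over the pairs of integers \<open>r, s\<close> of equal sign, weighted by that sign.
  A Bailey pair gives \<open>\<psi>(q)X(q) = S(q)\<close>, and a companion pair an analogous formula for \<open>\<chi>\<close>.
  As \<open>g(n) \<equiv> 1\<close> (mod 3) for \<open>n \<equiv> 2\<close> (mod 3) and \<open>g(n) \<equiv> 0\<close> otherwise, \<open>S = H\<^sub>0 + H\<^sub>1 + H\<^sub>2\<close> according to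
  the number of indices that are 2 mod 3, and \<open>\<omega>q\<close> in place of \<open>q\<close> multiplies \<open>H\<^sub>i\<close> by \<open>\<omega>\<^sup>i\<close>.
  The part \<open>H\<^sub>2\<close> is again the sum for \<open>\<chi>(q\<^sup>9)\<close>. Similarly \<open>\<psi>(\<omega>q) = D(\<phi> + \<omega>B)\<close> with theta functions
  \<open>D\<close>, \<open>\<phi>\<close>, \<open>B\<close>, and the theorem reduces to
  \<open>B\<^sup>2H\<^sub>0 - \<phi>BH\<^sub>1 + \<phi>\<^sup>2H\<^sub>2 = q\<^sup>2 J\<^sub>6\<^sup>3 J\<^bsub>6,30\<^esub>\<close>.
  The left-hand side pairs a theta function with itself against the kernel
  \<open>\<Sum>\<plusminus>q\<^bsup>6rs\<^esup>x\<^sup>ry\<^sup>s = J\<^sub>6\<^sup>3 j(xy;q\<^sup>6) / (j(x;q\<^sup>6) j(y;q\<^sup>6))\<close>. That theta function turns out to be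
  \<open>q z\<^bsup>-1\<^esup> j(z;q\<^sup>6) j(-q\<^sup>3z;q\<^bsup>12\<^esup>)\<close>, whose first factor cancels the denominator of the kernel, so that
  the double sum collapses to a single theta series.\<close>

text \<open>The quadratic form in the reduction is the dissected double sum with weight
  \<open>\<phi>\<close> on the indices 2 mod 3 and \<open>- B\<close> on the others. This weight
  arises in two ways. Clearing denominators produces it: the difference of the X values over
  \<open>\<omega> - \<omega> ^ 2\<close> has denominator \<open>D * P\<close>, with P = \<phi>^2 -
  \<phi> B + B^2, and chi(q^9) is a multiple of H_2 / (D B). It also annihilates the dissected psi,
  because q^g(n) times the weight is, up to a constant factor, the coefficient sequence of a theta
  product with a zero at z = 1; this identifies the remaining part of psi without a further product
  formula. The quotient formula for the kernel is never proved. It enters only through coefficients: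
  two shifted copies of the coefficients of j(z;q^6) are orthogonal under the kernel unless the
  shifts agree. Summation along r + s = N reduces this to j(1;q^6) = 0 and to Jacobi's identity for
  the cube of the Euler product. All sums are unordered, so every rearrangement rests on an absolute
  bound.\<close>

section \<open>Infinite products\<close>

text \<open>Tannery's theorem for unordered sums: the majorant makes the finite partial sums
  converge uniformly in \<open>n\<close>, so the limit in \<open>n\<close> and the limit over finite
  sets commute.\<close>

lemma dominated_has_sum_tendsto:
  fixes f :: "nat \<Rightarrow> 'a \<Rightarrow> 'b :: banach"
  assumes bound: "\<And>n x. x \<in> A \<Longrightarrow> norm (f n x) \<le> M x"
    and M: "M summable_on A"
    and lim: "\<And>x. x \<in> A \<Longrightarrow> (\<lambda>n. f n x) \<longlonglongrightarrow> g x"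
    and hs: "\<And>n. (f n has_sum s n) A"
    and gs: "(g has_sum S) A"
  shows "s \<longlonglongrightarrow> S"
proof (rule swap_uniform_limit')
  show "\<forall>\<^sub>F X in finite_subsets_at_top A. (\<lambda>n. \<Sum>x\<in>X. f n x) \<longlonglongrightarrow> (\<Sum>x\<in>X. g x)"
    by (rule eventually_finite_subsets_at_top_weakI) (intro tendsto_sum lim, auto)
  show "((\<lambda>X. \<Sum>x\<in>X. g x) \<longlongrightarrow> S) (finite_subsets_at_top A)"
    using gs by (simp add: has_sum_def)
  show "uniform_limit UNIV (\<lambda>X n. \<Sum>x\<in>X. f n x) s (finite_subsets_at_top A)"
    by (rule Weierstrass_m_test_general'[where M = M]) (use bound M hs in auto)
qed auto

section \<open>q-Pochhammer symbols: convergence, bounds and factorisations\<close>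

lemma qpoch_0 [simp]: "qpoch x p 0 = 1"
  and qpoch_Suc: "qpoch x p (Suc n) = qpoch x p n * (1 - p ^ n * x)"
  by (simp_all add: qpoch_def)

lemma qpoch_Suc_left: "qpoch x p (Suc n) = (1 - x) * qpoch (p * x) p n"
  by (simp add: qpoch_def prod.lessThan_Suc_shift mult_ac del: prod.lessThan_Suc)

lemma qpoch_add: "qpoch x p (m + n) = qpoch x p m * qpoch (p ^ m * x) p n"
  by (induction n) (simp_all add: qpoch_Suc power_add mult_ac)

lemma qpoch_convergent_prod:
  fixes p x :: complex
  assumes "norm p < 1"
  shows "convergent_prod (\<lambda>i. 1 - p ^ i * x)"
proof -
  have "summable (\<lambda>i. norm p ^ i * norm x)"
    by (intro summable_mult2 summable_geometric) (use assms in auto)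
  hence "summable (\<lambda>i. norm (1 - p ^ i * x - 1))"
    by (simp add: norm_mult norm_power)
  hence "abs_convergent_prod (\<lambda>i. 1 - p ^ i * x)"
    by (rule summable_imp_abs_convergent_prod)
  thus ?thesis by (rule abs_convergent_prod_imp_convergent_prod)
qed

lemma qpoch_tendsto:
  assumes "norm p < 1"
  shows "qpoch x p \<longlonglongrightarrow> qpoch_inf x p"
proof -
  have "(\<lambda>n. qpoch x p (Suc n)) \<longlonglongrightarrow> qpoch_inf x p"
    using convergent_prod_LIMSEQ[OF qpoch_convergent_prod[OF assms, of x]]
    by (simp add: qpoch_def qpoch_inf_def lessThan_Suc_atMost)
  thus ?thesis by (simp only: filterlim_sequentially_Suc)
qed

lemma qpoch_factor_nz:
  fixes p x :: complex
  assumes "norm p \<le> 1" "norm x < 1"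
  shows "1 - p ^ i * x \<noteq> 0"
proof
  assume "1 - p ^ i * x = 0"
  hence "p ^ i * x = 1" by simp
  hence "norm (p ^ i * x) = 1" by (simp only: norm_one)
  moreover have "norm (p ^ i * x) \<le> norm x"
    using assms by (simp add: norm_mult norm_power mult_left_le_one_le power_le_one)
  ultimately show False using assms by simp
qed

lemma qpoch_nz:
  assumes "norm p \<le> 1" "norm x < 1"
  shows "qpoch x p n \<noteq> 0"
  using qpoch_factor_nz[OF assms] by (simp add: qpoch_def)

lemma qpoch_inf_nz:
  assumes "norm p < 1" "norm x < 1"
  shows "qpoch_inf x p \<noteq> 0"
  unfolding qpoch_inf_def
  by (intro prodinf_nonzero qpoch_convergent_prod qpoch_factor_nz) (use assms in auto)

text \<open>Convergent sequences are bounded. For the reciprocals this uses that the infinite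
  product is nonzero, whence the condition on \<open>x\<close>.\<close>

lemma qpoch_bounds:
  assumes "norm p < 1"
  obtains C where "C \<ge> 1" "\<And>n. norm (qpoch x p n) \<le> C"
    "norm x < 1 \<Longrightarrow> (\<And>n. norm (inverse (qpoch x p n)) \<le> C)"
proof -
  have "Bseq (qpoch x p)"
    by (rule convergent_imp_Bseq[OF convergentI[OF qpoch_tendsto[OF assms]]])
  then obtain C1 where C1: "\<And>n. norm (qpoch x p n) \<le> C1" by (auto simp: Bseq_def)
  have "\<exists>C2. norm x < 1 \<longrightarrow> (\<forall>n. norm (inverse (qpoch x p n)) \<le> C2)"
  proof (cases "norm x < 1")
    case True
    have "(\<lambda>n. inverse (qpoch x p n)) \<longlonglongrightarrow> inverse (qpoch_inf x p)"
      by (intro tendsto_inverse qpoch_tendsto qpoch_inf_nz assms True)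
    hence "Bseq (\<lambda>n. inverse (qpoch x p n))"
      by (rule convergent_imp_Bseq[OF convergentI])
    thus ?thesis by (auto simp: Bseq_def)
  qed auto
  then obtain C2 where C2: "norm x < 1 \<longrightarrow> (\<forall>n. norm (inverse (qpoch x p n)) \<le> C2)" by blast
  show ?thesis
    by (rule that[of "max 1 (max C1 C2)"]) (use C1 C2 in \<open>auto simp: le_max_iff_disj\<close>)
qed

lemma norm_power_less_1:
  assumes "norm (p :: 'a :: real_normed_div_algebra) < 1" "n > 0"
  shows "norm (p ^ n) < 1"
  using assms by (simp add: norm_power power_less_one_iff)

lemma qpoch_inf_eqI:
  assumes "norm p < 1" "(\<lambda>n. qpoch x p (k * n)) \<longlonglongrightarrow> L" "k > 0"
  shows "qpoch_inf x p = L"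
proof -
  have "strict_mono (\<lambda>n. k * n)" using assms by (auto simp: strict_mono_def)
  hence "(\<lambda>n. qpoch x p (k * n)) \<longlonglongrightarrow> qpoch_inf x p"
    using LIMSEQ_subseq_LIMSEQ[OF qpoch_tendsto[OF assms(1), of x]] by (simp add: o_def)
  thus ?thesis using assms(2) LIMSEQ_unique by blast
qed

text \<open>The factors are sorted by the residue of their index modulo \<open>k\<close>. The
  identity is exact for truncations of length \<open>k * n\<close>, so the limit is taken along that
  subsequence.\<close>

lemma qpoch_inf_split:
  assumes "norm p < 1" "k > 0"
  shows "qpoch_inf x p = (\<Prod>j<k. qpoch_inf (p ^ j * x) (p ^ k))"
proof (rule qpoch_inf_eqI[where k = k])
  have "qpoch x p (k * n) = (\<Prod>j<k. qpoch (p ^ j * x) (p ^ k) n)" for n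
  proof (induction n)
    case (Suc n)
    have "qpoch x p (k * Suc n) = qpoch x p (k * n) * qpoch (p ^ (k * n) * x) p k"
      by (metis qpoch_add mult_Suc_right add.commute)
    also have "qpoch (p ^ (k * n) * x) p k = (\<Prod>j<k. 1 - (p ^ k) ^ n * (p ^ j * x))"
      by (simp add: qpoch_def power_mult mult_ac)
    finally show ?case by (simp add: Suc qpoch_Suc prod.distrib)
  qed auto
  thus "(\<lambda>n. qpoch x p (k * n)) \<longlonglongrightarrow> (\<Prod>j<k. qpoch_inf (p ^ j * x) (p ^ k))"
    using norm_power_less_1[OF assms] by (auto intro!: tendsto_prod qpoch_tendsto)
qed (use assms in auto)

lemma qpoch_inf_minus:
  assumes "norm p < 1"
  shows "qpoch_inf x p * qpoch_inf (- x) p = qpoch_inf (x ^ 2) (p ^ 2)"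
proof -
  have "qpoch x p n * qpoch (- x) p n = qpoch (x ^ 2) (p ^ 2) n" for n
    unfolding qpoch_def prod.distrib[symmetric]
    by (rule prod.cong) (auto simp: algebra_simps power2_eq_square power_mult_distrib)
  hence "(\<lambda>n. qpoch (x ^ 2) (p ^ 2) n) \<longlonglongrightarrow> qpoch_inf x p * qpoch_inf (- x) p"
    using tendsto_mult[OF qpoch_tendsto[OF assms, of x] qpoch_tendsto[OF assms, of "- x"]] by simp
  moreover have "qpoch (x ^ 2) (p ^ 2) \<longlonglongrightarrow> qpoch_inf (x ^ 2) (p ^ 2)"
    by (intro qpoch_tendsto norm_power_less_1 assms) auto
  ultimately show ?thesis using LIMSEQ_unique by blast
qed

section \<open>Finite theta sums\<close>

text \<open>Extending the reciprocals of \<open>(p;p)\<^sub>m\<close> by zero to negative \<open>m\<close> keeps the recurrence \<open>rpoch_pred\<close>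
  valid for all integers, so that no boundary terms arise below. The nome is \<open>s\<^sup>2\<close> throughout, which
  makes \<open>(-1)\<^sup>N p\<^bsup>N(N-1)/2\<^esup> = (-1)\<^sup>N s\<^bsup>N\<^sup>2 - N\<^esup>\<close> free of halves.\<close>

definition rpoch :: "complex \<Rightarrow> int \<Rightarrow> complex" where
  "rpoch p m = (if m < 0 then 0 else inverse (qpoch p p (nat m)))"

lemma rpoch_neg [simp]: "m < 0 \<Longrightarrow> rpoch p m = 0"
  and rpoch_nat [simp]: "rpoch p (int n) = inverse (qpoch p p n)"
  by (auto simp: rpoch_def)

lemma rpoch_pred:
  assumes "norm p < 1"
  shows "rpoch p (m - 1) = (1 - p powi m) * rpoch p m"
proof (cases "m \<ge> 1")
  case True
  then obtain k where k: "m = int (Suc k)" by (metis Suc_pred zero_less_nat_eq int_nat_eq int_one_le_iff_zero_less order_less_imp_le)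
  have "1 - p * p ^ k \<noteq> 0"
    using qpoch_factor_nz[of p p k] assms by (simp add: mult.commute)
  thus ?thesis
    unfolding k rpoch_nat power_int_of_nat by (simp add: qpoch_Suc mult_ac)
next
  case False
  thus ?thesis by (cases "m = 0") auto
qed

definition theta_coeff :: "complex \<Rightarrow> int \<Rightarrow> complex" where
  "theta_coeff s N = (-1) powi N * s powi (N ^ 2 - N)"

definition theta_weight :: "complex \<Rightarrow> nat \<Rightarrow> int \<Rightarrow> complex" where
  "theta_weight s n N = theta_coeff s N * (rpoch (s ^ 2) (int n - N) * rpoch (s ^ 2) (int n + N))"

text \<open>In Bailey's terminology this is beta_n relative to 1, with alpha_N spread as
  \<open>theta_coeff s N * f N\<close> over positive and negative indices. Because \<open>f\<close>
  is arbitrary, the same recurrences prove Jacobi's identities and verify the Bailey pairs.\<close>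

definition theta_sum :: "complex \<Rightarrow> nat \<Rightarrow> (int \<Rightarrow> complex) \<Rightarrow> complex" where
  "theta_sum s n f = (\<Sum>N\<in>{-int n..int n}. theta_weight s n N * f N)"

lemma theta_coeff_succ:
  assumes "s \<noteq> 0"
  shows "theta_coeff s (N + 1) = - ((s ^ 2) powi N * theta_coeff s N)"
proof -
  have e: "(N + 1) ^ 2 - (N + 1) = 2 * N + (N ^ 2 - N)"
    by (simp add: power2_eq_square algebra_simps)
  have "s powi ((N + 1) ^ 2 - (N + 1)) = (s ^ 2) powi N * s powi (N ^ 2 - N)"
    unfolding e by (subst power_int_add) (use assms in \<open>simp_all add: power_int_power\<close>)
  thus ?thesis
    by (simp add: theta_coeff_def power_int_add)
qed

lemma theta_coeff_pred:
  assumes "s \<noteq> 0"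
  shows "theta_coeff s (N - 1) = - ((s ^ 2) powi (1 - N) * theta_coeff s N)"
  using theta_coeff_succ[OF assms, of "N - 1"] assms
  by (simp add: power_int_diff)

lemma theta_coeff_uminus:
  assumes "s \<noteq> 0"
  shows "theta_coeff s (- N) = (s ^ 2) powi N * theta_coeff s N"
proof -
  have e: "(- N) ^ 2 - (- N) = 2 * N + (N ^ 2 - N)" by simp
  have "s powi ((- N) ^ 2 - (- N)) = (s ^ 2) powi N * s powi (N ^ 2 - N)"
    unfolding e by (subst power_int_add) (use assms in \<open>simp_all add: power_int_power\<close>)
  thus ?thesis
    by (simp only: theta_coeff_def power_int_minus_one_minus mult_ac)
qed

lemma theta_weight_outside:
  "\<bar>N\<bar> > int n \<Longrightarrow> theta_weight s n N = 0"
  by (cases "N \<ge> 0") (auto simp: theta_weight_def)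

lemma theta_sum_shift:
  assumes "finite A" "{-int n + k..int n + k} \<subseteq> A"
  shows "theta_sum s n (\<lambda>N. f (N + k)) = (\<Sum>N\<in>A. theta_weight s n (N - k) * f N)"
proof -
  have "theta_sum s n (\<lambda>N. f (N + k)) = (\<Sum>N\<in>{-int n + k..int n + k}. theta_weight s n (N - k) * f N)"
    unfolding theta_sum_def
    by (rule sum.reindex_bij_witness[of _ "\<lambda>N. N - k" "\<lambda>N. N + k"]) auto
  also have "\<dots> = (\<Sum>N\<in>A. theta_weight s n (N - k) * f N)"
  proof (rule sum.mono_neutral_left)
    show "\<forall>N\<in>A - {-int n + k..int n + k}. theta_weight s n (N - k) * f N = 0"
      by (intro ballI, subst theta_weight_outside) auto
  qed (use assms in auto)
  finally show ?thesis .
qed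

lemma theta_sum_eq:
  assumes "finite A" "{-int n..int n} \<subseteq> A"
  shows "theta_sum s n f = (\<Sum>N\<in>A. theta_weight s n N * f N)"
  using theta_sum_shift[where k = 0] assms by simp

lemma theta_sum_linear:
  "theta_sum s n (\<lambda>N. f N + g N) = theta_sum s n f + theta_sum s n g"
  "theta_sum s n (\<lambda>N. f N - g N) = theta_sum s n f - theta_sum s n g"
  "theta_sum s n (\<lambda>N. - f N) = - theta_sum s n f"
  "theta_sum s n (\<lambda>N. c * f N) = c * theta_sum s n f"
  by (simp_all add: theta_sum_def algebra_simps sum.distrib sum_subtractf sum_distrib_left sum_negf)

lemma theta_sum_0 [simp]: "theta_sum s 0 f = f 0"
  by (simp add: theta_sum_def theta_weight_def theta_coeff_def rpoch_def)

context
  fixes s p :: complex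
  assumes s: "s \<noteq> 0" "norm s < 1" and p_def: "p = s ^ 2"
begin

lemma nome_square: "p \<noteq> 0" "norm p < 1"
  using s by (auto simp: p_def norm_power power_less_one_iff)

text \<open>All neighbouring weights are written over one factor \<open>R\<close>, the product of
  the reciprocals belonging to n+1-N and n+1+N, with polynomials in A = p^(n-N) and B = p^(n+N).
  Recurrences then become ring identities. The factor \<open>p ^ n\<close> before the weight at
  \<open>N - 1\<close> turns p^(1-N) into \<open>p * A\<close>.\<close>

lemma theta_weight_neighbours:
  obtains A B R where
    "p powi N * A = p ^ n" "B = p ^ n * p powi N"
    "theta_weight s (Suc n) N = theta_coeff s N * R"
    "theta_weight s n N = theta_coeff s N * ((1 - p * A) * (1 - p * B) * R)"
    "p ^ n * theta_weight s n (N - 1) = - (theta_coeff s N * (p * A * (1 - p * B) * (1 - B) * R))"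
    "theta_weight s n (N + 1) = - (theta_coeff s N * (p powi N * (1 - p * A) * (1 - A) * R))"
proof
  define a b where "a = int n - N" and "b = int n + N"
  let ?A = "p powi a" and ?B = "p powi b"
  let ?R = "rpoch p (a + 1) * rpoch p (b + 1)"
  have r: "rpoch p a = (1 - p * ?A) * rpoch p (a + 1)" "rpoch p b = (1 - p * ?B) * rpoch p (b + 1)"
          "rpoch p (a - 1) = (1 - ?A) * rpoch p a" "rpoch p (b - 1) = (1 - ?B) * rpoch p b"
    using rpoch_pred[of p "a + 1"] rpoch_pred[of p "b + 1"] rpoch_pred[of p a] rpoch_pred[of p b] nome_square
    by (simp_all add: power_int_add mult_ac)
  show "p powi N * ?A = p ^ n" "?B = p ^ n * p powi N"
    using nome_square by (simp_all add: a_def b_def power_int_add power_int_diff)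
  have e: "int (Suc n) - N = a + 1" "int (Suc n) + N = b + 1" "int n - N = a" "int n + N = b"
    "int n - (N - 1) = a + 1" "int n + (N - 1) = b - 1" "int n - (N + 1) = a - 1" "int n + (N + 1) = b + 1"
    by (simp_all add: a_def b_def)
  show "theta_weight s (Suc n) N = theta_coeff s N * ?R"
    by (simp only: theta_weight_def e flip: p_def)
  show "theta_weight s n N = theta_coeff s N * ((1 - p * ?A) * (1 - p * ?B) * ?R)"
    by (simp only: theta_weight_def e r(1,2) mult_ac flip: p_def)
  have pA: "p ^ n * p powi (1 - N) = p * ?A"
    using nome_square by (simp add: a_def power_int_diff)
  have "p ^ n * theta_weight s n (N - 1) =
      - (theta_coeff s N * ((p ^ n * p powi (1 - N)) * ((1 - p * ?B) * (1 - ?B) * ?R)))"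
    unfolding theta_weight_def theta_coeff_pred[OF s(1)] e p_def[symmetric] r(2,4)
    by (simp add: mult_ac)
  thus "p ^ n * theta_weight s n (N - 1) = - (theta_coeff s N * (p * ?A * (1 - p * ?B) * (1 - ?B) * ?R))"
    unfolding pA by (simp add: mult_ac)
  show "theta_weight s n (N + 1) = - (theta_coeff s N * (p powi N * (1 - p * ?A) * (1 - ?A) * ?R))"
    unfolding theta_weight_def theta_coeff_succ[OF s(1)] e p_def[symmetric] r(1,3) by algebra
qed

text \<open>Weights that are polynomial multiples of one factor satisfy several linear relations.
  The first one advances \<open>n\<close>. The second has an extra \<open>p powi N\<close> on the
  left, which is the factor that the recurrence of the Hecke coefficients produces later.\<close>

lemma theta_weight_Suc:
  "(1 - p ^ (2 * n + 1)) * (1 - p ^ (2 * n + 2)) * theta_weight s (Suc n) N =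
     (1 + p ^ (2 * n + 1)) * theta_weight s n N
     - p ^ n * theta_weight s n (N - 1) - p ^ (n + 1) * theta_weight s n (N + 1)" (is ?rec)
  and theta_weight_Suc':
  "(1 - p ^ (2 * n + 1)) * (1 - p ^ (2 * n + 2)) * (p powi N * theta_weight s (Suc n) N) =
     - (theta_weight s n (N + 1) - (p ^ (n + 1) + p ^ n) * theta_weight s n N
        + p ^ (2 * n + 1) * theta_weight s n (N - 1))" (is ?rec')
proof -
  define P where "P = p powi N"
  obtain A B R where w:
    "P * A = p ^ n" "B = p ^ n * P"
    "theta_weight s (Suc n) N = theta_coeff s N * R"
    "theta_weight s n N = theta_coeff s N * ((1 - p * A) * (1 - p * B) * R)"
    "p ^ n * theta_weight s n (N - 1) = - (theta_coeff s N * (p * A * (1 - p * B) * (1 - B) * R))"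
    "theta_weight s n (N + 1) = - (theta_coeff s N * (P * (1 - p * A) * (1 - A) * R))"
    unfolding P_def by (rule theta_weight_neighbours)
  have pw: "p ^ (2 * n + 1) = p * p ^ n * p ^ n" "p ^ (2 * n + 2) = p * p * p ^ n * p ^ n"
    "p ^ (n + 1) = p * p ^ n"
    by (simp_all add: mult_2 power_add)
  have w5': "p * p ^ n * p ^ n * theta_weight s n (N - 1) =
      p * p ^ n * - (theta_coeff s N * (p * A * (1 - p * B) * (1 - B) * R))"
    unfolding w(5)[symmetric] by (simp only: mult.assoc)
  show ?rec
    unfolding pw w(3,4,5,6) w(2) unfolding w(1)[symmetric] by (simp add: algebra_simps)
  show ?rec'
    unfolding pw w(3,4,6) w5' P_def[symmetric] w(2) unfolding w(1)[symmetric]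
    by (simp add: algebra_simps)
qed

lemma theta_sum_Suc:
  "(1 - p ^ (2 * n + 1)) * (1 - p ^ (2 * n + 2)) * theta_sum s (Suc n) f =
     (1 + p ^ (2 * n + 1)) * theta_sum s n f
     - p ^ n * theta_sum s n (\<lambda>N. f (N + 1)) - p ^ (n + 1) * theta_sum s n (\<lambda>N. f (N - 1))"
proof -
  \<comment> \<open>The enlarged range contains the supports of all three shifted weights.\<close>
  define A where "A = {-int (Suc n)..int (Suc n)}"
  have A: "finite A" "{-int n..int n} \<subseteq> A" "{-int n + 1..int n + 1} \<subseteq> A" "{-int n + (-1)..int n + (-1)} \<subseteq> A"
    by (auto simp: A_def)
  have "(1 - p ^ (2 * n + 1)) * (1 - p ^ (2 * n + 2)) * theta_sum s (Suc n) f =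
        (\<Sum>N\<in>A. ((1 - p ^ (2 * n + 1)) * (1 - p ^ (2 * n + 2)) * theta_weight s (Suc n) N) * f N)"
    unfolding theta_sum_def sum_distrib_left A_def by (simp add: mult_ac)
  also have "\<dots> = (1 + p ^ (2 * n + 1)) * (\<Sum>N\<in>A. theta_weight s n N * f N)
     - p ^ n * (\<Sum>N\<in>A. theta_weight s n (N - 1) * f N) - p ^ (n + 1) * (\<Sum>N\<in>A. theta_weight s n (N - (-1)) * f N)"
    unfolding theta_weight_Suc
    by (simp add: sum_subtractf sum.distrib sum_distrib_left algebra_simps)
  finally show ?thesis
    unfolding theta_sum_shift[OF A(1,3), symmetric] theta_sum_shift[OF A(1,4), symmetric]
      theta_sum_eq[OF A(1,2), symmetric] by simp
qed

lemma theta_sum_Suc':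
  "(1 - p ^ (2 * n + 1)) * (1 - p ^ (2 * n + 2)) * theta_sum s (Suc n) (\<lambda>N. p powi N * f N) =
     - (theta_sum s n (\<lambda>N. f (N - 1)) - (p ^ (n + 1) + p ^ n) * theta_sum s n f
        + p ^ (2 * n + 1) * theta_sum s n (\<lambda>N. f (N + 1)))"
proof -
  define A where "A = {-int (Suc n)..int (Suc n)}"
  have A: "finite A" "{-int n..int n} \<subseteq> A" "{-int n + 1..int n + 1} \<subseteq> A" "{-int n + (-1)..int n + (-1)} \<subseteq> A"
    by (auto simp: A_def)
  have "(1 - p ^ (2 * n + 1)) * (1 - p ^ (2 * n + 2)) * theta_sum s (Suc n) (\<lambda>N. p powi N * f N) =
        (\<Sum>N\<in>A. ((1 - p ^ (2 * n + 1)) * (1 - p ^ (2 * n + 2)) * (p powi N * theta_weight s (Suc n) N)) * f N)"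
    unfolding theta_sum_def sum_distrib_left A_def by (simp add: mult_ac)
  also have "\<dots> = - ((\<Sum>N\<in>A. theta_weight s n (N - (-1)) * f N) - (p ^ (n + 1) + p ^ n) * (\<Sum>N\<in>A. theta_weight s n N * f N)
     + p ^ (2 * n + 1) * (\<Sum>N\<in>A. theta_weight s n (N - 1) * f N))"
    unfolding theta_weight_Suc'
    by (simp add: sum_subtractf sum.distrib sum_distrib_left algebra_simps)
  finally show ?thesis
    unfolding theta_sum_shift[OF A(1,3), symmetric] theta_sum_shift[OF A(1,4), symmetric]
      theta_sum_eq[OF A(1,2), symmetric] by simp
qed

lemma theta_sum_reflect:
  "theta_sum s n f = theta_sum s n (\<lambda>N. p powi N * f (- N))"
proof -
  have "theta_sum s n f = (\<Sum>N\<in>{-int n..int n}. theta_weight s n (- N) * f (- N))"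
    unfolding theta_sum_def by (rule sum.reindex_bij_witness[of _ uminus uminus]) auto
  thus ?thesis
    by (simp add: theta_sum_def theta_weight_def theta_coeff_uminus[OF s(1)] p_def mult_ac)
qed

lemma one_minus_nome_power_nz: "1 - p ^ Suc n \<noteq> 0"
  using qpoch_factor_nz[of p p n] nome_square by (simp add: mult.commute)

text \<open>Finite form of Jacobi's triple product. On powers of z the two shifts act as
  multiplication by z and 1/z, and the resulting multiplier 1 + p^(2n+1) - p^n z - p^(n+1)/z splits
  into the factors that the products on the right gain.\<close>

lemma theta_sum_powi:
  assumes "z \<noteq> 0"
  shows "theta_sum s n (\<lambda>N. z powi N) = qpoch z p n * qpoch (p / z) p n / qpoch p p (2 * n)"
proof (induction n)
  case (Suc n)
  let ?D = "(1 - p ^ (2 * n + 1)) * (1 - p ^ (2 * n + 2))"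
  have D: "?D \<noteq> 0" using one_minus_nome_power_nz[of "2 * n"] one_minus_nome_power_nz[of "2 * n + 1"] by simp
  have q: "qpoch p p (2 * Suc n) = qpoch p p (2 * n) * ?D"
    by (simp add: qpoch_Suc mult_ac)
  have "?D * theta_sum s (Suc n) (\<lambda>N. z powi N) =
      (1 + p ^ (2 * n + 1) - p ^ n * z - p ^ (n + 1) / z) * theta_sum s n (\<lambda>N. z powi N)"
    unfolding theta_sum_Suc using assms
    by (simp add: power_int_add power_int_diff theta_sum_linear algebra_simps divide_inverse)
  also have "1 + p ^ (2 * n + 1) - p ^ n * z - p ^ (n + 1) / z = (1 - p ^ n * z) * (1 - p ^ n * (p / z))"
    using assms by (simp add: field_simps power_add power_mult power2_eq_square)
  finally have "theta_sum s (Suc n) (\<lambda>N. z powi N) =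
     (1 - p ^ n * z) * (1 - p ^ n * (p / z)) * theta_sum s n (\<lambda>N. z powi N) / ?D"
    using D by (metis nonzero_mult_div_cancel_left)
  thus ?case unfolding Suc q by (simp add: qpoch_Suc mult_ac)
qed auto

text \<open>At z = p the first factor of \<open>qpoch (p / z) p n\<close> vanishes. This is what
  annihilates inhomogeneous terms in the Bailey pair below.\<close>

lemma theta_sum_p:
  assumes "n > 0"
  shows "theta_sum s n (\<lambda>N. p powi N) = 0"
proof -
  obtain m where "n = Suc m" using assms by (cases n) auto
  thus ?thesis using theta_sum_powi[OF nome_square(1), of n] nome_square
    by (simp add: qpoch_Suc_left)
qed

lemma theta_sum_1:
  assumes "n > 0"
  shows "theta_sum s n (\<lambda>N. 1) = 0"
  using theta_sum_powi[of 1 n] assms by (cases n) (auto simp: qpoch_Suc_left)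

text \<open>The derivative of the finite triple product at z = 1, obtained by recurrence instead of
  differentiation. Shifting the identity by one adds a constant, whose sum vanishes only for
  positive \<open>n\<close>; hence the index starts at one and the first value is computed
  separately.\<close>

lemma theta_sum_ident:
  "theta_sum s (Suc n) of_int = - (qpoch p p n * qpoch p p (Suc n) / qpoch p p (2 * Suc n))"
proof (induction n)
  case 0
  have nz: "1 - p \<noteq> 0" "1 - p * p \<noteq> 0"
    using one_minus_nome_power_nz[of 0] one_minus_nome_power_nz[of 1] by simp_all
  have "(1 - p) * ((1 - p * p) * theta_sum s (Suc 0) of_int) = (1 - p) * (- 1)"
    using theta_sum_Suc[of 0 of_int] by (simp add: power2_eq_square mult.assoc)
  hence "(1 - p * p) * theta_sum s (Suc 0) of_int = - 1"
    using nz by (metis mult_left_cancel)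
  hence S: "theta_sum s (Suc 0) of_int = - 1 / (1 - p * p)"
    using nz by (metis nonzero_mult_div_cancel_left)
  show ?case unfolding S using nz by (simp add: numeral_2_eq_2 qpoch_Suc)
next
  case (Suc n)
  let ?m = "Suc n"
  let ?D = "(1 - p ^ (2 * ?m + 1)) * (1 - p ^ (2 * ?m + 2))"
  have D: "?D \<noteq> 0" using one_minus_nome_power_nz[of "2 * ?m"] one_minus_nome_power_nz[of "2 * ?m + 1"] by simp
  have q: "qpoch p p (2 * Suc ?m) = qpoch p p (2 * ?m) * ?D"
    by (simp add: qpoch_Suc mult_ac)
  have "?D * theta_sum s (Suc ?m) of_int = (1 + p ^ (2 * ?m + 1) - p ^ ?m - p ^ (?m + 1)) * theta_sum s ?m of_int"
    unfolding theta_sum_Suc using theta_sum_1[of ?m]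
    by (simp add: theta_sum_linear algebra_simps)
  also have "1 + p ^ (2 * ?m + 1) - p ^ ?m - p ^ (?m + 1) = (1 - p ^ ?m) * (1 - p ^ (?m + 1))"
    by (simp add: algebra_simps power_add power_mult power2_eq_square)
  finally have "theta_sum s (Suc ?m) of_int = (1 - p ^ ?m) * (1 - p ^ (?m + 1)) * theta_sum s ?m of_int / ?D"
    using D by (metis nonzero_mult_div_cancel_left)
  thus ?case unfolding Suc q by (simp add: qpoch_Suc mult_ac)
qed

end

section \<open>Jacobi's triple product and cube identities\<close>

lemma summable_on_power_abs:
  fixes t :: real
  assumes "0 \<le> t" "t < 1"
  shows "(\<lambda>n::int. t ^ nat \<bar>n\<bar>) summable_on UNIV"
proof -
  have g: "(\<lambda>n. t ^ n) summable_on UNIV"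
    by (subst summable_on_UNIV_nonneg_real_iff) (use assms in \<open>auto intro: summable_geometric\<close>)
  have 1: "(\<lambda>n::int. t ^ nat \<bar>n\<bar>) summable_on {0..}"
    using g by (subst summable_on_reindex_bij_witness[of _ int nat UNIV "\<lambda>n. t ^ n"]) auto
  have Suc: "nat (- n) = Suc (nat (- 1 - n))" if "n < 0" for n :: int
    using that by auto
  have 2: "(\<lambda>n::int. t ^ nat \<bar>n\<bar>) summable_on {..<0}"
    using summable_on_cmult_right[OF g, of t]
    by (subst summable_on_reindex_bij_witness[of _ "\<lambda>n. - 1 - int n" "\<lambda>n. nat (- 1 - n)" UNIV "\<lambda>n. t * t ^ n"])
       (auto simp: Suc)
  have "{0..} \<union> {..<0} = (UNIV :: int set)" "{0..} \<inter> {..<0::int} = {}" by auto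
  thus ?thesis using summable_on_Un_disjoint[OF 1 2] by simp
qed

text \<open>Exponential growth is converted into a linear exponent of \<open>t\<close>, which a
  quadratic exponent can absorb.\<close>

lemma power_le_powi_abs:
  fixes t r :: real
  assumes "0 < t" "t < 1"
  obtains c :: nat where "\<And>m. r \<ge> 0 \<Longrightarrow> r ^ m \<le> t powi (- (int c * int m))"
proof -
  obtain c where c: "t ^ c < inverse (\<bar>r\<bar> + 1)"
    using real_arch_pow_inv[of "inverse (\<bar>r\<bar> + 1)" t] assms
    by (auto simp: add_nonneg_pos)
  have "\<bar>r\<bar> * t ^ c \<le> (\<bar>r\<bar> + 1) * inverse (\<bar>r\<bar> + 1)"
    by (intro mult_mono) (use c assms in auto)
  hence *: "\<bar>r * t ^ c\<bar> \<le> 1" using assms by (simp add: abs_mult)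
  have le: "r ^ m * t ^ (c * m) \<le> 1" for m
  proof -
    have "\<bar>(r * t ^ c) ^ m\<bar> \<le> 1" using * by (simp add: power_abs power_le_one)
    thus ?thesis by (simp add: power_mult_distrib power_mult)
  qed
  show ?thesis
  proof (rule that)
    fix m
    have "t powi (int c * int m) = t ^ (c * m)" by (metis of_nat_mult power_int_of_nat)
    hence "t powi (- (int c * int m)) = 1 / t ^ (c * m)" by (simp add: power_int_minus_divide)
    thus "r ^ m \<le> t powi (- (int c * int m))"
      using le[of m] assms by (simp add: pos_le_divide_eq)
  qed
qed

lemma summable_on_quadratic_powi:
  fixes t r :: real
  assumes t: "0 < t" "t < 1" and e: "\<And>n. e n \<ge> n ^ 2 - int k * \<bar>n\<bar>"
    and f: "\<And>n. 0 \<le> f n" "\<And>n. f n \<le> r ^ nat \<bar>n\<bar>" and r: "r \<ge> 0"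
  shows "(\<lambda>n::int. t powi (e n) * f n) summable_on UNIV"
proof -
  obtain c where c: "\<And>m. r \<ge> 0 \<Longrightarrow> r ^ m \<le> t powi (- (int c * int m))"
    using power_le_powi_abs[OF t] by blast
  \<comment> \<open>With b = k + c + 1, positivity of a^2 - b a + b^2 at a = |n| gives n^2 - (k +
    c)|n| >= |n| - b^2; so \<open>K\<close> is b^2.\<close>
  define K where "K = (int k + int c + 1) ^ 2"
  have "(\<lambda>n::int. t powi (- K) * t ^ nat \<bar>n\<bar>) summable_on UNIV"
    by (intro summable_on_cmult_right summable_on_power_abs) (use t in auto)
  thus ?thesis
  proof (rule summable_on_comparison_test)
    fix n :: int
    have "f n \<le> t powi (- (int c * \<bar>n\<bar>))"
      using order.trans[OF f(2)[of n] c[OF r, of "nat \<bar>n\<bar>"]] by simp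
    hence "t powi (e n) * f n \<le> t powi (e n) * t powi (- (int c * \<bar>n\<bar>))"
      using t by (intro mult_left_mono) auto
    also have "\<dots> = t powi (e n - int c * \<bar>n\<bar>)"
      using t by (simp flip: power_int_add)
    also have "\<dots> \<le> t powi (- K + \<bar>n\<bar>)"
    proof (rule power_int_decreasing)
      define a b where "a = \<bar>n\<bar>" and "b = int k + int c + 1"
      have "2 * (a ^ 2 - b * a + b ^ 2) = a ^ 2 + b ^ 2 + (a - b) ^ 2"
        by (simp add: power2_eq_square algebra_simps)
      moreover have "a ^ 2 + b ^ 2 + (a - b) ^ 2 \<ge> 0" by (intro add_nonneg_nonneg zero_le_power2)
      ultimately have "2 * (a ^ 2 - b * a + b ^ 2) \<ge> 0" by (simp only:)
      hence "a ^ 2 - b * a + b ^ 2 \<ge> 0" by simp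
      moreover have "n ^ 2 = a ^ 2" by (simp add: a_def)
      moreover have "b * a = int k * a + int c * a + a" by (simp add: b_def algebra_simps)
      ultimately have "- (b ^ 2) + a \<le> e n - int c * a"
        using e[of n] unfolding a_def[symmetric] by linarith
      thus "- K + \<bar>n\<bar> \<le> e n - int c * \<bar>n\<bar>"
        by (simp only: K_def a_def b_def)
    qed (use t in auto)
    also have "\<dots> = t powi (- K) * t ^ nat \<bar>n\<bar>"
      by (subst power_int_add) (use t in \<open>auto simp: power_int_def\<close>)
    finally show "t powi (e n) * f n \<le> t powi (- K) * t ^ nat \<bar>n\<bar>" .
  qed (use t f in auto)
qed

lemma norm_powi [simp]: "norm (x powi n) = norm (x :: complex) powi n"
  by (simp add: norm_power_int)

lemma summable_on_quadratic:
  fixes s :: complex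
  assumes s: "s \<noteq> 0" "norm s < 1" and e: "\<And>n. e n \<ge> n ^ 2 - int k * \<bar>n\<bar>"
    and f: "\<And>n. norm (f n) \<le> r ^ nat \<bar>n\<bar>" and r: "r \<ge> 0"
  shows "(\<lambda>n::int. s powi (e n) * f n) summable_on UNIV"
  unfolding summable_on_iff_abs_summable_on_complex
  using summable_on_quadratic_powi[of "norm s" k e "\<lambda>n. norm (f n)" r] assms
  by (simp add: norm_mult)

lemma norm_minus_one_powi [simp]: "norm ((-1 :: complex) powi n) = 1"
  by (simp add: norm_power_int)

lemma powi_le_power_abs:
  fixes z :: real
  assumes "z > 0"
  shows "z powi n \<le> (max z (inverse z)) ^ nat \<bar>n\<bar>"
proof (cases "n \<ge> 0")
  case True
  thus ?thesis using assms by (simp add: power_int_def power_mono)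
next
  case False
  thus ?thesis using assms by (auto simp: power_int_def intro!: power_mono)
qed

lemma theta_coeff_summable:
  assumes "s \<noteq> 0" "norm s < 1" "\<And>n. norm (f n) \<le> r ^ nat \<bar>n\<bar>" "r \<ge> 0"
  shows "(\<lambda>n. theta_coeff s n * f n) summable_on UNIV"
proof -
  have "(\<lambda>n. s powi (n ^ 2 - n) * ((-1) powi n * f n)) summable_on UNIV"
    by (rule summable_on_quadratic[where k = 1 and r = r]) (use assms in \<open>auto simp: norm_mult\<close>)
  thus ?thesis by (simp add: theta_coeff_def mult_ac)
qed

lemma theta_coeff_powi_summable:
  assumes "s \<noteq> 0" "norm s < 1" "z \<noteq> 0"
  shows "(\<lambda>n. theta_coeff s n * z powi n) summable_on UNIV"
  by (rule theta_coeff_summable[where r = "max (norm z) (inverse (norm z))"])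
     (use assms powi_le_power_abs[of "norm z"] in \<open>auto simp: le_max_iff_disj\<close>)

section \<open>Limits of the finite theta sums\<close>

lemma rpoch_bounded:
  assumes "norm p < 1"
  obtains C where "C \<ge> 1" "\<And>m. norm (rpoch p m) \<le> C"
proof -
  obtain C where C: "C \<ge> 1" "\<And>n. norm (inverse (qpoch p p n)) \<le> C"
    by (rule qpoch_bounds[OF assms, of p]) (use assms in blast)
  show ?thesis by (rule that[of C]) (use C in \<open>auto simp: rpoch_def\<close>)
qed

lemma rpoch_tendsto:
  assumes "norm p < 1"
  shows "(\<lambda>n. rpoch p (int n + k)) \<longlonglongrightarrow> inverse (qpoch_inf p p)"
proof -
  have "filterlim (\<lambda>n. nat (int n + k)) sequentially sequentially"
    unfolding filterlim_at_top
  proof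
    fix Z :: nat
    show "\<forall>\<^sub>F n in sequentially. Z \<le> nat (int n + k)"
      using eventually_ge_at_top[of "Z + nat \<bar>k\<bar>"] by eventually_elim auto
  qed
  hence "(\<lambda>n. inverse (qpoch p p (nat (int n + k)))) \<longlonglongrightarrow> inverse (qpoch_inf p p)"
    by (intro tendsto_inverse qpoch_inf_nz filterlim_compose[OF qpoch_tendsto]) (use assms in auto)
  moreover have "\<forall>\<^sub>F n in sequentially. inverse (qpoch p p (nat (int n + k))) = rpoch p (int n + k)"
    using eventually_ge_at_top[of "nat \<bar>k\<bar>"] by eventually_elim (auto simp: rpoch_def)
  ultimately show ?thesis by (rule Lim_transform_eventually)
qed

text \<open>Each weight tends to its coefficient divided by the square of the Euler product.
  Boundedness of the reciprocals dominates all weights by a multiple of the coefficients.\<close>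

lemma theta_sum_tendsto:
  assumes "s \<noteq> 0" "norm s < 1" "((\<lambda>N. theta_coeff s N * f N) has_sum S) UNIV"
  shows "(\<lambda>n. theta_sum s n f) \<longlonglongrightarrow> inverse (qpoch_inf (s ^ 2) (s ^ 2)) ^ 2 * S"
proof -
  let ?p = "s ^ 2"
  have p: "norm ?p < 1" using assms by (simp add: norm_power_less_1)
  obtain C where C: "C \<ge> 1" "\<And>m. norm (rpoch ?p m) \<le> C" using rpoch_bounded[OF p] by metis
  show ?thesis
  proof (rule dominated_has_sum_tendsto[where A = UNIV and M = "\<lambda>N. C * C * norm (theta_coeff s N * f N)"])
    show "norm (theta_weight s n N * f N) \<le> C * C * norm (theta_coeff s N * f N)" for n N
    proof -
      have "norm (rpoch ?p (int n - N) * rpoch ?p (int n + N)) \<le> C * C"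
        unfolding norm_mult by (intro mult_mono C) (use C in auto)
      hence "norm (rpoch ?p (int n - N) * rpoch ?p (int n + N)) * norm (theta_coeff s N * f N) \<le>
             C * C * norm (theta_coeff s N * f N)" by (rule mult_right_mono) auto
      thus ?thesis by (simp add: theta_weight_def norm_mult mult_ac)
    qed
    show "(\<lambda>N. C * C * norm (theta_coeff s N * f N)) summable_on UNIV"
      using has_sum_imp_summable[OF assms(3)]
      by (intro summable_on_cmult_right) (simp add: summable_on_iff_abs_summable_on_complex)
    show "(\<lambda>n. theta_weight s n N * f N) \<longlonglongrightarrow> inverse (qpoch_inf ?p ?p) ^ 2 * (theta_coeff s N * f N)" for N
    proof -
      have "(\<lambda>n. theta_coeff s N * (rpoch ?p (int n + (-N)) * rpoch ?p (int n + N)) * f N) \<longlonglongrightarrow>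
          theta_coeff s N * (inverse (qpoch_inf ?p ?p) * inverse (qpoch_inf ?p ?p)) * f N"
        by (intro tendsto_intros rpoch_tendsto p)
      thus ?thesis by (simp add: theta_weight_def power2_eq_square mult_ac)
    qed
    show "((\<lambda>N. inverse (qpoch_inf ?p ?p) ^ 2 * (theta_coeff s N * f N)) has_sum
           inverse (qpoch_inf ?p ?p) ^ 2 * S) UNIV"
      by (rule has_sum_cmult_right[OF assms(3)])
    show "((\<lambda>N. theta_weight s n N * f N) has_sum theta_sum s n f) UNIV" for n
      unfolding theta_sum_def
      by (rule has_sum_finite_neutralI[of "{-int n..int n}"]) (auto simp: theta_weight_outside)
  qed
qed

text \<open>The limit of \<open>theta_sum_powi\<close>. The weights contribute two reciprocal Euler
  products and the product of length 2n one, so a single Euler product is left.\<close>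

theorem jacobi_triple_product:
  assumes s: "s \<noteq> 0" "norm s < 1" and z: "z \<noteq> 0"
  shows "((\<lambda>N. theta_coeff s N * z powi N) has_sum theta_j z (s ^ 2)) UNIV"
proof -
  let ?p = "s ^ 2"
  define S where "S = (\<Sum>\<^sub>\<infinity>N. theta_coeff s N * z powi N)"
  have p: "norm ?p < 1" using assms by (simp add: norm_power_less_1)
  have hs: "((\<lambda>N. theta_coeff s N * z powi N) has_sum S) UNIV"
    unfolding S_def by (intro has_sum_infsum theta_coeff_powi_summable s z)
  have "(\<lambda>n. theta_sum s n (\<lambda>N. z powi N)) \<longlonglongrightarrow> inverse (qpoch_inf ?p ?p) ^ 2 * S"
    by (rule theta_sum_tendsto[OF s hs])
  moreover have "(\<lambda>n. qpoch ?p ?p (2 * n)) \<longlonglongrightarrow> qpoch_inf ?p ?p"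
    by (rule filterlim_compose[OF qpoch_tendsto[OF p] mult_nat_left_at_top]) auto
  hence "(\<lambda>n. qpoch z ?p n * qpoch (?p / z) ?p n / qpoch ?p ?p (2 * n)) \<longlonglongrightarrow>
      qpoch_inf z ?p * qpoch_inf (?p / z) ?p / qpoch_inf ?p ?p"
    by (intro tendsto_intros qpoch_tendsto p qpoch_inf_nz)
  ultimately have "inverse (qpoch_inf ?p ?p) ^ 2 * S = qpoch_inf z ?p * qpoch_inf (?p / z) ?p / qpoch_inf ?p ?p"
    unfolding theta_sum_powi[OF s refl z] using LIMSEQ_unique by blast
  hence "S = theta_j z ?p"
    using qpoch_inf_nz[OF p p] by (simp add: theta_j_def field_simps power2_eq_square)
  thus ?thesis using hs by simp
qed

text \<open>The limit of \<open>theta_sum_ident\<close>; in terms of generating functions, the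
  derivative of the triple product at its zero z = 1.\<close>

theorem jacobi_cube:
  assumes s: "s \<noteq> 0" "norm s < 1"
  shows "((\<lambda>N. theta_coeff s N * of_int N) has_sum - (qpoch_inf (s ^ 2) (s ^ 2) ^ 3)) UNIV"
proof -
  let ?p = "s ^ 2"
  define S where "S = (\<Sum>\<^sub>\<infinity>N. theta_coeff s N * of_int N)"
  have p: "norm ?p < 1" using assms by (simp add: norm_power_less_1)
  have le: "real k \<le> 2 ^ k" for k using less_exp[of k] by (metis less_imp_le of_nat_le_iff of_nat_numeral of_nat_power)
  have "(\<lambda>N. theta_coeff s N * of_int N) summable_on UNIV"
  proof (rule theta_coeff_summable[where r = 2, OF s])
    fix n :: int
    show "norm (complex_of_int n) \<le> 2 ^ nat \<bar>n\<bar>" using le[of "nat \<bar>n\<bar>"] by simp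
  qed auto
  hence hs: "((\<lambda>N. theta_coeff s N * of_int N) has_sum S) UNIV"
    unfolding S_def by (rule has_sum_infsum)
  have "(\<lambda>n. theta_sum s n of_int) \<longlonglongrightarrow> inverse (qpoch_inf ?p ?p) ^ 2 * S"
    by (rule theta_sum_tendsto[OF s hs])
  hence "(\<lambda>n. theta_sum s (Suc n) of_int) \<longlonglongrightarrow> inverse (qpoch_inf ?p ?p) ^ 2 * S"
    by (rule LIMSEQ_Suc)
  moreover have "(\<lambda>n. qpoch ?p ?p (2 * Suc n)) \<longlonglongrightarrow> qpoch_inf ?p ?p"
    by (rule LIMSEQ_Suc, rule filterlim_compose[OF qpoch_tendsto[OF p] mult_nat_left_at_top]) auto
  hence "(\<lambda>n. - (qpoch ?p ?p n * qpoch ?p ?p (Suc n) / qpoch ?p ?p (2 * Suc n))) \<longlonglongrightarrow>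
      - (qpoch_inf ?p ?p * qpoch_inf ?p ?p / qpoch_inf ?p ?p)"
    by (intro tendsto_intros qpoch_tendsto LIMSEQ_Suc[OF qpoch_tendsto] p qpoch_inf_nz)
  ultimately have "inverse (qpoch_inf ?p ?p) ^ 2 * S = - (qpoch_inf ?p ?p * qpoch_inf ?p ?p / qpoch_inf ?p ?p)"
    unfolding theta_sum_ident[OF s refl] using LIMSEQ_unique by blast
  hence "S = - (qpoch_inf ?p ?p ^ 3)"
    using qpoch_inf_nz[OF p p] by (simp add: field_simps power2_eq_square power3_eq_cube)
  thus ?thesis using hs by simp
qed

section \<open>A Bailey pair\<close>

lemma powi_add: "x \<noteq> 0 \<Longrightarrow> (x :: complex) powi (m + n) = x powi m * x powi n"
  by (simp add: power_int_add)

text \<open>The sum of \<open>\<plusminus>Q\<^bsup>ij\<^esup>\<close> over \<open>i + j = N\<close>, with sign plus for \<open>i, j \<ge> 0\<close> and minus for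
  \<open>i, j < 0\<close>; for each \<open>N\<close> at least one of the two index ranges is empty.\<close>

definition hecke_coeff :: "complex \<Rightarrow> int \<Rightarrow> complex" where
  "hecke_coeff Q N = (\<Sum>i\<in>{0..N}. Q powi (i * (N - i))) - (\<Sum>i\<in>{N+1..-1}. Q powi (i * (N - i)))"

text \<open>Moving \<open>i\<close> by one multiplies a summand by Q^(N-1), so both sides differ
  only in the end terms i = 0 and i = N, each equal to 1. For N = 0 the two ends coincide, hence the
  separate case.\<close>

lemma hecke_coeff_rec:
  assumes "Q \<noteq> 0"
  shows "hecke_coeff Q N = 2 + Q powi (N - 1) * hecke_coeff Q (N - 2)"
proof -
  have shift: "Q powi (N - 1) * (\<Sum>i\<in>{a..b}. Q powi (i * (N - 2 - i))) =
      (\<Sum>i\<in>{a+1..b+1}. Q powi (i * (N - i)))" for a b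
  proof -
    have "Q powi (N - 1) * (\<Sum>i\<in>{a..b}. Q powi (i * (N - 2 - i))) =
        (\<Sum>i\<in>{a..b}. Q powi (N - 1) * Q powi (i * (N - 2 - i)))"
      by (rule sum_distrib_left)
    also have "\<dots> = (\<Sum>i\<in>{a+1..b+1}. Q powi (i * (N - i)))"
    proof (rule sum.reindex_bij_witness[of _ "\<lambda>i. i - 1" "\<lambda>i. i + 1"])
      fix i
      have "(i + 1) * (N - (i + 1)) = (N - 1) + i * (N - 2 - i)" by (simp add: algebra_simps)
      thus "Q powi ((i + 1) * (N - (i + 1))) = Q powi (N - 1) * Q powi (i * (N - 2 - i))"
        by (simp only: powi_add[OF assms])
    qed auto
    finally show ?thesis .
  qed
  have e: "Q powi (N - 1) * hecke_coeff Q (N - 2) =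
      (\<Sum>i\<in>{1..N-1}. Q powi (i * (N - i))) - (\<Sum>i\<in>{N..0}. Q powi (i * (N - i)))"
    unfolding hecke_coeff_def by (simp add: right_diff_distrib[of "Q powi (N - 1)"] shift)
  consider "N \<ge> 1" | "N = 0" | "N \<le> -1" by linarith
  thus ?thesis
  proof cases
    case 1
    hence "{0..N} = insert 0 (insert N {1..N-1})" by auto
    thus ?thesis using 1 unfolding e by (simp add: hecke_coeff_def)
  next
    case 2
    thus ?thesis unfolding e by (simp add: hecke_coeff_def)
  next
    case 3
    hence "{N..0} = insert 0 (insert N {N+1..-1})" by auto
    thus ?thesis using 3 unfolding e by (simp add: hecke_coeff_def)
  qed
qed

text \<open>The substitution i -> -1 - i interchanges the two index ranges, whence the sign.\<close>

lemma hecke_coeff_reflect: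
  assumes "Q \<noteq> 0"
  shows "hecke_coeff Q (- 2 - N) = - (Q powi (N + 1) * hecke_coeff Q N)"
proof -
  have shift: "Q powi (N + 1) * (\<Sum>i\<in>{a..b}. Q powi (i * (N - i))) =
      (\<Sum>i\<in>{-1-b..-1-a}. Q powi (i * (- 2 - N - i)))" for a b
  proof -
    have "Q powi (N + 1) * (\<Sum>i\<in>{a..b}. Q powi (i * (N - i))) =
        (\<Sum>i\<in>{a..b}. Q powi (N + 1) * Q powi (i * (N - i)))"
      by (rule sum_distrib_left)
    also have "\<dots> = (\<Sum>i\<in>{-1-b..-1-a}. Q powi (i * (- 2 - N - i)))"
    proof (rule sum.reindex_bij_witness[of _ "\<lambda>i. -1-i" "\<lambda>i. -1-i"])
      fix i
      have "(-1-i) * (- 2 - N - (-1-i)) = (N + 1) + i * (N - i)" by (simp add: algebra_simps)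
      thus "Q powi ((-1-i) * (- 2 - N - (-1-i))) = Q powi (N + 1) * Q powi (i * (N - i))"
        by (simp only: powi_add[OF assms])
    qed auto
    finally show ?thesis .
  qed
  have "Q powi (N + 1) * hecke_coeff Q N = (\<Sum>i\<in>{-1-N..-1}. Q powi (i * (- 2 - N - i)))
      - (\<Sum>i\<in>{0..-2-N}. Q powi (i * (- 2 - N - i)))"
    unfolding hecke_coeff_def by (simp add: right_diff_distrib[of "Q powi (N + 1)"] shift)
  thus ?thesis by (simp add: hecke_coeff_def)
qed

context
  fixes s p :: complex
  assumes s: "s \<noteq> 0" "norm s < 1" and p_def: "p = s ^ 2"
begin

text \<open>The remaining part of alpha: the sign and the quadratic power sit in
  \<open>theta_coeff\<close>.\<close>

private definition lam :: "int \<Rightarrow> complex" where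
  "lam N = p powi N * hecke_coeff p N"

private lemma p0: "p \<noteq> 0"
  using s by (simp add: p_def)

private lemma lam_rec: "lam N = 2 * p powi N + p powi (N + 1) * lam (N - 2)"
proof -
  have "p powi (N + 1) * lam (N - 2) = p powi (N + 1 + (N - 2)) * hecke_coeff p (N - 2)"
    by (simp only: lam_def powi_add[OF p0, of "N + 1"] mult.assoc)
  also have "N + 1 + (N - 2) = N + (N - 1)" by simp
  also have "p powi (N + (N - 1)) * hecke_coeff p (N - 2) = p powi N * (p powi (N - 1) * hecke_coeff p (N - 2))"
    by (simp only: powi_add[OF p0] mult.assoc)
  finally have *: "p powi (N + 1) * lam (N - 2) = p powi N * (p powi (N - 1) * hecke_coeff p (N - 2))" .
  have "lam N = p powi N * (2 + p powi (N - 1) * hecke_coeff p (N - 2))"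
    by (simp only: lam_def hecke_coeff_rec[OF p0, of N])
  thus ?thesis by (simp only: * distrib_left mult.commute[of "p powi N" 2])
qed

text \<open>Combines N -> -N for the weights with N -> -2 - N for the Hecke coefficients; the powers
  of \<open>p\<close> that depend on N cancel.\<close>

private lemma theta_sum_lam_reflect:
  "theta_sum s n (\<lambda>N. lam (N + a)) = - (p powi (a + 1) * theta_sum s n (\<lambda>N. lam (N - a - 2)))"
proof -
  have "p powi N * lam (- N + a) = - (p powi (a + 1) * lam (N - a - 2))" for N
  proof -
    have e: "- N + a = - 2 - (N - a - 2)" by simp
    have "p powi N * lam (- N + a) = p powi N * p powi (- N + a) * hecke_coeff p (- 2 - (N - a - 2))"
      by (simp only: lam_def e mult.assoc)
    also have "\<dots> = - (p powi (N + (- N + a) + (N - a - 2 + 1)) * hecke_coeff p (N - a - 2))"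
      unfolding hecke_coeff_reflect[OF p0] by (simp only: powi_add[OF p0] mult.assoc mult_minus_right)
    also have "N + (- N + a) + (N - a - 2 + 1) = (a + 1) + (N - a - 2)" by simp
    finally show ?thesis by (simp only: powi_add[OF p0] lam_def mult.assoc)
  qed
  thus ?thesis
    unfolding theta_sum_reflect[OF s p_def, of n "\<lambda>N. lam (N + a)"] theta_sum_linear(4)[symmetric]
      theta_sum_linear(3)[symmetric] by simp
qed

text \<open>For a = -1 the reflection maps the sum to its own negative.\<close>

private lemma theta_sum_lam_m1: "theta_sum s n (\<lambda>N. lam (N - 1)) = 0"
  using theta_sum_lam_reflect[of n "-1"] by (simp add: algebra_simps)

text \<open>Two linear equations for the sums at \<open>n\<close> and \<open>n + 1\<close>: the first is the recurrence of the weights,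
  the second comes from \<open>lam_rec\<close>, whose inhomogeneous term is annihilated by the finite theta sum.\<close>

private lemma lam_system:
  fixes n
  defines "D \<equiv> (1 - p ^ (2 * n + 1)) * (1 - p ^ (2 * n + 2))"
  defines "M0 \<equiv> theta_sum s n lam" and "M1 \<equiv> theta_sum s n (\<lambda>N. lam (N + 1))"
  shows "D * theta_sum s (Suc n) lam = (1 + p ^ (2 * n + 1)) * M0 - p ^ n * M1"
    and "p * (D * theta_sum s (Suc n) lam) = M1 - p * (p ^ (n + 1) + p ^ n) * M0"
proof -
  show "D * theta_sum s (Suc n) lam = (1 + p ^ (2 * n + 1)) * M0 - p ^ n * M1"
    unfolding D_def theta_sum_Suc[OF s p_def] theta_sum_lam_m1 M0_def M1_def by simp
  have "lam N = 2 * p powi N + p powi N * (p * lam (N - 2))" for N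
    using lam_rec[of N] by (simp add: powi_add[OF p0])
  hence "theta_sum s (Suc n) lam = theta_sum s (Suc n) (\<lambda>N. 2 * p powi N + p powi N * (p * lam (N - 2)))"
    by (intro arg_cong[where f = "theta_sum s (Suc n)"] ext)
  hence "theta_sum s (Suc n) lam = 2 * theta_sum s (Suc n) (\<lambda>N. p powi N)
      + theta_sum s (Suc n) (\<lambda>N. p powi N * (p * lam (N - 2)))"
    by (simp only: theta_sum_linear)
  hence "D * theta_sum s (Suc n) lam =
      D * theta_sum s (Suc n) (\<lambda>N. p powi N * (p * lam (N - 2)))"
    using theta_sum_p[OF s p_def] by simp
  also have "\<dots> = - (p * theta_sum s n (\<lambda>N. lam (N - 1 - 2)) - (p ^ (n + 1) + p ^ n) * (p * theta_sum s n (\<lambda>N. lam (N - 2)))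
        + p ^ (2 * n + 1) * (p * theta_sum s n (\<lambda>N. lam (N + 1 - 2))))"
    unfolding D_def theta_sum_Suc'[OF s p_def] theta_sum_linear(4) ..
  also have "theta_sum s n (\<lambda>N. lam (N + 1 - 2)) = 0"
    using theta_sum_lam_m1[of n] by (simp add: algebra_simps)
  finally have *: "D * theta_sum s (Suc n) lam = - (p * theta_sum s n (\<lambda>N. lam (N - 1 - 2))
      - (p ^ (n + 1) + p ^ n) * (p * theta_sum s n (\<lambda>N. lam (N - 2))))" by simp
  have m0: "M0 = - (p * theta_sum s n (\<lambda>N. lam (N - 2)))"
    using theta_sum_lam_reflect[of n 0] by (simp add: M0_def)
  have m1: "M1 = - (p * (p * theta_sum s n (\<lambda>N. lam (N - 1 - 2))))"
    using theta_sum_lam_reflect[of n 1] by (simp add: M1_def power2_eq_square)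
  show "p * (D * theta_sum s (Suc n) lam) = M1 - p * (p ^ (n + 1) + p ^ n) * M0"
    unfolding * m0 m1 by (simp add: algebra_simps)
qed

text \<open>Eliminating the shifted sum from the two equations leaves the common factor
  \<open>1 + p ^ (n + 1)\<close>, nonzero as |p| < 1, and then a first-order recurrence. The shifted
  sum is recorded as well, because the pair for chi is read off from it.\<close>

private lemma theta_sum_lam_aux:
  fixes n
  defines "D \<equiv> (1 - p ^ (2 * n + 1)) * (1 - p ^ (2 * n + 2))"
  shows "D * theta_sum s (Suc n) lam = (1 - p ^ (n + 1)) * theta_sum s n lam"
    and "theta_sum s n (\<lambda>N. lam (N + 1)) = p * (1 + p ^ n) * theta_sum s n lam"
proof -
  define M0 M1 S P where "M0 = theta_sum s n lam" and "M1 = theta_sum s n (\<lambda>N. lam (N + 1))"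
    and "S = D * theta_sum s (Suc n) lam" and "P = p ^ n"
  have a: "S = (1 + p * P * P) * M0 - P * M1" "p * S = M1 - p * (p * P + P) * M0"
    using lam_system[of n] by (simp_all add: D_def S_def M0_def M1_def P_def power_mult power2_eq_square power_add mult_ac)
  have nz: "1 + p ^ (n + 1) \<noteq> 0"
  proof
    assume "1 + p ^ (n + 1) = 0"
    hence "p ^ (n + 1) = - 1" by (simp add: add_eq_0_iff)
    moreover have "norm (p ^ (n + 1)) < 1"
      by (rule norm_power_less_1) (use nome_square[OF s p_def] in auto)
    ultimately show False by simp
  qed
  have "(1 + p * P) * S = (1 + p * P) * ((1 - p * P) * M0)"
    using a by algebra
  hence S: "S = (1 - p * P) * M0" using nz by (simp add: P_def)
  thus "D * theta_sum s (Suc n) lam = (1 - p ^ (n + 1)) * theta_sum s n lam"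
    by (simp add: S_def P_def M0_def)
  have "M1 = p * (1 + P) * M0" using a(2) S by algebra
  thus "theta_sum s n (\<lambda>N. lam (N + 1)) = p * (1 + p ^ n) * theta_sum s n lam"
    by (simp add: M1_def M0_def P_def)
qed

private lemma theta_sum_lam: "theta_sum s n lam = qpoch p p n / qpoch p p (2 * n)"
proof (induction n)
  case 0
  show ?case by (simp add: lam_def hecke_coeff_def)
next
  case (Suc n)
  let ?D = "(1 - p ^ (2 * n + 1)) * (1 - p ^ (2 * n + 2))"
  have D: "?D \<noteq> 0" using one_minus_nome_power_nz[OF s p_def, of "2 * n"] one_minus_nome_power_nz[OF s p_def, of "2 * n + 1"] by simp
  have q: "qpoch p p (2 * Suc n) = qpoch p p (2 * n) * ?D"
    by (simp add: qpoch_Suc mult_ac)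
  have "theta_sum s (Suc n) lam = (1 - p ^ (n + 1)) * theta_sum s n lam / ?D"
    using theta_sum_lam_aux(1)[of n] D by (metis nonzero_mult_div_cancel_left)
  thus ?case unfolding Suc q by (simp add: qpoch_Suc mult_ac)
qed

lemma theta_sum_hecke:
  "theta_sum s n (\<lambda>N. p powi N * hecke_coeff p N) = qpoch p p n / qpoch p p (2 * n)"
  using theta_sum_lam[of n] unfolding lam_def .

text \<open>By \<open>lam_rec\<close>, \<open>lam (N + 1)\<close> is a multiple of p^N plus
  \<open>p\<close> times the present summand. The first part sums to zero only for positive
  \<open>n\<close>, hence the hypothesis.\<close>

lemma theta_sum_hecke_pred:
  assumes "n > 0"
  shows "theta_sum s n (\<lambda>N. p powi (2 * N) * hecke_coeff p (N - 1)) =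
      (1 + p ^ n) * qpoch p p n / qpoch p p (2 * n)"
proof -
  have "lam (N + 1) = 2 * (p * p powi N) + p * (p powi (2 * N) * hecke_coeff p (N - 1))" for N
  proof -
    have "lam (N + 1) = 2 * p powi (N + 1) + p powi (N + 1 + 1) * (p powi (N - 1) * hecke_coeff p (N - 1))"
      using lam_rec[of "N + 1"] by (simp add: lam_def)
    also have "\<dots> = 2 * p powi (1 + N) + p powi (N + 1 + 1 + (N - 1)) * hecke_coeff p (N - 1)"
      by (simp only: powi_add[OF p0] mult_ac)
    also have "N + 1 + 1 + (N - 1) = 1 + 2 * N" by simp
    finally show ?thesis by (simp add: powi_add[OF p0])
  qed
  hence "theta_sum s n (\<lambda>N. lam (N + 1)) = 2 * (p * theta_sum s n (\<lambda>N. p powi N))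
      + p * theta_sum s n (\<lambda>N. p powi (2 * N) * hecke_coeff p (N - 1))"
    unfolding theta_sum_linear(4)[symmetric] theta_sum_linear(1)[symmetric] by simp
  hence "p * theta_sum s n (\<lambda>N. p powi (2 * N) * hecke_coeff p (N - 1)) =
      p * ((1 + p ^ n) * qpoch p p n / qpoch p p (2 * n))"
    using theta_sum_lam_aux(2)[of n] theta_sum_p[OF s p_def assms] theta_sum_lam[of n]
    by (simp add: mult.assoc)
  thus ?thesis using p0 by (metis mult_left_cancel)
qed

end

section \<open>A summation of a basic hypergeometric series\<close>

lemma summable_on_product:
  fixes f :: "'a \<Rightarrow> real" and g :: "'b \<Rightarrow> real"
  assumes "f summable_on A" "g summable_on B" "\<And>x. x \<in> A \<Longrightarrow> f x \<ge> 0" "\<And>x. x \<in> B \<Longrightarrow> g x \<ge> 0"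
  shows "(\<lambda>(x, y). f x * g y) summable_on A \<times> B"
proof (rule summable_on_SigmaI)
  show "((\<lambda>y. case (x, y) of (x, y) \<Rightarrow> f x * g y) has_sum f x * infsum g B) B" for x
    using assms(2) by (auto intro!: has_sum_cmult_right has_sum_infsum)
  show "(\<lambda>x. f x * infsum g B) summable_on A"
    by (rule summable_on_cmult_left[OF assms(1)])
qed (use assms in auto)

lemma summable_on_complex_bound:
  fixes f :: "'a \<Rightarrow> complex"
  assumes "g summable_on A" "\<And>x. x \<in> A \<Longrightarrow> norm (f x) \<le> g x"
  shows "f summable_on A"
  unfolding summable_on_iff_abs_summable_on_complex
  by (rule Infinite_Sum.abs_summable_on_comparison_test'[OF assms])

lemma qpoch_inf_shift:
  assumes "norm p < 1"
  shows "qpoch_inf x p = qpoch x p k * qpoch_inf (p ^ k * x) p"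
proof -
  have "(\<lambda>n. qpoch x p (n + k)) \<longlonglongrightarrow> qpoch_inf x p"
    by (rule LIMSEQ_ignore_initial_segment[OF qpoch_tendsto[OF assms]])
  moreover have "(\<lambda>n. qpoch x p k * qpoch (p ^ k * x) p n) \<longlonglongrightarrow> qpoch x p k * qpoch_inf (p ^ k * x) p"
    by (intro tendsto_intros qpoch_tendsto assms)
  hence "(\<lambda>n. qpoch x p (n + k)) \<longlonglongrightarrow> qpoch x p k * qpoch_inf (p ^ k * x) p"
    by (simp add: qpoch_add add.commute[of _ k])
  ultimately show ?thesis using LIMSEQ_unique by blast
qed

text \<open>Summand of the basic series 1phi1(a; c; p, c/a) with c = a b. Taking \<open>b\<close>
  instead of c as the parameter avoids the quotient.\<close>

definition phi_term :: "complex \<Rightarrow> complex \<Rightarrow> complex \<Rightarrow> nat \<Rightarrow> complex" where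
  "phi_term s a b m = qpoch a (s ^ 2) m * (-1) ^ m * s ^ (m * (m - 1)) * b ^ m
     / (qpoch (s ^ 2) (s ^ 2) m * qpoch (a * b) (s ^ 2) m)"

context
  fixes s p a b :: complex
  assumes s: "s \<noteq> 0" "norm s < 1" and p_def: "p = s ^ 2"
    and ab: "norm a \<le> 1" "norm b < 1"
begin

private lemma p1: "norm p < 1"
  using nome_square[OF s p_def] by auto

private lemma ab1: "norm (a * b) < 1"
proof -
  have "norm a * norm b \<le> 1 * norm b" by (intro mult_right_mono) (use ab in auto)
  thus ?thesis using ab by (simp add: norm_mult)
qed

private lemma phi_term_bound:
  obtains C where "\<And>k m. norm (phi_term s a (p ^ k * b) m) \<le> C * norm (p ^ k * b) ^ m"
proof -
  obtain C1 where C1: "C1 \<ge> 1" "\<And>n. norm (qpoch a p n) \<le> C1"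
    by (rule qpoch_bounds[OF p1, of a]) blast
  obtain C2 where C2: "C2 \<ge> 1" "\<And>n. norm (inverse (qpoch p p n)) \<le> C2"
    by (rule qpoch_bounds[OF p1, of p]) (use p1 in blast)
  obtain C3 where C3: "C3 \<ge> 1" "\<And>n. norm (qpoch (a * b) p n) \<le> C3"
      "\<And>n. norm (inverse (qpoch (a * b) p n)) \<le> C3"
    by (rule qpoch_bounds[OF p1, of "a * b"]) (use ab1 in blast)
  show ?thesis
  proof (rule that)
    fix k m
    have nz: "qpoch (a * b) p k \<noteq> 0" "qpoch (a * b) p (k + m) \<noteq> 0"
      by (rule qpoch_nz[OF less_imp_le[OF p1] ab1])+
    \<comment> \<open>The denominator at \<open>p ^ k * b\<close> is a quotient of two products with
      parameter \<open>a * b\<close>, so the bound is uniform in \<open>k\<close>.\<close>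
    have "qpoch (a * b) p (k + m) = qpoch (a * b) p k * qpoch (a * (p ^ k * b)) p m"
      by (simp add: qpoch_add mult_ac)
    hence "inverse (qpoch (a * (p ^ k * b)) p m) = qpoch (a * b) p k * inverse (qpoch (a * b) p (k + m))"
      using nz by (simp add: field_simps)
    hence "phi_term s a (p ^ k * b) m = (qpoch a p m * inverse (qpoch p p m) * qpoch (a * b) p k
        * inverse (qpoch (a * b) p (k + m)) * ((-1) ^ m * s ^ (m * (m - 1)))) * (p ^ k * b) ^ m"
      by (simp add: phi_term_def divide_inverse mult_ac flip: p_def)
    also have "norm \<dots> \<le> (C1 * C2 * C3 * C3 * 1) * norm (p ^ k * b) ^ m"
      unfolding norm_mult norm_power[of "p ^ k * b"]
    proof (intro mult_right_mono mult_mono C1 C2 C3)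
      show "norm ((- 1 :: complex) ^ m) * norm (s ^ (m * (m - 1))) \<le> 1"
        using s by (simp add: norm_power power_le_one)
    qed (use C1(1) C2(1) C3(1) in auto)
    finally show "norm (phi_term s a (p ^ k * b) m) \<le> (C1 * C2 * C3 * C3 * 1) * norm (p ^ k * b) ^ m" .
  qed
qed

private lemma pkb: "norm (p ^ k * b) \<le> norm b"
  using p1 by (simp add: norm_mult norm_power mult_left_le_one_le power_le_one)

private lemma phi_term_summable: "summable (\<lambda>m. norm (phi_term s a (p ^ k * b) m))"
proof -
  obtain C where C: "\<And>k m. norm (phi_term s a (p ^ k * b) m) \<le> C * norm (p ^ k * b) ^ m"
    using phi_term_bound by blast
  have "summable (\<lambda>m. C * norm (p ^ k * b) ^ m)"
    using pkb[of k] ab by (intro summable_mult summable_geometric) auto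
  thus ?thesis by (rule summable_comparison_test') (use C in auto)
qed

text \<open>Telescoping certificate for the contiguous relation that carries \<open>b\<close> to \<open>pb\<close>.\<close>

private lemma phi_term_certificate:
  assumes "b' = p ^ k * b"
  defines "G \<equiv> (\<lambda>m. qpoch a p m * (-1) ^ m * s ^ (m * (m - 1)) * b' ^ m
     / (qpoch p p m * qpoch (p * (a * b')) p m) * (1 - p ^ m) * (1 - p ^ m * (a * b')))"
  shows "(1 - a * b') * phi_term s a b' m - (1 - b') * phi_term s a (p * b') m = G m - G (Suc m)"
    and "G (Suc m) = - (b' * phi_term s a (p * b') m * (1 - p ^ m * a))"
proof -
  have "norm (a * b') \<le> norm (a * b)"
    using pkb[of k] by (simp add: assms(1) norm_mult mult_left_mono)
  hence ab': "norm (a * b') < 1" using ab1 by simp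
  hence pab': "norm (p * (a * b')) < 1"
    using mult_left_le_one_le[of "norm (a * b')" "norm p"] p1 by (simp add: norm_mult)
  define u where "u = qpoch a p m * (-1) ^ m * s ^ (m * (m - 1)) * b' ^ m
     / (qpoch p p m * qpoch (p * (a * b')) p m)"
  have nz: "qpoch p p n \<noteq> 0" "qpoch (a * b') p n \<noteq> 0" "qpoch (p * (a * b')) p n \<noteq> 0"
      "1 - p ^ n * (a * b') \<noteq> 0" "1 - p ^ n * p \<noteq> 0" "1 - p ^ n * (p * (a * b')) \<noteq> 0" for n
    using qpoch_nz[OF less_imp_le[OF p1] p1] qpoch_nz[OF less_imp_le[OF p1] ab']
      qpoch_nz[OF less_imp_le[OF p1] pab'] qpoch_factor_nz[OF less_imp_le[OF p1] p1]
      qpoch_factor_nz[OF less_imp_le[OF p1] ab'] qpoch_factor_nz[OF less_imp_le[OF p1] pab'] by blast+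
  \<comment> \<open>Brings both series over the denominator with parameter
    \<open>p * (a * b')\<close>.\<close>
  have "(1 - a * b') * qpoch (p * (a * b')) p m = qpoch (a * b') p m * (1 - p ^ m * (a * b'))"
    using qpoch_Suc[of "a * b'" p m] qpoch_Suc_left[of "a * b'" p m] by simp
  hence e: "(1 - a * b') / qpoch (a * b') p m = (1 - p ^ m * (a * b')) / qpoch (p * (a * b')) p m"
    using nz by (simp add: frac_eq_eq mult_ac)
  have t1: "(1 - a * b') * phi_term s a b' m = u * (1 - p ^ m * (a * b'))"
  proof -
    have "(1 - a * b') * phi_term s a b' m = qpoch a p m * (-1) ^ m * s ^ (m * (m - 1)) * b' ^ m
        / qpoch p p m * ((1 - a * b') / qpoch (a * b') p m)"
      by (simp add: phi_term_def flip: p_def)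
    thus ?thesis unfolding e by (simp add: u_def)
  qed
  have t2: "phi_term s a (p * b') m = u * p ^ m"
    by (simp add: phi_term_def u_def power_mult_distrib mult_ac flip: p_def)
  have G: "G m = u * (1 - p ^ m) * (1 - p ^ m * (a * b'))"
    by (simp add: G_def u_def)
  have sp: "s ^ (Suc m * (Suc m - 1)) = s ^ (m * (m - 1)) * p ^ m"
  proof (cases m)
    case (Suc k)
    have "Suc m * (Suc m - 1) = m * (m - 1) + 2 * m" by (simp add: Suc algebra_simps)
    thus ?thesis by (simp only: power_add p_def power_mult)
  qed auto
  have "G (Suc m) = - (u * p ^ m * b' * (1 - p ^ m * a)) *
      ((1 - p ^ Suc m) * (1 - p ^ Suc m * (a * b'))) / ((1 - p ^ m * p) * (1 - p ^ m * (p * (a * b'))))"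
    unfolding G_def u_def sp qpoch_Suc by (simp add: mult_ac)
  also have "\<dots> = - (u * p ^ m * b' * (1 - p ^ m * a))"
    using nz(5,6)[of m] by (simp add: mult_ac)
  finally have G': "G (Suc m) = - (u * p ^ m * b' * (1 - p ^ m * a))" .
  show "G (Suc m) = - (b' * phi_term s a (p * b') m * (1 - p ^ m * a))"
    unfolding G' t2 by (simp add: mult_ac)
  show "(1 - a * b') * phi_term s a b' m - (1 - b') * phi_term s a (p * b') m = G m - G (Suc m)"
    unfolding t1 t2 G G' by (simp add: algebra_simps)
qed

private lemma phi_step:
  assumes "b' = p ^ k * b"
  shows "(1 - a * b') * (\<Sum>m. phi_term s a b' m) = (1 - b') * (\<Sum>m. phi_term s a (p * b') m)"
proof -
  define G where "G = (\<lambda>m. qpoch a p m * (-1) ^ m * s ^ (m * (m - 1)) * b' ^ m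
     / (qpoch p p m * qpoch (p * (a * b')) p m) * (1 - p ^ m) * (1 - p ^ m * (a * b')))"
  have cert: "(1 - a * b') * phi_term s a b' m - (1 - b') * phi_term s a (p * b') m = G m - G (Suc m)"
     "G (Suc m) = - (b' * phi_term s a (p * b') m * (1 - p ^ m * a))" for m
    unfolding G_def by (rule phi_term_certificate[OF assms])+
  have sm: "summable (phi_term s a b')" "summable (phi_term s a (p * b'))"
    using summable_norm_cancel[OF phi_term_summable[of k]] summable_norm_cancel[OF phi_term_summable[of "Suc k"]]
    by (simp_all add: assms mult_ac)
  \<comment> \<open>In this form \<open>G (Suc m)\<close> is a summand times a convergent factor, so
    \<open>G\<close> tends to zero. At 0 it vanishes through its factor
    \<open>1 - p ^ m\<close>.\<close>
  have "(\<lambda>m. - (b' * phi_term s a (p * b') m * (1 - p ^ m * a))) \<longlonglongrightarrow> - (b' * 0 * (1 - 0 * a))"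
    by (intro tendsto_intros summable_LIMSEQ_zero sm LIMSEQ_power_zero p1)
  hence "(\<lambda>m. G (Suc m)) \<longlonglongrightarrow> 0" unfolding cert(2) by simp
  hence "G \<longlonglongrightarrow> 0" by (simp only: filterlim_sequentially_Suc)
  hence "(\<lambda>m. G m - G (Suc m)) sums (G 0 - 0)" by (rule telescope_sums')
  hence "(\<lambda>m. (1 - a * b') * phi_term s a b' m - (1 - b') * phi_term s a (p * b') m) sums 0"
    unfolding cert(1) by (simp add: G_def)
  moreover have "(\<lambda>m. (1 - a * b') * phi_term s a b' m - (1 - b') * phi_term s a (p * b') m) sums
      ((1 - a * b') * (\<Sum>m. phi_term s a b' m) - (1 - b') * (\<Sum>m. phi_term s a (p * b') m))"
    by (intro sums_diff sums_mult summable_sums sm)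
  ultimately have "(1 - a * b') * (\<Sum>m. phi_term s a b' m) - (1 - b') * (\<Sum>m. phi_term s a (p * b') m) = 0"
    by (rule sums_unique2[rotated])
  thus ?thesis by simp
qed

text \<open>Iterating the contiguous relation replaces \<open>b\<close> by p^k b at the cost of
  finite products. As k grows, all summands but the first tend to zero, so by domination the series
  tends to 1 and only the infinite products remain.\<close>

lemma phi_1_1_sum:
  "(phi_term s a b has_sum qpoch_inf b p / qpoch_inf (a * b) p) UNIV"
proof -
  define F where "F = (\<lambda>k. \<Sum>m. phi_term s a (p ^ k * b) m)"
  have step: "qpoch (a * b) p k * F 0 = qpoch b p k * F k" for k
  proof (induction k)
    case (Suc k)
    have "qpoch (a * b) p (Suc k) * F 0 = qpoch b p k * ((1 - a * (p ^ k * b)) * F k)"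
      using Suc by (simp add: qpoch_Suc mult_ac)
    also have "(1 - a * (p ^ k * b)) * F k = (1 - p ^ k * b) * F (Suc k)"
      using phi_step[OF refl, of k] by (simp add: F_def mult_ac)
    finally show ?case by (simp add: qpoch_Suc mult_ac)
  qed auto
  have hs: "(phi_term s a (p ^ k * b) has_sum F k) UNIV" for k
    unfolding F_def by (intro norm_summable_imp_has_sum phi_term_summable summable_sums summable_norm_cancel)
  obtain C where C: "\<And>k m. norm (phi_term s a (p ^ k * b) m) \<le> C * norm (p ^ k * b) ^ m"
    using phi_term_bound by blast
  have "1 \<le> C" using C[of 0 0] by (simp add: phi_term_def)
  hence "0 \<le> C" by simp
  have "F \<longlonglongrightarrow> 1"
  proof (rule dominated_has_sum_tendsto[where A = UNIV and M = "\<lambda>m. C * norm b ^ m"])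
    fix k m
    have "C * norm (p ^ k * b) ^ m \<le> C * norm b ^ m"
      using \<open>0 \<le> C\<close> pkb[of k] by (intro mult_left_mono power_mono) auto
    thus "norm (phi_term s a (p ^ k * b) m) \<le> C * norm b ^ m" using C[of k m] by linarith
  next
    show "(\<lambda>m. C * norm b ^ m) summable_on UNIV"
      by (subst summable_on_UNIV_nonneg_real_iff)
         (use ab \<open>0 \<le> C\<close> in \<open>auto intro!: summable_mult summable_geometric\<close>)
  next
    fix m
    show "(\<lambda>k. phi_term s a (p ^ k * b) m) \<longlonglongrightarrow> (if m = 0 then 1 else 0)"
    proof (cases "m = 0")
      case False
      have "(\<lambda>k. C * norm (p ^ k * b) ^ m) \<longlonglongrightarrow> C * norm (0 * b) ^ m"
        by (intro tendsto_intros LIMSEQ_power_zero p1)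
      hence "(\<lambda>k. C * norm (p ^ k * b) ^ m) \<longlonglongrightarrow> 0" using False by (simp add: power_0_left)
      hence "(\<lambda>k. phi_term s a (p ^ k * b) m) \<longlonglongrightarrow> 0"
        by (rule Lim_null_comparison[OF always_eventually[OF allI[OF C]]])
      thus ?thesis using False by simp
    qed (auto simp: phi_term_def)
  next
    show "((\<lambda>m. if m = 0 then 1 else 0) has_sum (1::complex)) (UNIV :: nat set)"
      by (rule has_sum_finite_neutralI[of "{0}"]) auto
  qed (rule hs)
  hence "(\<lambda>k. qpoch b p k * F k) \<longlonglongrightarrow> qpoch_inf b p * 1"
    by (intro tendsto_intros qpoch_tendsto p1)
  moreover have "(\<lambda>k. qpoch (a * b) p k * F 0) \<longlonglongrightarrow> qpoch_inf (a * b) p * F 0"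
    by (intro tendsto_intros qpoch_tendsto p1)
  ultimately have "qpoch_inf (a * b) p * F 0 = qpoch_inf b p"
    unfolding step mult_1_right using LIMSEQ_unique by blast
  hence "F 0 = qpoch_inf b p / qpoch_inf (a * b) p"
    using qpoch_inf_nz[OF p1 ab1] by (metis nonzero_mult_div_cancel_left)
  thus ?thesis using hs[of 0] by simp
qed

end

section \<open>Hecke double sums for the mock theta functions\<close>

definition hsgn :: "int \<Rightarrow> int \<Rightarrow> complex" where
  "hsgn r s = (if r \<ge> 0 \<and> s \<ge> 0 then 1 else if r < 0 \<and> s < 0 then - 1 else 0)"

lemma hsgn_mult_nonneg: "hsgn r s \<noteq> 0 \<Longrightarrow> r * s \<ge> 0"
  by (auto simp: hsgn_def mult_nonpos_nonpos split: if_splits)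

lemma norm_hsgn_le: "norm (hsgn r s) \<le> 1"
  by (simp add: hsgn_def)

text \<open>The quadratic forms in use are indefinite or degenerate, but on the support of
  \<open>hsgn\<close> their cross term is nonnegative. The bound is therefore asked for only there,
  with the two indices separated.\<close>

lemma hecke_double_summable:
  fixes q :: complex
  assumes q: "q \<noteq> 0" "norm q < 1"
    and E: "\<And>r s. hsgn r s \<noteq> 0 \<Longrightarrow> E r s \<ge> (r ^ 2 - int k * \<bar>r\<bar>) + (s ^ 2 - int k * \<bar>s\<bar>)"
    and u: "\<And>r s. norm (u r s) \<le> C"
  shows "(\<lambda>(r, s). hsgn r s * (q powi (E r s) * u r s)) summable_on UNIV \<times> UNIV"
proof (rule summable_on_complex_bound)
  define G where "G = (\<lambda>r. norm q powi (r ^ 2 - int k * \<bar>r\<bar>))"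
  have "(\<lambda>r. norm q powi (r ^ 2 - int k * \<bar>r\<bar>) * 1) summable_on UNIV"
    by (rule summable_on_quadratic_powi[where r = 1]) (use q in auto)
  hence G: "G summable_on UNIV" by (simp add: G_def)
  have G0: "G r \<ge> 0" for r by (simp add: G_def)
  have "C \<ge> 0" using u[of 0 0] norm_ge_zero order.trans by blast
  show "(\<lambda>(r, s). (C * G r) * G s) summable_on UNIV \<times> UNIV"
    by (rule summable_on_product) (use G G0 \<open>C \<ge> 0\<close> in \<open>auto intro: summable_on_cmult_right\<close>)
  show "norm (case x of (r, s) \<Rightarrow> hsgn r s * (q powi (E r s) * u r s)) \<le> (case x of (r, s) \<Rightarrow> (C * G r) * G s)"
    for x
  proof (cases x)
    case (Pair r s)
    show ?thesis
    proof (cases "hsgn r s = 0")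
      case True
      thus ?thesis using G0 \<open>C \<ge> 0\<close> by (simp add: Pair)
    next
      case False
      have "norm q powi (E r s) \<le> norm q powi ((r ^ 2 - int k * \<bar>r\<bar>) + (s ^ 2 - int k * \<bar>s\<bar>))"
        by (rule power_int_decreasing[OF E[OF False]]) (use q in auto)
      also have "\<dots> = G r * G s"
        unfolding G_def by (rule power_int_add) (use q in auto)
      finally have "norm q powi (E r s) * norm (u r s) \<le> (G r * G s) * C"
        using u[of r s] G0 by (intro mult_mono) auto
      from mult_mono[OF norm_hsgn_le[of r s] this]
      have "norm (hsgn r s) * (norm q powi (E r s) * norm (u r s)) \<le> 1 * ((G r * G s) * C)"
        by simp
      thus ?thesis by (simp add: Pair norm_mult mult_ac)
    qed
  qed
qed

lemma hecke_coeff_has_sum: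
  "((\<lambda>i. hsgn i (N - i) * Q powi (i * (N - i))) has_sum hecke_coeff Q N) UNIV"
proof (rule has_sum_finite_neutralI[of "{0..N} \<union> {N+1..-1}"])
  have "(\<Sum>i\<in>{0..N} \<union> {N+1..-1}. hsgn i (N - i) * Q powi (i * (N - i))) =
      (\<Sum>i\<in>{0..N}. hsgn i (N - i) * Q powi (i * (N - i))) + (\<Sum>i\<in>{N+1..-1}. hsgn i (N - i) * Q powi (i * (N - i)))"
    by (rule sum.union_disjoint) auto
  also have "(\<Sum>i\<in>{0..N}. hsgn i (N - i) * Q powi (i * (N - i))) = (\<Sum>i\<in>{0..N}. Q powi (i * (N - i)))"
    by (rule sum.cong) (auto simp: hsgn_def)
  also have "(\<Sum>i\<in>{N+1..-1}. hsgn i (N - i) * Q powi (i * (N - i))) = (\<Sum>i\<in>{N+1..-1}. - (Q powi (i * (N - i))))"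
    by (rule sum.cong) (auto simp: hsgn_def)
  finally show "hecke_coeff Q N = (\<Sum>i\<in>{0..N} \<union> {N+1..-1}. hsgn i (N - i) * Q powi (i * (N - i)))"
    by (simp add: hecke_coeff_def sum_negf)
qed (auto simp: hsgn_def)

text \<open>Summation along the lines r + s = N, each of which meets the support of
  \<open>hsgn\<close> in finitely many points.\<close>

lemma hecke_coeff_sum:
  assumes "((\<lambda>(r, s). hsgn r s * (F (r + s) * Q powi (r * s))) has_sum S) (UNIV \<times> UNIV)"
  shows "((\<lambda>N. F N * hecke_coeff Q N) has_sum S) UNIV"
proof (rule has_sum_SigmaD)
  have "((\<lambda>(N, i). hsgn i (N - i) * (F N * Q powi (i * (N - i)))) has_sum S) (UNIV \<times> UNIV) \<longleftrightarrow>
        ((\<lambda>(r, s). hsgn r s * (F (r + s) * Q powi (r * s))) has_sum S) (UNIV \<times> UNIV)"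
    by (rule has_sum_reindex_bij_witness[of _ "\<lambda>(r, s). (r + s, r)" "\<lambda>(N, i). (i, N - i)"]) auto
  thus "((\<lambda>(N, i). hsgn i (N - i) * (F N * Q powi (i * (N - i)))) has_sum S) (UNIV \<times> UNIV)"
    using assms by simp
  show "((\<lambda>i. case (N, i) of (N, i) \<Rightarrow> hsgn i (N - i) * (F N * Q powi (i * (N - i)))) has_sum
      F N * hecke_coeff Q N) UNIV" for N
    using has_sum_cmult_right[OF hecke_coeff_has_sum[of N Q], of "F N"] by (simp add: mult_ac)
qed

lemma square_add_exponent: "r ^ 2 + (m * (m - 1) + (2 * r + 1) * m) = (r + m) ^ (2 :: nat)" for r m :: nat
  by (cases m) (auto simp: power2_eq_square algebra_simps)

section \<open>The Bailey transform with nome q^2\<close>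

context
  fixes q :: complex
  assumes q: "q \<noteq> 0" "norm q < 1"
begin

private lemma q2: "norm (q ^ 2) < 1" "q ^ 2 \<noteq> 0"
  using q by (auto simp: norm_power_less_1)

text \<open>This evaluates gamma_N of the conjugate Bailey pair with delta_n = \<open>g n\<close>.
  With n = |N| + m the series becomes the 1phi1 with both parameters equal to q^(2|N|+1), and the
  infinite products that are left do not depend on N.\<close>

lemma conjugate_bailey_aux:
  defines "g \<equiv> (\<lambda>n. (-1) ^ n * q ^ (n ^ 2) * qpoch q (q ^ 2) n)"
  shows "((\<lambda>n. g n * (rpoch (q ^ 2) (int n - N) * rpoch (q ^ 2) (int n + N))) has_sum
    (-1) powi N * q powi (N ^ 2) * (qpoch_inf q (q ^ 2) / qpoch_inf (q ^ 2) (q ^ 2))) UNIV"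
proof -
  let ?Q = "q ^ 2"
  define r where "r = nat \<bar>N\<bar>"
  have N: "(-1 :: complex) powi N = (-1) ^ r" "q powi (N ^ 2) = q ^ (r ^ 2)"
  proof -
    have "N = int r \<or> N = - int r" by (auto simp: r_def)
    thus "(-1 :: complex) powi N = (-1) ^ r" by (auto simp: power_int_minus_one_minus)
    have "N ^ 2 = int (r ^ 2)" by (simp add: r_def)
    thus "q powi (N ^ 2) = q ^ (r ^ 2)" by (metis power_int_of_nat)
  qed
  have R: "rpoch ?Q (int n - N) * rpoch ?Q (int n + N) = rpoch ?Q (int n - int r) * rpoch ?Q (int n + int r)" for n
    by (cases "N \<ge> 0") (auto simp: r_def mult.commute)
  define a where "a = ?Q ^ r * q"
  have a1: "norm a < 1"
  proof -
    have "norm ?Q ^ r * norm q \<le> 1 * norm q"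
      by (intro mult_right_mono power_le_one) (use q2 in auto)
    hence "norm ?Q ^ r * norm q < 1" using q by linarith
    thus ?thesis by (simp add: a_def norm_mult norm_power)
  qed
  have aa: "a * a = ?Q ^ (2 * r) * ?Q"
    by (simp add: a_def power_mult power2_eq_square mult_ac)
  have nz: "qpoch ?Q ?Q n \<noteq> 0" for n
    by (rule qpoch_nz) (use q2 in auto)
  define c where "c = (-1) ^ r * q ^ (r ^ 2) * qpoch q ?Q r / qpoch ?Q ?Q (2 * r)"
  have tm: "g (r + m) * (rpoch ?Q (int (r + m) - int r) * rpoch ?Q (int (r + m) + int r)) =
      c * phi_term q a a m" for m
  proof -
    have e1: "int (r + m) - int r = int m" "int (r + m) + int r = int (2 * r + m)" by simp_all
    have e2: "q ^ ((r + m) ^ 2) = q ^ (r ^ 2) * (q ^ (m * (m - 1)) * a ^ m)"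
    proof -
      have "a = q ^ (2 * r + 1)" by (simp add: a_def power_mult)
      hence "a ^ m = q ^ ((2 * r + 1) * m)" by (simp only: power_mult)
      thus ?thesis by (simp only: power_add flip: square_add_exponent)
    qed
    show ?thesis
      unfolding e1 rpoch_nat g_def e2 qpoch_add phi_term_def c_def aa a_def[symmetric]
      by (simp add: power_add divide_inverse mult_ac)
  qed
  have "((\<lambda>m. c * phi_term q a a m) has_sum c * (qpoch_inf a ?Q / qpoch_inf (a * a) ?Q)) UNIV"
    by (intro has_sum_cmult_right phi_1_1_sum) (use q a1 in auto)
  also have "c * (qpoch_inf a ?Q / qpoch_inf (a * a) ?Q) =
      (-1) ^ r * q ^ (r ^ 2) * (qpoch_inf q ?Q / qpoch_inf ?Q ?Q)"
  proof -
    have "qpoch_inf q ?Q = qpoch q ?Q r * qpoch_inf a ?Q"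
      unfolding a_def by (rule qpoch_inf_shift[OF q2(1)])
    moreover have "qpoch_inf ?Q ?Q = qpoch ?Q ?Q (2 * r) * qpoch_inf (a * a) ?Q"
      unfolding aa by (rule qpoch_inf_shift[OF q2(1)])
    ultimately show ?thesis by (simp add: c_def)
  qed
  finally have "((\<lambda>n. g n * (rpoch ?Q (int n - int r) * rpoch ?Q (int n + int r))) has_sum
      (-1) ^ r * q ^ (r ^ 2) * (qpoch_inf q ?Q / qpoch_inf ?Q ?Q)) {r..}"
    by (subst has_sum_reindex_bij_witness[of _ "\<lambda>m. r + m" "\<lambda>n. n - r" UNIV "\<lambda>m. c * phi_term q a a m"])
       (auto simp flip: tm)
  also have "?this \<longleftrightarrow> ((\<lambda>n. g n * (rpoch ?Q (int n - int r) * rpoch ?Q (int n + int r))) has_sum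
      (-1) ^ r * q ^ (r ^ 2) * (qpoch_inf q ?Q / qpoch_inf ?Q ?Q)) UNIV"
    by (rule has_sum_cong_neutral) auto
  finally show ?thesis unfolding R N .
qed

text \<open>Bailey's transform: the family over (n, N) is summed in both orders. Rows are finite,
  columns come from \<open>conjugate_bailey_aux\<close>, and absolute convergence holds since
  \<open>g n\<close> decays at least like |q|^n.\<close>

lemma conjugate_bailey:
  defines "g \<equiv> (\<lambda>n. (-1) ^ n * q ^ (n ^ 2) * qpoch q (q ^ 2) n)"
  assumes f: "(\<lambda>N. theta_coeff q N * f N) summable_on UNIV"
    and S: "((\<lambda>N. q powi (2 * N ^ 2 - N) * f N) has_sum S) UNIV"
  shows "((\<lambda>n. g n * theta_sum q n f) has_sum (qpoch_inf q (q ^ 2) / qpoch_inf (q ^ 2) (q ^ 2)) * S) UNIV"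
proof -
  let ?Q = "q ^ 2"
  define K where "K = qpoch_inf q ?Q / qpoch_inf ?Q ?Q"
  define F where "F = (\<lambda>(n, N). g n * (theta_weight q n N * f N))"
  obtain C1 where C1: "C1 \<ge> 1" "\<And>n. norm (qpoch q ?Q n) \<le> C1"
    by (rule qpoch_bounds[OF q2(1), of q]) blast
  obtain C2 where C2: "C2 \<ge> 1" "\<And>m. norm (rpoch ?Q m) \<le> C2"
    using rpoch_bounded[OF q2(1)] by metis
  have Fs: "F summable_on UNIV \<times> UNIV"
  proof (rule summable_on_complex_bound)
    have "summable (\<lambda>n. norm q ^ n)" using q by (intro summable_geometric) auto
    hence 1: "(\<lambda>n::nat. norm q ^ n) summable_on UNIV"
      by (subst summable_on_UNIV_nonneg_real_iff) auto
    have 2: "(\<lambda>N. norm (theta_coeff q N * f N)) summable_on UNIV"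
      using f by (simp only: summable_on_iff_abs_summable_on_complex)
    show "(\<lambda>(n, N). (C1 * C2 * C2 * norm q ^ n) * norm (theta_coeff q N * f N)) summable_on UNIV \<times> UNIV"
      by (rule summable_on_product[OF summable_on_cmult_right[OF 1] 2]) (use C1 C2 in auto)
    show "norm (F x) \<le> (case x of (n, N) \<Rightarrow> (C1 * C2 * C2 * norm q ^ n) * norm (theta_coeff q N * f N))" for x
    proof (cases x)
      case (Pair n N)
      have "norm q ^ (n ^ 2) \<le> norm q ^ n"
        by (rule power_decreasing) (use q in \<open>auto simp: power2_eq_square\<close>)
      hence g: "norm (g n) \<le> norm q ^ n * C1"
        unfolding g_def norm_mult norm_power using C1(2)[of n] by (auto intro!: mult_mono)
      have R: "norm (rpoch ?Q (int n - N) * rpoch ?Q (int n + N)) \<le> C2 * C2"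
        unfolding norm_mult by (intro mult_mono C2) (use C2 in auto)
      have "norm (F x) = norm (g n) * norm (rpoch ?Q (int n - N) * rpoch ?Q (int n + N)) * norm (theta_coeff q N * f N)"
        by (simp add: F_def Pair theta_weight_def norm_mult)
      also have "\<dots> \<le> (norm q ^ n * C1) * (C2 * C2) * norm (theta_coeff q N * f N)"
        by (intro mult_right_mono mult_mono g R) (use C1 C2 in auto)
      finally show ?thesis by (simp add: Pair mult_ac)
    qed
  qed
  hence hs: "(F has_sum infsum F (UNIV \<times> UNIV)) (UNIV \<times> UNIV)" by (rule has_sum_infsum)
  have col: "((\<lambda>n. F (n, N)) has_sum K * (q powi (2 * N ^ 2 - N) * f N)) UNIV" for N
  proof -
    have "((\<lambda>n. theta_coeff q N * f N * (g n * (rpoch ?Q (int n - N) * rpoch ?Q (int n + N)))) has_sum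
      theta_coeff q N * f N * ((-1) powi N * q powi (N ^ 2) * K)) UNIV"
      unfolding g_def K_def by (intro has_sum_cmult_right conjugate_bailey_aux)
    also have "(\<lambda>n. theta_coeff q N * f N * (g n * (rpoch ?Q (int n - N) * rpoch ?Q (int n + N)))) = (\<lambda>n. F (n, N))"
      by (auto simp: F_def theta_weight_def mult_ac)
    \<comment> \<open>The sign in \<open>theta_coeff\<close> cancels the sign of gamma_N, so the
      resulting series has none.\<close>
    also have "theta_coeff q N * f N * ((-1) powi N * q powi (N ^ 2) * K) =
        K * ((q powi (N ^ 2 - N) * q powi (N ^ 2)) * f N)"
      by (simp add: theta_coeff_def mult_ac)
    also have "q powi (N ^ 2 - N) * q powi (N ^ 2) = q powi (2 * N ^ 2 - N)"
      by (subst powi_add[OF q(1), symmetric]) (simp add: algebra_simps)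
    finally show ?thesis .
  qed
  have row: "((\<lambda>N. F (n, N)) has_sum g n * theta_sum q n f) UNIV" for n
    unfolding F_def prod.case theta_sum_def
    by (intro has_sum_cmult_right has_sum_finite_neutralI[of "{-int n..int n}"]) (auto simp: theta_weight_outside)
  have "((\<lambda>N. K * (q powi (2 * N ^ 2 - N) * f N)) has_sum infsum F (UNIV \<times> UNIV)) UNIV"
  proof (rule has_sum_SigmaD)
    show "((\<lambda>(N, n). F (n, N)) has_sum infsum F (UNIV \<times> UNIV)) (UNIV \<times> UNIV)"
      using hs by (subst (asm) has_sum_swap)
  qed (use col in auto)
  moreover have "((\<lambda>N. K * (q powi (2 * N ^ 2 - N) * f N)) has_sum K * S) UNIV"
    by (rule has_sum_cmult_right[OF S])
  ultimately have "infsum F (UNIV \<times> UNIV) = K * S" by (rule has_sum_unique)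
  with hs have "(F has_sum K * S) (UNIV \<times> UNIV)" by simp
  from has_sum_SigmaD[OF this row] show ?thesis unfolding K_def .
qed

text \<open>Because (q;q^2)_n (q^2;q^2)_n = (q;q)_2n and (q^2;q^2)_2n = (q;q)_2n (-q;q)_2n.\<close>

lemma qpoch_quotient:
  "qpoch q (q ^ 2) n * qpoch (q ^ 2) (q ^ 2) n / qpoch (q ^ 2) (q ^ 2) (2 * n) = inverse (qpoch (- q) q (2 * n))"
proof -
  have 1: "qpoch q q (2 * n) = qpoch q (q ^ 2) n * qpoch (q ^ 2) (q ^ 2) n"
  proof (induction n)
    case (Suc n)
    have "qpoch q q (2 * Suc n) = qpoch q q (2 * n) * ((1 - (q ^ 2) ^ n * q) * (1 - (q ^ 2) ^ n * q ^ 2))"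
      unfolding power_mult[symmetric] by (simp add: qpoch_Suc power2_eq_square mult_ac)
    thus ?case unfolding Suc.IH by (simp only: qpoch_Suc mult_ac)
  qed auto
  have 2: "qpoch (q ^ 2) (q ^ 2) m = qpoch q q m * qpoch (- q) q m" for m
    unfolding qpoch_def prod.distrib[symmetric]
    by (rule prod.cong) (auto simp: algebra_simps power2_eq_square power_mult_distrib)
  have "qpoch q q (2 * n) \<noteq> 0" by (rule qpoch_nz) (use q in auto)
  thus ?thesis unfolding 1[symmetric] 2[of "2 * n"] by (simp add: field_simps)
qed

text \<open>By \<open>qpoch_quotient\<close>, delta_n beta_n is the summand of X. On r + s = N the
  exponent is (2N^2 - N) + 2N + 2rs. The prefactor is the reciprocal of psi(q).\<close>

lemma mock_X_hecke:
  assumes S: "((\<lambda>(r, s). hsgn r s * q powi (2 * r ^ 2 + 2 * s ^ 2 + 6 * r * s + r + s)) has_sum S) (UNIV \<times> UNIV)"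
  shows "mock_X q = qpoch_inf q (q ^ 2) / qpoch_inf (q ^ 2) (q ^ 2) * S"
proof -
  let ?Q = "q ^ 2"
  define f where "f = (\<lambda>N. ?Q powi N * hecke_coeff ?Q N)"
  \<comment> \<open>The transform asks for convergence already with the exponent of
    \<open>theta_coeff\<close>, which grows more slowly than the one in the final double
    sum.\<close>
  have 1: "(\<lambda>N. theta_coeff q N * f N) summable_on UNIV"
  proof -
    have "(\<lambda>(r, s). hsgn r s * (q powi ((r + s) ^ 2 + (r + s) + 2 * (r * s)) * (-1) powi (r + s))) summable_on UNIV \<times> UNIV"
    proof (rule hecke_double_summable[where k = 1 and C = 1, OF q])
      fix r s :: int assume "hsgn r s \<noteq> 0"
      hence "r * s \<ge> 0" by (rule hsgn_mult_nonneg)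
      thus "r ^ 2 - int 1 * \<bar>r\<bar> + (s ^ 2 - int 1 * \<bar>s\<bar>) \<le> (r + s) ^ 2 + (r + s) + 2 * (r * s)"
        unfolding power2_sum using abs_ge_minus_self[of r] abs_ge_minus_self[of s] by linarith
    qed simp
    also have "(\<lambda>(r, s). hsgn r s * (q powi ((r + s) ^ 2 + (r + s) + 2 * (r * s)) * (-1) powi (r + s))) =
        (\<lambda>(r, s). hsgn r s * ((theta_coeff q (r + s) * ?Q powi (r + s)) * ?Q powi (r * s)))"
    proof (intro ext, clarify)
      fix r s :: int
      have e: "(r + s) ^ 2 + (r + s) + 2 * (r * s) = ((r + s) ^ 2 - (r + s)) + 2 * (r + s) + 2 * (r * s)" by simp
      have "q powi ((r + s) ^ 2 + (r + s) + 2 * (r * s)) =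
          q powi ((r + s) ^ 2 - (r + s)) * ?Q powi (r + s) * ?Q powi (r * s)"
        unfolding e powi_add[OF q(1)] by (simp only: power_int_power of_nat_numeral)
      thus "hsgn r s * (q powi ((r + s) ^ 2 + (r + s) + 2 * (r * s)) * (-1) powi (r + s)) =
          hsgn r s * ((theta_coeff q (r + s) * ?Q powi (r + s)) * ?Q powi (r * s))"
        by (simp only: theta_coeff_def mult_ac)
    qed
    finally have "(\<lambda>N. theta_coeff q N * ?Q powi N * hecke_coeff ?Q N) summable_on UNIV"
      using hecke_coeff_sum has_sum_imp_summable summable_iff_has_sum_infsum by fast
    thus ?thesis by (simp add: f_def mult_ac)
  qed
  have 2: "((\<lambda>N. q powi (2 * N ^ 2 - N) * f N) has_sum S) UNIV"
  proof -
    have "q powi (2 * r ^ 2 + 2 * s ^ 2 + 6 * r * s + r + s) =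
        (q powi (2 * (r + s) ^ 2 - (r + s)) * ?Q powi (r + s)) * ?Q powi (r * s)" for r s
    proof -
      have e: "2 * r ^ 2 + 2 * s ^ 2 + 6 * r * s + r + s = (2 * (r + s) ^ 2 - (r + s)) + 2 * (r + s) + 2 * (r * s)"
        unfolding power2_sum by (simp add: algebra_simps)
      show ?thesis unfolding e powi_add[OF q(1)] by (simp only: power_int_power of_nat_numeral)
    qed
    hence "((\<lambda>N. q powi (2 * N ^ 2 - N) * ?Q powi N * hecke_coeff ?Q N) has_sum S) UNIV"
      by (intro hecke_coeff_sum) (use S in simp)
    thus ?thesis by (simp add: f_def mult_ac)
  qed
  have "((\<lambda>n. (-1) ^ n * q ^ (n ^ 2) * qpoch q ?Q n * theta_sum q n f) has_sum
      qpoch_inf q ?Q / qpoch_inf ?Q ?Q * S) UNIV"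
    by (rule conjugate_bailey[OF 1 2])
  also have "(\<lambda>n. (-1) ^ n * q ^ (n ^ 2) * qpoch q ?Q n * theta_sum q n f) =
      (\<lambda>n. (-1) ^ n * q ^ (n ^ 2) / qpoch (- q) q (2 * n))"
  proof
    fix n
    have "qpoch q ?Q n * theta_sum q n f = inverse (qpoch (- q) q (2 * n))"
      unfolding f_def theta_sum_hecke[OF q refl] qpoch_quotient[symmetric] by simp
    thus "(-1) ^ n * q ^ (n ^ 2) * qpoch q ?Q n * theta_sum q n f = (-1) ^ n * q ^ (n ^ 2) / qpoch (- q) q (2 * n)"
      by (simp only: mult.assoc divide_inverse)
  qed
  finally show ?thesis
    unfolding mock_X_def by (intro sums_unique[symmetric] has_sum_imp_sums)
qed

text \<open>Here beta_n has an extra factor 1 + q^(2n), which cancels the last factor of (-q;q)_2n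
  and leaves an odd length. The term at n = 0 vanishes, so the series starts at one, and the sign
  lost by this shift is restored by reflecting the double sum.\<close>

lemma mock_chi_hecke:
  assumes S: "((\<lambda>(r, s). hsgn r s * q powi (2 * r ^ 2 + 2 * s ^ 2 + 6 * r * s + 3 * r + 3 * s + 1)) has_sum S) (UNIV \<times> UNIV)"
  shows "mock_chi q = qpoch_inf q (q ^ 2) / qpoch_inf (q ^ 2) (q ^ 2) * S"
proof -
  let ?Q = "q ^ 2"
  have Q0: "?Q \<noteq> 0" using q by simp
  define f where "f = (\<lambda>N. ?Q powi (2 * N) * hecke_coeff ?Q (N - 1))"
  have 1: "(\<lambda>N. theta_coeff q N * f N) summable_on UNIV"
  proof -
    have "(\<lambda>(r, s). hsgn r s * (q powi ((r + s) ^ 2 + 5 * (r + s) + 4 + 2 * (r * s)) * (-1) powi (r + s + 1))) summable_on UNIV \<times> UNIV"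
    proof (rule hecke_double_summable[where k = 5 and C = 1, OF q])
      fix r s :: int assume "hsgn r s \<noteq> 0"
      hence "r * s \<ge> 0" by (rule hsgn_mult_nonneg)
      thus "r ^ 2 - int 5 * \<bar>r\<bar> + (s ^ 2 - int 5 * \<bar>s\<bar>) \<le> (r + s) ^ 2 + 5 * (r + s) + 4 + 2 * (r * s)"
        unfolding power2_sum using abs_ge_minus_self[of r] abs_ge_minus_self[of s] by simp
    qed simp
    also have "(\<lambda>(r, s). hsgn r s * (q powi ((r + s) ^ 2 + 5 * (r + s) + 4 + 2 * (r * s)) * (-1) powi (r + s + 1))) =
        (\<lambda>(r, s). hsgn r s * ((theta_coeff q (r + s + 1) * ?Q powi (2 * (r + s + 1))) * ?Q powi (r * s)))"
    proof (intro ext, clarify)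
      fix r s :: int
      have e: "(r + s) ^ 2 + 5 * (r + s) + 4 + 2 * (r * s) =
          ((r + s + 1) ^ 2 - (r + s + 1)) + 2 * (2 * (r + s + 1)) + 2 * (r * s)"
        by (simp add: power2_eq_square algebra_simps)
      have "q powi ((r + s) ^ 2 + 5 * (r + s) + 4 + 2 * (r * s)) =
          q powi ((r + s + 1) ^ 2 - (r + s + 1)) * ?Q powi (2 * (r + s + 1)) * ?Q powi (r * s)"
        unfolding e powi_add[OF q(1), of "((r + s + 1) ^ 2 - (r + s + 1)) + 2 * (2 * (r + s + 1))"]
          powi_add[OF q(1), of "(r + s + 1) ^ 2 - (r + s + 1)"] by (simp only: power_int_power of_nat_numeral)
      thus "hsgn r s * (q powi ((r + s) ^ 2 + 5 * (r + s) + 4 + 2 * (r * s)) * (-1) powi (r + s + 1)) =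
          hsgn r s * ((theta_coeff q (r + s + 1) * ?Q powi (2 * (r + s + 1))) * ?Q powi (r * s))"
        by (simp only: theta_coeff_def mult_ac)
    qed
    finally have "(\<lambda>M. theta_coeff q (M + 1) * ?Q powi (2 * (M + 1)) * hecke_coeff ?Q M) summable_on UNIV"
      using hecke_coeff_sum[where F = "\<lambda>N. theta_coeff q (N + 1) * ?Q powi (2 * (N + 1))"]
        has_sum_imp_summable summable_iff_has_sum_infsum by fast
    thus ?thesis
      by (subst summable_on_reindex_bij_witness[of _ "\<lambda>M. M + 1" "\<lambda>N. N - 1" UNIV
            "\<lambda>M. theta_coeff q (M + 1) * ?Q powi (2 * (M + 1)) * hecke_coeff ?Q M"])
         (auto simp: f_def mult_ac)
  qed
  have 2: "((\<lambda>N. q powi (2 * N ^ 2 - N) * f N) has_sum - S) UNIV"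
  proof -
    have "q powi (2 * r ^ 2 + 2 * s ^ 2 + 6 * r * s + 3 * r + 3 * s + 1) =
        q powi (2 * (r + s) ^ 2 + 3 * (r + s) + 1) * ?Q powi (r * s)" for r s
    proof -
      have e: "2 * r ^ 2 + 2 * s ^ 2 + 6 * r * s + 3 * r + 3 * s + 1 = (2 * (r + s) ^ 2 + 3 * (r + s) + 1) + 2 * (r * s)"
        unfolding power2_sum by (simp add: algebra_simps)
      show ?thesis unfolding e powi_add[OF q(1), of "2 * (r + s) ^ 2 + 3 * (r + s) + 1"]
        by (simp only: power_int_power of_nat_numeral)
    qed
    hence "((\<lambda>M. q powi (2 * M ^ 2 + 3 * M + 1) * hecke_coeff ?Q M) has_sum S) UNIV"
      by (intro hecke_coeff_sum) (use S in simp)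
    hence *: "((\<lambda>M. - (q powi (2 * M ^ 2 + 3 * M + 1) * hecke_coeff ?Q M)) has_sum - S) UNIV"
      by (rule has_sum_uminusI)
    \<comment> \<open>Indexing by M = N - 1 would give the exponent 2M^2 + 7M + 5; the reflection
      gives 2M^2 + 3M + 1 at the cost of a sign.\<close>
    have reflect: "q powi (2 * (-1 - M) ^ 2 - (-1 - M)) * f (-1 - M) = - (q powi (2 * M ^ 2 + 3 * M + 1) * hecke_coeff ?Q M)" for M
    proof -
      have e: "2 * M ^ 2 + 3 * M + 1 = (2 * (-1 - M) ^ 2 - (-1 - M)) + 2 * (2 * (-1 - M)) + 2 * (M + 1)"
        by (simp add: power2_eq_square algebra_simps)
      have "q powi (2 * M ^ 2 + 3 * M + 1) = q powi (2 * (-1 - M) ^ 2 - (-1 - M)) * ?Q powi (2 * (-1 - M)) * ?Q powi (M + 1)"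
        unfolding e powi_add[OF q(1), of "(2 * (-1 - M) ^ 2 - (-1 - M)) + 2 * (2 * (-1 - M))"]
          powi_add[OF q(1), of "2 * (-1 - M) ^ 2 - (-1 - M)"] by (simp only: power_int_power of_nat_numeral)
      moreover have "f (-1 - M) = - (?Q powi (2 * (-1 - M)) * (?Q powi (M + 1) * hecke_coeff ?Q M))"
        using hecke_coeff_reflect[OF Q0, of M] by (simp add: f_def)
      ultimately show ?thesis by simp
    qed
    have "((\<lambda>N. q powi (2 * N ^ 2 - N) * f N) has_sum - S) UNIV \<longleftrightarrow>
        ((\<lambda>M. - (q powi (2 * M ^ 2 + 3 * M + 1) * hecke_coeff ?Q M)) has_sum - S) UNIV"
    proof (rule has_sum_reindex_bij_witness[of _ "\<lambda>M. -1 - M" "\<lambda>N. -1 - N"])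
      show "- (q powi (2 * (-1 - N) ^ 2 + 3 * (-1 - N) + 1) * hecke_coeff ?Q (-1 - N)) = q powi (2 * N ^ 2 - N) * f N" for N
        using reflect[of "-1 - N"] by simp
    qed auto
    thus ?thesis using * by simp
  qed
  define G where "G = (\<lambda>n. (-1) ^ n * q ^ (n ^ 2) * qpoch q ?Q n * theta_sum q n f)"
  have "(G has_sum qpoch_inf q ?Q / qpoch_inf ?Q ?Q * - S) UNIV"
    unfolding G_def by (rule conjugate_bailey[OF 1 2])
  hence "G sums (- (qpoch_inf q ?Q / qpoch_inf ?Q ?Q * S))"
    using has_sum_imp_sums by fastforce
  \<comment> \<open>At -1 both sums in \<open>hecke_coeff\<close> are empty.\<close>
  moreover have "G 0 = 0" by (simp add: G_def f_def hecke_coeff_def)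
  ultimately have "(\<lambda>n. G (Suc n)) sums (- (qpoch_inf q ?Q / qpoch_inf ?Q ?Q * S))"
    by (simp add: sums_Suc_iff)
  hence "(\<lambda>n. - G (Suc n)) sums (qpoch_inf q ?Q / qpoch_inf ?Q ?Q * S)"
    using sums_minus by fastforce
  also have "(\<lambda>n. - G (Suc n)) = (\<lambda>n. (-1) ^ n * q ^ ((n + 1) ^ 2) / qpoch (- q) q (2 * n + 1))"
  proof
    fix n
    let ?m = "Suc n"
    have "norm (?Q ^ ?m) < 1" by (rule norm_power_less_1) (use q2 in auto)
    hence nz: "1 + ?Q ^ ?m \<noteq> 0" by (metis add_eq_0_iff norm_minus_cancel norm_one less_irrefl)
    have "qpoch q ?Q ?m * theta_sum q ?m f = (1 + ?Q ^ ?m) * (qpoch q ?Q ?m * qpoch ?Q ?Q ?m / qpoch ?Q ?Q (2 * ?m))"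
      unfolding f_def theta_sum_hecke_pred[OF q refl zero_less_Suc] by simp
    also have "\<dots> = (1 + ?Q ^ ?m) * inverse (qpoch (- q) q (2 * ?m))"
      unfolding qpoch_quotient ..
    also have "qpoch (- q) q (2 * ?m) = qpoch (- q) q (2 * n + 1) * (1 + ?Q ^ ?m)"
    proof -
      have "q ^ (2 * n + 1) * q = q ^ (2 * ?m)" by simp
      hence "q ^ (2 * n + 1) * q = ?Q ^ ?m" by (simp only: power_mult)
      moreover have "2 * ?m = Suc (2 * n + 1)" by simp
      ultimately show ?thesis using qpoch_Suc[of "- q" q "2 * n + 1"] by simp
    qed
    finally have "qpoch q ?Q ?m * theta_sum q ?m f = inverse (qpoch (- q) q (2 * n + 1))"
      using nz by simp
    thus "- G ?m = (-1) ^ n * q ^ ((n + 1) ^ 2) / qpoch (- q) q (2 * n + 1)"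
      by (simp add: G_def mult.assoc divide_inverse)
  qed
  finally show ?thesis
    unfolding mock_chi_def by (intro sums_unique[symmetric])
qed

end

section \<open>The pairing of a theta function with itself\<close>

lemma has_sum_product:
  fixes f :: "'a \<Rightarrow> complex" and g :: "'b \<Rightarrow> complex"
  assumes f: "(f has_sum S) A" and g: "(g has_sum T) B"
  shows "((\<lambda>(x, y). f x * g y) has_sum (S * T)) (A \<times> B)"
proof (rule has_sum_SigmaI)
  show "((\<lambda>x. f x * T) has_sum S * T) A" by (rule has_sum_cmult_left[OF f])
  show "((\<lambda>y. case (x, y) of (x, y) \<Rightarrow> f x * g y) has_sum f x * T) B" for x
    by (simp add: has_sum_cmult_right[OF g])
  show "(\<lambda>(x, y). f x * g y) summable_on A \<times> B"
  proof (rule summable_on_complex_bound)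
    show "(\<lambda>(x, y). norm (f x) * norm (g y)) summable_on A \<times> B"
      using has_sum_imp_summable[OF f] has_sum_imp_summable[OF g]
      by (intro summable_on_product) (simp_all add: summable_on_iff_abs_summable_on_complex)
  qed (auto simp: norm_mult)
qed

lemma sum_telescope_int:
  fixes h :: "int \<Rightarrow> 'a :: ab_group_add"
  assumes "a \<le> b + 1"
  shows "(\<Sum>i\<in>{a..b}. h (i + 1) - h i) = h (b + 1) - h a"
proof -
  have "(\<Sum>i\<in>{a..a + int n - 1}. h (i + 1) - h i) = h (a + int n) - h a" for n
  proof (induction n)
    case (Suc n)
    have "{a..a + int (Suc n) - 1} = insert (a + int n) {a..a + int n - 1}" by auto
    thus ?case using Suc by (simp add: algebra_simps)
  qed auto
  from this[of "nat (b + 1 - a)"] show ?thesis using assms by simp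
qed

text \<open>One formula for all integers \<open>N\<close>, negative ones included, since both parts
  telescope the same function. It is division-free because equal arguments are needed too.\<close>

lemma hsgn_geometric:
  fixes x y :: complex
  assumes "x \<noteq> 0" "y \<noteq> 0"
  obtains g where "((\<lambda>i. hsgn i (N - i) * (x powi i * y powi (N - i))) has_sum g) UNIV"
    "(x - y) * g = x powi (N + 1) - y powi (N + 1)" "x = y \<Longrightarrow> g = of_int (N + 1) * x powi N"
proof
  let ?t = "\<lambda>i. x powi i * y powi (N - i)"
  let ?g = "(\<Sum>i\<in>{0..N}. ?t i) - (\<Sum>i\<in>{N+1..-1}. ?t i)"
  show "((\<lambda>i. hsgn i (N - i) * ?t i) has_sum ?g) UNIV"
  proof (rule has_sum_finite_neutralI[of "{0..N} \<union> {N+1..-1}"])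
    have "(\<Sum>i\<in>{0..N} \<union> {N+1..-1}. hsgn i (N - i) * ?t i) =
        (\<Sum>i\<in>{0..N}. hsgn i (N - i) * ?t i) + (\<Sum>i\<in>{N+1..-1}. hsgn i (N - i) * ?t i)"
      by (rule sum.union_disjoint) auto
    also have "(\<Sum>i\<in>{0..N}. hsgn i (N - i) * ?t i) = (\<Sum>i\<in>{0..N}. ?t i)"
      by (rule sum.cong) (auto simp: hsgn_def)
    also have "(\<Sum>i\<in>{N+1..-1}. hsgn i (N - i) * ?t i) = (\<Sum>i\<in>{N+1..-1}. - ?t i)"
      by (rule sum.cong) (auto simp: hsgn_def)
    finally show "?g = (\<Sum>i\<in>{0..N} \<union> {N+1..-1}. hsgn i (N - i) * ?t i)"
      by (simp add: sum_negf)
  qed (auto simp: hsgn_def)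
  define h where "h = (\<lambda>i. x powi i * y powi (N + 1 - i))"
  have t: "(x - y) * ?t i = h (i + 1) - h i" for i
  proof -
    have "N + 1 - i = (N - i) + 1" "N + 1 - (i + 1) = N - i" by simp_all
    thus ?thesis
      unfolding h_def by (simp only: powi_add[OF assms(1)] powi_add[OF assms(2)] power_int_1_right)
        (simp add: algebra_simps)
  qed
  have "(x - y) * ?g = (\<Sum>i\<in>{0..N}. h (i + 1) - h i) - (\<Sum>i\<in>{N+1..-1}. h (i + 1) - h i)"
    unfolding t[symmetric] by (simp add: right_diff_distrib sum_distrib_left)
  also have "\<dots> = h (N + 1) - h 0"
  proof (cases "N \<ge> 0")
    case True
    thus ?thesis using sum_telescope_int[of 0 N h] by simp
  next
    case False
    thus ?thesis using sum_telescope_int[of "N + 1" "-1" h] by simp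
  qed
  finally show "(x - y) * ?g = x powi (N + 1) - y powi (N + 1)" by (simp add: h_def)
  show "?g = of_int (N + 1) * x powi N" if "x = y"
  proof -
    have "?t i = x powi N" for i
      using that powi_add[OF assms(1), of i "N - i"] by simp
    thus ?thesis by (cases "N \<ge> 0") (auto simp: algebra_simps)
  qed
qed

section \<open>Orthogonality of shifted theta coefficients under the kernel\<close>

context
  fixes q :: complex
  assumes q: "q \<noteq> 0" "norm q < 1"
begin

text \<open>The coefficients of j(z;q^6).\<close>

private abbreviation th :: "int \<Rightarrow> complex" where "th \<equiv> theta_coeff (q ^ 3)"
private abbreviation E :: complex where "E \<equiv> qpoch_inf (q ^ 6) (q ^ 6)"

private lemma th_eq: "th n = (-1) powi n * q powi (3 * (n ^ 2 - n))"
  by (simp add: theta_coeff_def power_int_power)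

private lemma q3: "q ^ 3 \<noteq> 0" "norm (q ^ 3) < 1" "(q ^ 3) ^ 2 = q ^ 6"
  using q by (auto simp: norm_power_less_1 simp flip: power_mult)

private lemma th_sum: "(th has_sum 0) UNIV"
proof -
  have "qpoch_inf 1 (q ^ 6) = qpoch 1 (q ^ 6) 1 * qpoch_inf ((q ^ 6) ^ 1 * 1) (q ^ 6)"
    by (rule qpoch_inf_shift) (use q in \<open>simp add: norm_power_less_1\<close>)
  hence "theta_j 1 (q ^ 6) = 0" by (simp add: theta_j_def qpoch_def)
  thus ?thesis using jacobi_triple_product[OF q3(1,2), of 1] unfolding q3(3) by simp
qed

private lemma th_cube: "((\<lambda>n. th n * of_int n) has_sum - (E ^ 3)) UNIV"
  using jacobi_cube[OF q3(1,2)] unfolding q3(3) .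

private lemma has_sum_shift: "((\<lambda>n. f (n - k)) has_sum S) UNIV \<longleftrightarrow> (f has_sum S) (UNIV :: int set)"
  by (rule has_sum_reindex_bij_witness[of _ "\<lambda>n. n + k" "\<lambda>n. n - k"]) auto

text \<open>On r + s = N the quadratic part 3r^2 + 3s^2 + 6rs equals 3N^2, so \<open>i\<close>
  survives only in the linear exponents that the shifts \<open>k\<close> and \<open>l\<close>
  supply.\<close>

private lemma th_split:
  "th (i - k) * th (N - i - l) * q powi (6 * (i * (N - i))) =
     th (- k) * th (- l) * th N * ((q powi (- 6 * k)) powi i * (q powi (- 6 * l)) powi (N - i))"
proof -
  have sgn: "(-1 :: complex) powi (i - k) * (-1) powi (N - i - l) = (-1) powi (- k) * (-1) powi (- l) * (-1) powi N"
    by (simp only: powi_add[of "-1", symmetric] zero_neq_neg_one[symmetric] not_False_eq_True)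
       (simp add: algebra_simps)
  have e: "3 * ((i - k) ^ 2 - (i - k)) + 3 * ((N - i - l) ^ 2 - (N - i - l)) + 6 * (i * (N - i)) =
      3 * ((- k) ^ 2 - (- k)) + 3 * ((- l) ^ 2 - (- l)) + 3 * (N ^ 2 - N) + ((- 6 * k) * i + (- 6 * l) * (N - i))"
    by (simp add: power2_eq_square algebra_simps)
  have "q powi (3 * ((i - k) ^ 2 - (i - k))) * q powi (3 * ((N - i - l) ^ 2 - (N - i - l))) * q powi (6 * (i * (N - i))) =
      q powi (3 * ((- k) ^ 2 - (- k))) * q powi (3 * ((- l) ^ 2 - (- l))) * q powi (3 * (N ^ 2 - N)) *
      (q powi ((- 6 * k) * i) * q powi ((- 6 * l) * (N - i)))"
    unfolding powi_add[OF q(1), symmetric] e ..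
  note e = this
  have "th (i - k) * th (N - i - l) * q powi (6 * (i * (N - i))) =
      ((-1) powi (i - k) * (-1) powi (N - i - l)) *
      (q powi (3 * ((i - k) ^ 2 - (i - k))) * q powi (3 * ((N - i - l) ^ 2 - (N - i - l))) * q powi (6 * (i * (N - i))))"
    by (simp only: th_eq mult_ac)
  also have "\<dots> = th (- k) * th (- l) * th N * (q powi ((- 6 * k) * i) * q powi ((- 6 * l) * (N - i)))"
    unfolding sgn e by (simp only: th_eq mult_ac)
  finally show ?thesis by (simp only: power_int_mult)
qed

private lemma th_shift: "th (- k) * th N * (q powi (- 6 * k)) powi N = th (N - k)"
proof -
  have sgn: "(-1 :: complex) powi (N - k) = (-1) powi (- k) * (-1) powi N"
    using powi_add[of "-1" "-k" N] by (simp add: algebra_simps)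
  have e: "3 * ((N - k) ^ 2 - (N - k)) = 3 * ((- k) ^ 2 - (- k)) + 3 * (N ^ 2 - N) + (- 6 * k) * N"
    by (simp add: power2_eq_square algebra_simps)
  show ?thesis
    unfolding th_eq sgn e powi_add[OF q(1), of "3 * ((- k) ^ 2 - (- k)) + 3 * (N ^ 2 - N)"]
      powi_add[OF q(1), of "3 * ((- k) ^ 2 - (- k))"] power_int_mult[symmetric] by (simp add: mult_ac)
qed

text \<open>The constant is symmetric in \<open>k\<close> and \<open>l\<close>, so that one constant
  serves both variables of the double sum.\<close>

private lemma th_exponent_bound:
  "3 * ((r - k) ^ 2 - (r - k)) \<ge> r ^ 2 - int (nat (6 * \<bar>k\<bar> + 6 * \<bar>l\<bar> + 3)) * \<bar>r\<bar>" for r k l :: int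
proof -
  have "k ^ 2 + k \<ge> 0"
  proof (cases "k \<ge> 0")
    case False
    hence "(- k) * 1 \<le> (- k) * (- k)" by (intro mult_left_mono) auto
    thus ?thesis by (simp add: power2_eq_square)
  qed auto
  moreover have "k * r \<le> \<bar>k\<bar> * \<bar>r\<bar>" by (metis abs_ge_self abs_mult)
  moreover have "0 \<le> \<bar>l\<bar> * \<bar>r\<bar>" by simp
  moreover have "r \<le> \<bar>r\<bar>" "0 \<le> r ^ 2" by simp_all
  moreover have "3 * ((r - k) ^ 2 - (r - k)) = 3 * r ^ 2 - 6 * (k * r) - 3 * r + 3 * (k ^ 2 + k)"
    by (simp add: power2_eq_square algebra_simps)
  moreover have "int (nat (6 * \<bar>k\<bar> + 6 * \<bar>l\<bar> + 3)) * \<bar>r\<bar> = 6 * (\<bar>k\<bar> * \<bar>r\<bar>) + 6 * (\<bar>l\<bar> * \<bar>r\<bar>) + 3 * \<bar>r\<bar>"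
    by (simp add: algebra_simps)
  moreover have aux: "r2 - (6 * A + 6 * B + 3 * C) \<le> 3 * r2 - 6 * kr - 3 * r + 3 * M"
    if "0 \<le> M" "kr \<le> A" "0 \<le> B" "r \<le> C" "0 \<le> r2" for M kr A B C r2 r :: int
    using that by linarith
  ultimately show ?thesis by (simp only:)
qed

text \<open>Informally this is the constant term of the kernel times x^(-k) j(1/x) y^(-l) j(1/y):
  the thetas cancel the denominator, and the remaining j(xy) has only equal powers of x and y. The
  proof sums along r + s = N. Unequal shifts give a combination of shifted copies of
  \<open>th\<close>, each with sum zero; equal shifts give a factor N + 1 and with it the cube
  identity.\<close>

lemma theta_kernel:
  "((\<lambda>(r, s). hsgn r s * (th (r - k) * th (s - l) * q powi (6 * (r * s)))) has_sum
     (if k = l then - (th (- k) * E ^ 3) else 0)) (UNIV \<times> UNIV)" (is "(?F has_sum ?V) _")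
proof -
  let ?K = "nat (6 * \<bar>k\<bar> + 6 * \<bar>l\<bar> + 3)"
  have "(\<lambda>(r, s). hsgn r s * (q powi (3 * ((r - k) ^ 2 - (r - k)) + 3 * ((s - l) ^ 2 - (s - l)) + 6 * (r * s))
      * ((-1) powi (r - k) * (-1) powi (s - l)))) summable_on UNIV \<times> UNIV"
  proof (rule hecke_double_summable[where k = ?K and C = 1, OF q])
    fix r s assume "hsgn r s \<noteq> 0"
    hence "r * s \<ge> 0" by (rule hsgn_mult_nonneg)
    moreover have "3 * ((s - l) ^ 2 - (s - l)) \<ge> s ^ 2 - int ?K * \<bar>s\<bar>"
      using th_exponent_bound[of s l k] by (simp add: add_ac)
    ultimately show "r ^ 2 - int ?K * \<bar>r\<bar> + (s ^ 2 - int ?K * \<bar>s\<bar>) \<le>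
       3 * ((r - k) ^ 2 - (r - k)) + 3 * ((s - l) ^ 2 - (s - l)) + 6 * (r * s)"
      using th_exponent_bound[of r k l] by linarith
  qed (simp add: norm_mult)
  also have "(\<lambda>(r, s). hsgn r s * (q powi (3 * ((r - k) ^ 2 - (r - k)) + 3 * ((s - l) ^ 2 - (s - l)) + 6 * (r * s))
      * ((-1) powi (r - k) * (-1) powi (s - l)))) = ?F"
    by (simp only: th_eq powi_add[OF q(1)] mult_ac)
  finally obtain S where S: "(?F has_sum S) (UNIV \<times> UNIV)"
    using summable_on_def by blast
  have "((\<lambda>(N, i). hsgn i (N - i) * (th (i - k) * th (N - i - l) * q powi (6 * (i * (N - i))))) has_sum S) (UNIV \<times> UNIV)
      \<longleftrightarrow> (?F has_sum S) (UNIV \<times> UNIV)"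
    by (rule has_sum_reindex_bij_witness[of _ "\<lambda>(r, s). (r + s, r)" "\<lambda>(N, i). (i, N - i)"]) auto
  with S have S': "((\<lambda>(N, i). hsgn i (N - i) * (th (i - k) * th (N - i - l) * q powi (6 * (i * (N - i))))) has_sum S)
      (UNIV \<times> UNIV)" by simp
  define x y where "x = q powi (- 6 * k)" and "y = q powi (- 6 * l)"
  have xy: "x \<noteq> 0" "y \<noteq> 0" using q by (auto simp: x_def y_def)
  have "\<exists>g. ((\<lambda>i. hsgn i (N - i) * (x powi i * y powi (N - i))) has_sum g) UNIV \<and>
      (x - y) * g = x powi (N + 1) - y powi (N + 1) \<and> (x = y \<longrightarrow> g = of_int (N + 1) * x powi N)" for N
    using hsgn_geometric[OF xy, of N] by blast
  hence "\<forall>N. \<exists>g. ((\<lambda>i. hsgn i (N - i) * (x powi i * y powi (N - i))) has_sum g) UNIV \<and>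
      (x - y) * g = x powi (N + 1) - y powi (N + 1) \<and> (x = y \<longrightarrow> g = of_int (N + 1) * x powi N)"
    by (rule allI)
  from choice[OF this] obtain g where "\<forall>N. ((\<lambda>i. hsgn i (N - i) * (x powi i * y powi (N - i))) has_sum g N) UNIV \<and>
      (x - y) * g N = x powi (N + 1) - y powi (N + 1) \<and> (x = y \<longrightarrow> g N = of_int (N + 1) * x powi N)"
    by blast
  hence g: "((\<lambda>i. hsgn i (N - i) * (x powi i * y powi (N - i))) has_sum g N) UNIV"
      "(x - y) * g N = x powi (N + 1) - y powi (N + 1)" "x = y \<Longrightarrow> g N = of_int (N + 1) * x powi N" for N
    by blast+
  have "((\<lambda>N. th (- k) * th (- l) * th N * g N) has_sum S) UNIV"
  proof (rule has_sum_SigmaD[OF S'])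
    fix N
    have "((\<lambda>i. th (- k) * th (- l) * th N * (hsgn i (N - i) * (x powi i * y powi (N - i)))) has_sum
        th (- k) * th (- l) * th N * g N) UNIV"
      by (rule has_sum_cmult_right[OF g(1)])
    thus "((\<lambda>i. case (N, i) of (N, i) \<Rightarrow> hsgn i (N - i) * (th (i - k) * th (N - i - l) * q powi (6 * (i * (N - i)))))
        has_sum th (- k) * th (- l) * th N * g N) UNIV"
      unfolding prod.case th_split x_def y_def by (simp only: mult_ac)
  qed
  moreover have "((\<lambda>N. th (- k) * th (- l) * th N * g N) has_sum ?V) UNIV"
  proof (cases "k = l")
    case True
    \<comment> \<open>In terms of n = N - k the factor N + 1 is n + (k + 1); the constant part is
      killed by \<open>th_sum\<close>.\<close>
    have "((\<lambda>n. th (- k) * (th n * of_int n + of_int (k + 1) * th n)) has_sum th (- k) * (- (E ^ 3) + of_int (k + 1) * 0)) UNIV"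
      by (intro has_sum_cmult_right has_sum_add th_cube th_sum)
    hence "((\<lambda>N. th (- k) * (th (N - k) * of_int (N - k) + of_int (k + 1) * th (N - k))) has_sum
        th (- k) * (- (E ^ 3) + of_int (k + 1) * 0)) UNIV"
      by (subst has_sum_shift[where f = "\<lambda>n. th (- k) * (th n * of_int n + of_int (k + 1) * th n)"])
    also have "(\<lambda>N. th (- k) * (th (N - k) * of_int (N - k) + of_int (k + 1) * th (N - k))) =
        (\<lambda>N. th (- k) * th (- l) * th N * g N)"
    proof
      fix N
      have "g N = of_int (N + 1) * x powi N" using g(3) True by (simp add: x_def y_def)
      hence "th (- k) * th (- l) * th N * g N = th (- k) * of_int (N + 1) * (th (- k) * th N * x powi N)"
        by (simp add: True mult_ac)
      also have "th (- k) * th N * x powi N = th (N - k)"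
        unfolding x_def by (rule th_shift)
      finally show "th (- k) * (th (N - k) * of_int (N - k) + of_int (k + 1) * th (N - k)) =
          th (- k) * th (- l) * th N * g N" by (simp add: algebra_simps)
    qed
    finally show ?thesis by (simp add: True)
  next
    case False
    \<comment> \<open>As 0 < |q| < 1, distinct exponents give powers that differ already in absolute
      value.\<close>
    have "norm x \<noteq> norm y"
    proof
      assume "norm x = norm y"
      hence "norm q powi (- 6 * k) = norm q powi (- 6 * l)" by (simp add: x_def y_def)
      moreover have "norm q powi (- 6 * k) < norm q powi (- 6 * l) \<or> norm q powi (- 6 * l) < norm q powi (- 6 * k)"
        using False q power_int_strict_decreasing[of "- 6 * k" "- 6 * l" "norm q"]
          power_int_strict_decreasing[of "- 6 * l" "- 6 * k" "norm q"] by (cases "k < l") auto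
      ultimately show False by simp
    qed
    hence xy': "x - y \<noteq> 0" by auto
    have "((\<lambda>N. (th (- l) * x * th (N - k) - th (- k) * y * th (N - l)) / (x - y)) has_sum
        (th (- l) * x * 0 - th (- k) * y * 0) / (x - y)) UNIV"
      unfolding diff_conv_add_uminus divide_inverse
      by (intro has_sum_cmult_left has_sum_add has_sum_uminusI has_sum_cmult_right) (simp_all add: has_sum_shift th_sum)
    also have "(\<lambda>N. (th (- l) * x * th (N - k) - th (- k) * y * th (N - l)) / (x - y)) =
        (\<lambda>N. th (- k) * th (- l) * th N * g N)"
    proof
      fix N
      have "(x - y) * (th (- k) * th (- l) * th N * g N) =
          th (- k) * th (- l) * th N * (x powi N * x - y powi N * y)"
        using g(2)[of N] powi_add[OF xy(1), of N 1] powi_add[OF xy(2), of N 1] by (simp add: mult_ac)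
      also have "\<dots> = th (- l) * x * (th (- k) * th N * x powi N) - th (- k) * y * (th (- l) * th N * y powi N)"
        by (simp add: algebra_simps)
      also have "\<dots> = th (- l) * x * th (N - k) - th (- k) * y * th (N - l)"
        unfolding x_def y_def th_shift ..
      finally show "(th (- l) * x * th (N - k) - th (- k) * y * th (N - l)) / (x - y) =
          th (- k) * th (- l) * th N * g N"
        using xy' by (metis nonzero_mult_div_cancel_left)
    qed
    finally show ?thesis using False by simp
  qed
  ultimately have "S = ?V" by (rule has_sum_unique)
  thus ?thesis using S by simp
qed

text \<open>The exponent equals (3k - n - 1)^2 + 2n^2 + n - 1. For n = 2 mod 3 the square runs
  through the (3m)^2, which gives \<open>\<phi>\<close>, and otherwise through the (3m+1)^2, which
  gives \<open>B\<close>. The three substitutions for \<open>k\<close> make 3k - n - 1 equal to 3m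
  or 3m + 1 up to sign.\<close>

lemma theta_convolution:
  assumes \<phi>: "((\<lambda>m. (-1) powi m * q powi (9 * m ^ 2)) has_sum \<phi>) UNIV"
    and B: "((\<lambda>m. (-1) powi m * q powi ((3 * m + 1) ^ 2)) has_sum B) UNIV"
  shows "((\<lambda>k. q powi (6 * k ^ 2 - 3 * k) * th (n + 1 - k)) has_sum
    q powi (2 * n ^ 2 + n - 1) * (if n mod 3 = 2 then \<phi> else - B)) UNIV"
proof -
  define t where "t = n div 3"
  define K where "K = q powi (2 * n ^ 2 + n - 1)"
  have n: "n = 3 * t + n mod 3" by (simp add: t_def)
  have "n mod 3 \<in> {0, 1, 2}" by auto
  then consider "n mod 3 = 0" | "n mod 3 = 1" | "n mod 3 = 2" by auto
  thus ?thesis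
  proof cases
    case 1
    hence n: "n = 3 * t" using n by simp
    have t: "K * - ((-1) powi m * q powi ((3 * m + 1) ^ 2)) = q powi (6 * (t - m) ^ 2 - 3 * (t - m)) * th (n + 1 - (t - m))" for m
    proof -
      have s: "(-1 :: complex) powi (n + 1 - (t - m)) = - ((-1) powi m)"
        by (simp add: n power_int_add power_int_diff flip: power_int_mult)
      have e: "6 * (t - m) ^ 2 - 3 * (t - m) + 3 * ((n + 1 - (t - m)) ^ 2 - (n + 1 - (t - m))) =
          (2 * n ^ 2 + n - 1) + (3 * m + 1) ^ 2"
        by (simp add: n power2_eq_square algebra_simps)
      show ?thesis
        unfolding th_eq s K_def mult.left_commute[of "q powi _"] powi_add[OF q(1), symmetric] e
          mult_minus_right mult_minus_left by (simp add: powi_add[OF q(1)])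
    qed
    have "((\<lambda>m. K * - ((-1) powi m * q powi ((3 * m + 1) ^ 2))) has_sum K * - B) UNIV"
      by (intro has_sum_cmult_right has_sum_uminusI B)
    also have "?this \<longleftrightarrow> ((\<lambda>k. q powi (6 * k ^ 2 - 3 * k) * th (n + 1 - k)) has_sum K * - B) UNIV"
    proof (rule has_sum_reindex_bij_witness[of _ "\<lambda>k. t - k" "\<lambda>m. t - m"])
      show "q powi (6 * (t - m) ^ 2 - 3 * (t - m)) * th (n + 1 - (t - m)) = K * - ((-1) powi m * q powi ((3 * m + 1) ^ 2))" for m
        by (rule t[symmetric])
    qed auto
    finally show ?thesis using 1 by (simp add: K_def)
  next
    case 2
    hence n: "n = 3 * t + 1" using n by simp
    have t: "K * - ((-1) powi m * q powi ((3 * m + 1) ^ 2)) = q powi (6 * (t + 1 + m) ^ 2 - 3 * (t + 1 + m)) * th (n + 1 - (t + 1 + m))" for m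
    proof -
      have "n + 1 - (t + 1 + m) = 2 * t + 1 + (- m)" by (simp add: n)
      hence s: "(-1 :: complex) powi (n + 1 - (t + 1 + m)) = - ((-1) powi m)"
        by (simp only:) (simp add: power_int_add power_int_minus_one_minus del: add_uminus_conv_diff)
      have e: "6 * (t + 1 + m) ^ 2 - 3 * (t + 1 + m) + 3 * ((n + 1 - (t + 1 + m)) ^ 2 - (n + 1 - (t + 1 + m))) =
          (2 * n ^ 2 + n - 1) + (3 * m + 1) ^ 2"
        by (simp add: n power2_eq_square algebra_simps)
      show ?thesis
        unfolding th_eq s K_def mult.left_commute[of "q powi _"] powi_add[OF q(1), symmetric] e
          mult_minus_right mult_minus_left by (simp add: powi_add[OF q(1)])
    qed
    have "((\<lambda>m. K * - ((-1) powi m * q powi ((3 * m + 1) ^ 2))) has_sum K * - B) UNIV"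
      by (intro has_sum_cmult_right has_sum_uminusI B)
    also have "?this \<longleftrightarrow> ((\<lambda>k. q powi (6 * k ^ 2 - 3 * k) * th (n + 1 - k)) has_sum K * - B) UNIV"
    proof (rule has_sum_reindex_bij_witness[of _ "\<lambda>k. k - t - 1" "\<lambda>m. t + 1 + m"])
      show "q powi (6 * (t + 1 + m) ^ 2 - 3 * (t + 1 + m)) * th (n + 1 - (t + 1 + m)) = K * - ((-1) powi m * q powi ((3 * m + 1) ^ 2))" for m
        by (rule t[symmetric])
    qed auto
    finally show ?thesis using 2 by (simp add: K_def)
  next
    case 3
    hence n: "n = 3 * t + 2" using n by simp
    have t: "K * ((-1) powi m * q powi (9 * m ^ 2)) = q powi (6 * (t + 1 - m) ^ 2 - 3 * (t + 1 - m)) * th (n + 1 - (t + 1 - m))" for m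
    proof -
      have s: "(-1 :: complex) powi (n + 1 - (t + 1 - m)) = ((-1) powi m)"
        by (simp add: n power_int_add power_int_diff flip: power_int_mult)
      have e: "6 * (t + 1 - m) ^ 2 - 3 * (t + 1 - m) + 3 * ((n + 1 - (t + 1 - m)) ^ 2 - (n + 1 - (t + 1 - m))) =
          (2 * n ^ 2 + n - 1) + 9 * m ^ 2"
        by (simp add: n power2_eq_square algebra_simps)
      show ?thesis
        unfolding th_eq s K_def mult.left_commute[of "q powi _"] powi_add[OF q(1), symmetric] e
          mult_minus_right mult_minus_left by (simp add: powi_add[OF q(1)])
    qed
    have "((\<lambda>m. K * ((-1) powi m * q powi (9 * m ^ 2))) has_sum K * \<phi>) UNIV"
      by (intro has_sum_cmult_right \<phi>)
    also have "?this \<longleftrightarrow> ((\<lambda>k. q powi (6 * k ^ 2 - 3 * k) * th (n + 1 - k)) has_sum K * \<phi>) UNIV"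
    proof (rule has_sum_reindex_bij_witness[of _ "\<lambda>k. t + 1 - k" "\<lambda>m. t + 1 - m"])
      show "q powi (6 * (t + 1 - m) ^ 2 - 3 * (t + 1 - m)) * th (n + 1 - (t + 1 - m)) = K * ((-1) powi m * q powi (9 * m ^ 2))" for m
        by (rule t[symmetric])
    qed auto
    finally show ?thesis using 3 by (simp add: K_def)
  qed
qed

text \<open>A lower bound with \<open>k\<close> and \<open>r\<close> separated, for the absolute
  convergence of the fourfold sum. With a = r + 1, one k^2 and one a^2 are split off and the
  nonnegative form \<open>X\<close> remains.\<close>

private lemma pairing_exponent:
  "(k ^ 2 - \<bar>k\<bar>) + (r ^ 2 - \<bar>r\<bar>) - 2 \<le> (6 * k ^ 2 - 3 * k) + 3 * ((r - (k - 1)) ^ 2 - (r - (k - 1)))" for k r :: int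
proof -
  define a where "a = r + 1"
  define X where "X = 8 * k ^ 2 - 6 * (a * k) + 2 * a ^ 2"
  have "2 * X = (2 * a - 3 * k) ^ 2 + 7 * k ^ 2"
    by (simp add: X_def power2_eq_square algebra_simps)
  also have "\<dots> \<ge> 0" by (intro add_nonneg_nonneg) simp_all
  finally have "X \<ge> 0" by simp
  moreover have "a ^ 2 - 3 * a = r ^ 2 - r - 2" by (simp add: a_def power2_eq_square algebra_simps)
  moreover have "(6 * k ^ 2 - 3 * k) + 3 * ((r - (k - 1)) ^ 2 - (r - (k - 1))) =
      X + k ^ 2 + (a ^ 2 - 3 * a)"
    by (simp add: X_def a_def power2_eq_square algebra_simps)
  ultimately show ?thesis by simp
qed

text \<open>Both factors \<open>w\<close> are expanded and the sums exchanged;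
  \<open>theta_kernel\<close> keeps only k = l. On the diagonal 2(6k^2 - 3k) + 3(k^2 - k) = 15(k^2 -
  k) + 6k, which is the origin of the nome q^30 and the argument q^6.\<close>

lemma theta_pairing:
  assumes w: "\<And>n. ((\<lambda>k. q powi (6 * k ^ 2 - 3 * k) * th (n + 1 - k)) has_sum w n) UNIV"
  shows "((\<lambda>(r, s). hsgn r s * (q powi (6 * (r * s)) * (w r * w s))) has_sum E ^ 3 * theta_j (q ^ 6) (q ^ 30)) (UNIV \<times> UNIV)"
proof -
  define v where "v = (\<lambda>k. q powi (6 * k ^ 2 - 3 * k))"
  define F where "F = (\<lambda>((k, l), (r, s)). v k * v l * (hsgn r s * (th (r - (k - 1)) * th (s - (l - 1)) * q powi (6 * (r * s)))))"
  have "F summable_on (UNIV \<times> UNIV) \<times> (UNIV \<times> UNIV)"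
  proof (rule summable_on_complex_bound)
    define G where "G = (\<lambda>n. norm q powi (n ^ 2 - \<bar>n\<bar>))"
    have "(\<lambda>n. norm q powi (n ^ 2 - \<bar>n\<bar>) * 1) summable_on UNIV"
      by (rule summable_on_quadratic_powi[where r = 1 and k = 1]) (use q in auto)
    hence G: "G summable_on UNIV" by (simp add: G_def)
    have G0: "G r \<ge> 0" for r by (simp add: G_def)
    have GG: "(\<lambda>(r, s). G r * G s) summable_on UNIV \<times> UNIV"
      by (rule summable_on_product[OF G G]) (use G0 in auto)
    have "(\<lambda>(x, y). (norm q powi (-4) * (case x of (k, l) \<Rightarrow> G k * G l)) * (case y of (r, s) \<Rightarrow> G r * G s)) summable_on (UNIV \<times> UNIV) \<times> (UNIV \<times> UNIV)"
      by (rule summable_on_product[OF summable_on_cmult_right[OF GG] GG]) (use G0 in auto)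
    thus "(\<lambda>((k, l), (r, s)). norm q powi (-4) * (G k * G l) * (G r * G s)) summable_on (UNIV \<times> UNIV) \<times> (UNIV \<times> UNIV)"
      (is "?M summable_on _") by (simp add: case_prod_unfold)
    fix x :: "(int \<times> int) \<times> int \<times> int"
    obtain k l r s where x: "x = ((k, l), (r, s))" by (metis surj_pair)
    show "norm (F x) \<le> ?M x"
    proof (cases "hsgn r s = 0")
      case True
      thus ?thesis using G0 by (simp add: x F_def)
    next
      case False
      hence rs: "r * s \<ge> 0" by (rule hsgn_mult_nonneg)
      have nq: "norm q \<noteq> 0" using q by simp
      have pa: "norm q powi (m + n) = norm q powi m * norm q powi n" for m n
        using nq by (simp add: power_int_add)
      have "norm (F x) = norm (hsgn r s) * norm q powi ((6 * k ^ 2 - 3 * k) + 3 * ((r - (k - 1)) ^ 2 - (r - (k - 1))) +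
          ((6 * l ^ 2 - 3 * l) + 3 * ((s - (l - 1)) ^ 2 - (s - (l - 1)))) + 6 * (r * s))"
        unfolding pa by (simp add: x F_def v_def th_eq norm_mult)
      also have "\<dots> \<le> 1 * norm q powi (-4 + ((k ^ 2 - \<bar>k\<bar>) + (l ^ 2 - \<bar>l\<bar>)) + ((r ^ 2 - \<bar>r\<bar>) + (s ^ 2 - \<bar>s\<bar>)))"
      proof (intro mult_mono norm_hsgn_le power_int_decreasing)
        show "- 4 + (k\<^sup>2 - \<bar>k\<bar> + (l\<^sup>2 - \<bar>l\<bar>)) + (r\<^sup>2 - \<bar>r\<bar> + (s\<^sup>2 - \<bar>s\<bar>))
          \<le> (6 * k ^ 2 - 3 * k) + 3 * ((r - (k - 1)) ^ 2 - (r - (k - 1))) +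
          ((6 * l ^ 2 - 3 * l) + 3 * ((s - (l - 1)) ^ 2 - (s - (l - 1)))) + 6 * (r * s)"
          using pairing_exponent[of k r] pairing_exponent[of l s] rs by linarith
      qed (use q in auto)
      also have "\<dots> = norm q powi (-4) * (G k * G l) * (G r * G s)"
        unfolding pa G_def by simp
      finally show ?thesis by (simp add: x)
    qed
  qed
  then obtain T where T: "(F has_sum T) ((UNIV \<times> UNIV) \<times> (UNIV \<times> UNIV))"
    using summable_on_def by blast
  have "((\<lambda>(k, l). v k * v l * (if k - 1 = l - 1 then - (th (- (k - 1)) * E ^ 3) else 0)) has_sum T) (UNIV \<times> UNIV)"
  proof (rule has_sum_SigmaD[OF T])
    fix x :: "int \<times> int"
    obtain k l where x: "x = (k, l)" by (metis surj_pair)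
    have "((\<lambda>y. v k * v l * (case y of (r, s) \<Rightarrow> hsgn r s * (th (r - (k - 1)) * th (s - (l - 1)) * q powi (6 * (r * s)))))
        has_sum v k * v l * (if k - 1 = l - 1 then - (th (- (k - 1)) * E ^ 3) else 0)) (UNIV \<times> UNIV)"
      by (intro has_sum_cmult_right theta_kernel q)
    thus "((\<lambda>y. F (x, y)) has_sum (case x of (k, l) \<Rightarrow> v k * v l * (if k - 1 = l - 1 then - (th (- (k - 1)) * E ^ 3) else 0))) (UNIV \<times> UNIV)"
      by (simp only: x F_def case_prod_unfold fst_conv snd_conv)
  qed
  hence "((\<lambda>k. v k * v k * - (th (- (k - 1)) * E ^ 3)) has_sum T) UNIV"
  proof (rule has_sum_SigmaD)
    fix k
    show "((\<lambda>l. case (k, l) of (k, l) \<Rightarrow> v k * v l * (if k - 1 = l - 1 then - (th (- (k - 1)) * E ^ 3) else 0)) has_sum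
        v k * v k * - (th (- (k - 1)) * E ^ 3)) UNIV"
      by (rule has_sum_finite_neutralI[of "{k}"]) auto
  qed
  moreover have "((\<lambda>k. v k * v k * - (th (- (k - 1)) * E ^ 3)) has_sum E ^ 3 * theta_j (q ^ 6) (q ^ 30)) UNIV"
  proof -
    have "((\<lambda>k. E ^ 3 * (theta_coeff (q ^ 15) k * (q ^ 6) powi k)) has_sum E ^ 3 * theta_j (q ^ 6) ((q ^ 15) ^ 2)) UNIV"
      by (intro has_sum_cmult_right jacobi_triple_product) (use q in \<open>auto simp: norm_power_less_1\<close>)
    also have "(\<lambda>k. E ^ 3 * (theta_coeff (q ^ 15) k * (q ^ 6) powi k)) = (\<lambda>k. v k * v k * - (th (- (k - 1)) * E ^ 3))"
    proof
      fix k :: int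
      have "- (k - 1) = 1 + (- k)" by simp
      hence s: "(-1 :: complex) powi (- (k - 1)) = - ((-1) powi k)"
        by (simp only:) (simp add: power_int_add power_int_minus_one_minus del: add_uminus_conv_diff)
      have e: "(6 * k ^ 2 - 3 * k) + (6 * k ^ 2 - 3 * k) + 3 * ((- (k - 1)) ^ 2 - (- (k - 1))) = 15 * (k ^ 2 - k) + 6 * k"
        by (simp add: power2_eq_square algebra_simps)
      have "v k * v k * q powi (3 * ((- (k - 1)) ^ 2 - (- (k - 1)))) = (q ^ 15) powi (k ^ 2 - k) * (q ^ 6) powi k"
        unfolding v_def powi_add[OF q(1), symmetric] e by (simp only: powi_add[OF q(1)] power_int_power of_nat_numeral)
      hence "E ^ 3 * (theta_coeff (q ^ 15) k * (q ^ 6) powi k) = E ^ 3 * ((-1) powi k *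
          (v k * v k * q powi (3 * ((- (k - 1)) ^ 2 - (- (k - 1))))))"
        by (simp only: theta_coeff_def[of "q ^ 15"] mult.assoc)
      thus "E ^ 3 * (theta_coeff (q ^ 15) k * (q ^ 6) powi k) = v k * v k * - (th (- (k - 1)) * E ^ 3)"
        unfolding th_eq s by (simp only: mult_minus_left mult_minus_right minus_minus mult_ac)
    qed
    also have "(q ^ 15) ^ 2 = q ^ 30" by (simp flip: power_mult)
    finally show ?thesis .
  qed
  ultimately have T_eq: "T = E ^ 3 * theta_j (q ^ 6) (q ^ 30)" by (rule has_sum_unique)
  have "((\<lambda>(y, x). F (x, y)) has_sum T) ((UNIV \<times> UNIV) \<times> (UNIV \<times> UNIV))"
    using T by (subst (asm) has_sum_swap)
  hence "((\<lambda>(r, s). hsgn r s * (q powi (6 * (r * s)) * (w r * w s))) has_sum T) (UNIV \<times> UNIV)"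
  proof (rule has_sum_SigmaD)
    fix y :: "int \<times> int"
    obtain r s where y: "y = (r, s)" by (metis surj_pair)
    have "((\<lambda>x. hsgn r s * (q powi (6 * (r * s)) * (case x of (k, l) \<Rightarrow> (v k * th (r + 1 - k)) * (v l * th (s + 1 - l))))) has_sum
        hsgn r s * (q powi (6 * (r * s)) * (w r * w s))) (UNIV \<times> UNIV)"
      unfolding v_def by (intro has_sum_cmult_right has_sum_product w)
    moreover have "F (x, y) = hsgn r s * (q powi (6 * (r * s)) * (case x of (k, l) \<Rightarrow> (v k * th (r + 1 - k)) * (v l * th (s + 1 - l))))" for x
      by (cases x) (simp add: F_def y algebra_simps)
    ultimately show "((\<lambda>x. case (y, x) of (y, x) \<Rightarrow> F (x, y)) has_sum
        (case y of (r, s) \<Rightarrow> hsgn r s * (q powi (6 * (r * s)) * (w r * w s)))) (UNIV \<times> UNIV)"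
      by (simp only: y prod.case)
  qed
  thus ?thesis unfolding T_eq .
qed

text \<open>Every shifted copy of \<open>th\<close> has sum zero, hence so has the convolution. This
  relation later determines the unknown part \<open>a0\<close> of psi.\<close>

lemma theta_convolution_total:
  assumes w: "\<And>n. ((\<lambda>k. q powi (6 * k ^ 2 - 3 * k) * th (n + 1 - k)) has_sum w n) UNIV"
  shows "(w has_sum 0) UNIV"
proof -
  define v where "v = (\<lambda>k. q powi (6 * k ^ 2 - 3 * k))"
  define F where "F = (\<lambda>(k, n). v k * th (n - (k - 1)))"
  have "F summable_on UNIV \<times> UNIV"
  proof (rule summable_on_complex_bound)
    define G where "G = (\<lambda>n. norm q powi (n ^ 2 - \<bar>n\<bar>))"
    have "(\<lambda>n. norm q powi (n ^ 2 - \<bar>n\<bar>) * 1) summable_on UNIV"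
      by (rule summable_on_quadratic_powi[where r = 1 and k = 1]) (use q in auto)
    hence G: "G summable_on UNIV" by (simp add: G_def)
    show "(\<lambda>(k, n). (norm q powi (-2) * G k) * G n) summable_on UNIV \<times> UNIV"
      by (rule summable_on_product[OF summable_on_cmult_right[OF G] G]) (auto simp: G_def)
    fix x :: "int \<times> int"
    obtain k n where x: "x = (k, n)" by (metis surj_pair)
    have pa: "norm q powi (m + n) = norm q powi m * norm q powi n" for m n
      using q by (simp add: power_int_add)
    have "norm (F x) = norm q powi ((6 * k ^ 2 - 3 * k) + 3 * ((n - (k - 1)) ^ 2 - (n - (k - 1))))"
      unfolding pa by (simp add: x F_def v_def th_eq norm_mult)
    also have "\<dots> \<le> norm q powi (-2 + (k ^ 2 - \<bar>k\<bar>) + (n ^ 2 - \<bar>n\<bar>))"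
    proof (rule power_int_decreasing)
      show "- 2 + (k\<^sup>2 - \<bar>k\<bar>) + (n\<^sup>2 - \<bar>n\<bar>) \<le> (6 * k ^ 2 - 3 * k) + 3 * ((n - (k - 1)) ^ 2 - (n - (k - 1)))"
        using pairing_exponent[of k n] by linarith
    qed (use q in auto)
    also have "\<dots> = norm q powi (-2) * G k * G n"
      unfolding pa G_def ..
    finally show "norm (F x) \<le> (case x of (k, n) \<Rightarrow> (norm q powi (-2) * G k) * G n)" by (simp add: x)
  qed
  then obtain T where T: "(F has_sum T) (UNIV \<times> UNIV)"
    using summable_on_def by blast
  have "((\<lambda>k::int. 0) has_sum T) UNIV"
  proof (rule has_sum_SigmaD[OF T])
    fix k
    have "((\<lambda>n. v k * th (n - (k - 1))) has_sum v k * 0) UNIV"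
      by (intro has_sum_cmult_right) (simp only: has_sum_shift th_sum)
    thus "((\<lambda>n. F (k, n)) has_sum 0) UNIV" by (simp add: F_def)
  qed
  hence T0: "T = 0" using has_sum_unique[OF has_sum_0_simp] by blast
  have "((\<lambda>(n, k). F (k, n)) has_sum T) (UNIV \<times> UNIV)"
    using T by (subst (asm) has_sum_swap)
  hence "(w has_sum T) UNIV"
  proof (rule has_sum_SigmaD)
    fix n :: int
    have "n - (k - 1) = n + 1 - k" for k by simp
    hence "(\<lambda>k. case (n, k) of (n, k) \<Rightarrow> F (k, n)) = (\<lambda>k. q powi (6 * k ^ 2 - 3 * k) * th (n + 1 - k))"
      by (simp only: F_def v_def prod.case)
    thus "((\<lambda>k. case (n, k) of (n, k) \<Rightarrow> F (k, n)) has_sum w n) UNIV"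
      using w[of n] by (simp only:)
  qed
  thus ?thesis unfolding T0 .
qed

end

section \<open>Euler products\<close>

abbreviation euler :: "complex \<Rightarrow> complex" where
  "euler x \<equiv> qpoch_inf x x"

lemma euler_nz: "norm x < 1 \<Longrightarrow> euler x \<noteq> 0"
  by (rule qpoch_inf_nz)

lemma prod_lessThan_3: "(\<Prod>j<(3::nat). f j) = f 0 * f 1 * (f 2 :: 'a :: comm_monoid_mult)"
  by (simp add: eval_nat_numeral)

lemma prod_lessThan_2: "(\<Prod>j<(2::nat). f j) = f 0 * (f 1 :: 'a :: comm_monoid_mult)"
  by (simp add: eval_nat_numeral)

lemma euler_split2:
  assumes "norm x < 1"
  shows "euler x = qpoch_inf x (x ^ 2) * euler (x ^ 2)"
  using qpoch_inf_split[OF assms, of 2 x] by (simp add: prod_lessThan_2 power2_eq_square)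

lemma euler_split3:
  assumes "norm x < 1"
  shows "euler x = qpoch_inf x (x ^ 3) * qpoch_inf (x ^ 2) (x ^ 3) * euler (x ^ 3)"
  using qpoch_inf_split[OF assms, of 3 x] by (simp add: prod_lessThan_3 power2_eq_square power3_eq_cube mult_ac)

text \<open>Here (-x;x^4)(-x^3;x^4) = (-x;x^2), and multiplying by (x;x^2) gives (x^2;x^4), which
  the other products complete to Euler products.\<close>

lemma theta_psi:
  assumes "x \<noteq> 0" "norm x < 1"
  shows "theta_j (- x) (x ^ 4) = euler (x ^ 2) ^ 2 / euler x"
proof -
  have x2: "norm (x ^ 2) < 1" using assms by (simp add: norm_power_less_1)
  have "x ^ 4 / - x = x ^ 2 * - x" using assms by (simp add: field_simps eval_nat_numeral)
  moreover have "(x ^ 2) ^ 2 = x ^ 4" by (simp flip: power_mult)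
  ultimately have "theta_j (- x) (x ^ 4) = qpoch_inf (- x) (x ^ 2) * euler (x ^ 4)"
    using qpoch_inf_split[OF x2, of 2 "- x"] by (simp add: theta_j_def prod_lessThan_2)
  hence "theta_j (- x) (x ^ 4) * euler x =
      qpoch_inf x (x ^ 2) * qpoch_inf (- x) (x ^ 2) * euler (x ^ 4) * euler (x ^ 2)"
    unfolding euler_split2[OF assms(2)] by (simp add: mult_ac)
  also have "\<dots> = euler (x ^ 2) ^ 2"
    unfolding qpoch_inf_minus[OF x2] using euler_split2[OF x2] \<open>(x ^ 2) ^ 2 = x ^ 4\<close>
    by (simp add: power2_eq_square)
  finally show ?thesis using euler_nz[OF assms(2)] by (simp add: field_simps)
qed

lemma theta_J1_eq:
  assumes "q \<noteq> 0" "norm q < 1" "m > 0"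
  shows "theta_J1 q m = euler (q ^ m)"
proof -
  define x where "x = q ^ m"
  have x: "x \<noteq> 0" "norm x < 1" using assms by (auto simp: x_def norm_power_less_1)
  have "x ^ 3 / x = x ^ 2" using x by (simp add: power2_eq_square power3_eq_cube)
  moreover have "q ^ (3 * m) = x ^ 3" unfolding x_def by (simp add: mult.commute flip: power_mult)
  ultimately show ?thesis
    unfolding theta_J1_def theta_J_def power_int_of_nat x_def[symmetric] theta_j_def euler_split3[OF x(2)]
    by simp
qed

text \<open>The factors of (x;x^2) fall into the classes 1, 3 and 5 modulo 6: the classes 1 and 5
  belong to the theta function, and class 3 is the odd part of \<open>euler (x ^ 3)\<close>.\<close>

lemma theta_one_sixth:
  assumes "x \<noteq> 0" "norm x < 1"
  shows "theta_j x (x ^ 6) * euler (x ^ 2) * euler (x ^ 3) = euler x * euler (x ^ 6) ^ 2"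
proof -
  have x2: "norm (x ^ 2) < 1" and x3: "norm (x ^ 3) < 1" using assms by (simp_all add: norm_power_less_1)
  have e: "x ^ 6 / x = x ^ 5" "(x ^ 2) ^ 3 = x ^ 6" "(x ^ 3) ^ 2 = x ^ 6" "x ^ 2 * x = x ^ 3" "(x ^ 2) ^ 2 * x = x ^ 5"
    using assms by (simp_all add: eval_nat_numeral)
  have 1: "qpoch_inf x (x ^ 2) = qpoch_inf x (x ^ 6) * qpoch_inf (x ^ 3) (x ^ 6) * qpoch_inf (x ^ 5) (x ^ 6)"
    using qpoch_inf_split[OF x2, of 3 x] e by (simp add: prod_lessThan_3)
  have 2: "euler (x ^ 3) = qpoch_inf (x ^ 3) (x ^ 6) * euler (x ^ 6)"
    using euler_split2[OF x3] e by simp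
  show ?thesis
    unfolding theta_j_def e(1) 2 euler_split2[OF assms(2)] 1 by (simp add: power2_eq_square mult_ac)
qed

lemma qpoch_inf_cube:
  assumes "norm p < 1" "1 + \<omega> + \<omega> ^ 2 = 0"
  shows "qpoch_inf x p * qpoch_inf (\<omega> * x) p * qpoch_inf (\<omega> ^ 2 * x) p = qpoch_inf (x ^ 3) (p ^ 3)"
proof -
  have c: "(1 - y) * (1 - \<omega> * y) * (1 - \<omega> ^ 2 * y) = 1 - y ^ 3" for y
    using assms(2) by algebra
  have "qpoch x p n * qpoch (\<omega> * x) p n * qpoch (\<omega> ^ 2 * x) p n = qpoch (x ^ 3) (p ^ 3) n" for n
    unfolding qpoch_def prod.distrib[symmetric]
  proof (rule prod.cong)
    fix i
    show "(1 - p ^ i * x) * (1 - p ^ i * (\<omega> * x)) * (1 - p ^ i * (\<omega>\<^sup>2 * x)) = 1 - (p ^ 3) ^ i * x ^ 3"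
      using c[of "p ^ i * x"] by (simp add: power_mult_distrib mult_ac flip: power_mult)
  qed auto
  hence "qpoch (x ^ 3) (p ^ 3) \<longlonglongrightarrow> qpoch_inf x p * qpoch_inf (\<omega> * x) p * qpoch_inf (\<omega> ^ 2 * x) p"
    using tendsto_mult[OF tendsto_mult[OF qpoch_tendsto[OF assms(1), of x] qpoch_tendsto[OF assms(1), of "\<omega> * x"]]
        qpoch_tendsto[OF assms(1), of "\<omega> ^ 2 * x"]] by simp
  moreover have "qpoch (x ^ 3) (p ^ 3) \<longlonglongrightarrow> qpoch_inf (x ^ 3) (p ^ 3)"
    by (intro qpoch_tendsto norm_power_less_1 assms) auto
  ultimately show ?thesis using LIMSEQ_unique by blast
qed

text \<open>Factors with exponent divisible by 3 appear three times unchanged. Those in the classes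
  1 and 2 modulo 3 are multiplied over all cube roots of unity by
  \<open>qpoch_inf_cube\<close>.\<close>

lemma euler_cube:
  assumes "norm x < 1" "1 + \<omega> + \<omega> ^ 2 = 0"
  shows "euler x * euler (\<omega> * x) * euler (\<omega> ^ 2 * x) * euler (x ^ 9) = euler (x ^ 3) ^ 4"
proof -
  have w3: "\<omega> ^ 3 = 1" using assms(2) by algebra
  have w4: "\<omega> ^ 4 = \<omega>" using assms(2) by algebra
  have w6: "\<omega> ^ 6 = 1" using assms(2) by algebra
  have w: "norm \<omega> = 1" by (metis norm_power norm_one w3 norm_ge_zero power_eq_1_iff zero_neq_numeral)
  have x3: "norm (x ^ 3) < 1" using assms by (simp add: norm_power_less_1)
  have e: "(\<omega> * x) ^ 3 = x ^ 3" "(\<omega> ^ 2 * x) ^ 3 = x ^ 3" "(\<omega> * x) ^ 2 = \<omega> ^ 2 * x ^ 2" "(\<omega> ^ 2 * x) ^ 2 = \<omega> * x ^ 2"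
    "(x ^ 3) ^ 3 = x ^ 9" "(x ^ 2) ^ 3 = (x ^ 3) ^ 2"
    using w3 w4 w6 by (simp_all add: power_mult_distrib flip: power_mult)
  have "euler x = qpoch_inf x (x ^ 3) * qpoch_inf (x ^ 2) (x ^ 3) * euler (x ^ 3)"
    "euler (\<omega> * x) = qpoch_inf (\<omega> * x) (x ^ 3) * qpoch_inf (\<omega> ^ 2 * x ^ 2) (x ^ 3) * euler (x ^ 3)"
    "euler (\<omega> ^ 2 * x) = qpoch_inf (\<omega> ^ 2 * x) (x ^ 3) * qpoch_inf (\<omega> * x ^ 2) (x ^ 3) * euler (x ^ 3)"
    using euler_split3[of x] euler_split3[of "\<omega> * x"] euler_split3[of "\<omega> ^ 2 * x"] assms(1) w
    unfolding e by (simp_all add: norm_mult norm_power)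
  hence "euler x * euler (\<omega> * x) * euler (\<omega> ^ 2 * x) =
      (qpoch_inf x (x ^ 3) * qpoch_inf (\<omega> * x) (x ^ 3) * qpoch_inf (\<omega> ^ 2 * x) (x ^ 3)) *
      (qpoch_inf (x ^ 2) (x ^ 3) * qpoch_inf (\<omega> * x ^ 2) (x ^ 3) * qpoch_inf (\<omega> ^ 2 * x ^ 2) (x ^ 3)) * euler (x ^ 3) ^ 3"
    by (simp add: power3_eq_cube mult_ac)
  also have "\<dots> = qpoch_inf (x ^ 3) (x ^ 9) * qpoch_inf ((x ^ 3) ^ 2) (x ^ 9) * euler (x ^ 3) ^ 3"
    unfolding qpoch_inf_cube[OF x3 assms(2)] e ..
  finally have "euler x * euler (\<omega> * x) * euler (\<omega> ^ 2 * x) * euler (x ^ 9) =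
      (qpoch_inf (x ^ 3) (x ^ 9) * qpoch_inf ((x ^ 3) ^ 2) (x ^ 9) * euler (x ^ 9)) * euler (x ^ 3) ^ 3"
    by (simp only: mult_ac)
  also have "qpoch_inf (x ^ 3) (x ^ 9) * qpoch_inf ((x ^ 3) ^ 2) (x ^ 9) * euler (x ^ 9) = euler (x ^ 3)"
    using euler_split3[OF x3] unfolding e by simp
  finally show ?thesis by (simp add: power_numeral_reduce)
qed

lemma psi_sum:
  assumes "x \<noteq> 0" "norm x < 1"
  shows "((\<lambda>n. x powi (2 * n ^ 2 + n)) has_sum theta_j (- x) (x ^ 4)) UNIV"
proof -
  have "((\<lambda>n. theta_coeff (x ^ 2) n * (- x) powi n) has_sum theta_j (- x) ((x ^ 2) ^ 2)) UNIV"
    by (rule jacobi_triple_product) (use assms in \<open>auto simp: norm_power_less_1\<close>)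
  also have "(x ^ 2) ^ 2 = x ^ 4" by (simp flip: power_mult)
  also have "((\<lambda>n. theta_coeff (x ^ 2) n * (- x) powi n) has_sum theta_j (- x) (x ^ 4)) UNIV \<longleftrightarrow> ?thesis"
  proof (rule has_sum_reindex_bij_witness[of _ uminus uminus])
    fix n :: int
    have "(- x) powi n = (-1) powi n * x powi n"
      using power_int_mult_distrib[of "-1" x n] by simp
    moreover have e: "2 * (- n) ^ 2 + - n = 2 * (n ^ 2 - n) + n" by simp
    ultimately show "x powi (2 * (- n) ^ 2 + - n) = theta_coeff (x ^ 2) n * (- x) powi n"
      unfolding e powi_add[OF assms(1)] by (simp add: theta_coeff_def power_int_power)
  qed auto
  finally show ?thesis .
qed

section \<open>Trisection\<close>

definition hterm :: "complex \<Rightarrow> int \<Rightarrow> int \<Rightarrow> complex" where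
  "hterm q r s = hsgn r s * q powi (2 * r ^ 2 + 2 * s ^ 2 + 6 * r * s + r + s)"

context
  fixes q :: complex
  assumes q: "q \<noteq> 0" "norm q < 1"
begin

private definition d :: "int \<Rightarrow> complex" where "d n = (if n mod 3 = 2 then 1 else 0)"

private lemma hterm_summable:
  assumes "\<And>r s. norm (u r s) \<le> 1"
  shows "(\<lambda>(r, s). hterm q r s * u r s) summable_on UNIV \<times> UNIV"
proof -
  have "(\<lambda>(r, s). hsgn r s * (q powi (2 * r ^ 2 + 2 * s ^ 2 + 6 * r * s + r + s) * u r s)) summable_on UNIV \<times> UNIV"
  proof (rule hecke_double_summable[where k = 1 and C = 1, OF q])
    fix r s :: int assume "hsgn r s \<noteq> 0"
    hence "r * s \<ge> 0" by (rule hsgn_mult_nonneg)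
    moreover have "0 \<le> r ^ 2" "0 \<le> s ^ 2" "- \<bar>r\<bar> \<le> r" "- \<bar>s\<bar> \<le> s" by simp_all
    ultimately show "r ^ 2 - int 1 * \<bar>r\<bar> + (s ^ 2 - int 1 * \<bar>s\<bar>) \<le> 2 * r ^ 2 + 2 * s ^ 2 + 6 * r * s + r + s"
      unfolding mult.assoc[of 6 r s] by linarith
  qed (rule assms)
  thus ?thesis by (simp add: hterm_def mult_ac)
qed

text \<open>The weights \<alpha> and \<beta> stay free because the dissection is used twice: with 1
  and a cube root of unity for X, and with \<open>- B\<close> and \<open>\<phi>\<close> for the
  quadratic form. In the part \<open>H2\<close>, r = -1 - 3a and s = -1 - 3b lead to the double sum
  of chi at q^9.\<close>

lemma hecke_dissection:
  obtains H0 H1 H2 where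
    "\<And>\<alpha> \<beta>. ((\<lambda>(r, s). hterm q r s * ((if r mod 3 = 2 then \<beta> else \<alpha>) * (if s mod 3 = 2 then \<beta> else \<alpha>))) has_sum
        (\<alpha> ^ 2 * H0 + \<alpha> * \<beta> * H1 + \<beta> ^ 2 * H2)) (UNIV \<times> UNIV)"
    "mock_chi (q ^ 9) = - q * H2 / theta_j (- (q ^ 9)) ((q ^ 9) ^ 4)"
proof -
  have bound: "norm ((1 - d r) * (1 - d s)) \<le> 1" "norm (d r * (1 - d s) + (1 - d r) * d s) \<le> 1"
    "norm (d r * d s) \<le> 1" for r s
    by (auto simp: d_def)
  obtain H0 where H0: "((\<lambda>(r, s). hterm q r s * ((1 - d r) * (1 - d s))) has_sum H0) (UNIV \<times> UNIV)"
    using has_sum_infsum[OF hterm_summable[of "\<lambda>r s. (1 - d r) * (1 - d s)", OF bound(1)]] by blast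
  obtain H1 where H1: "((\<lambda>(r, s). hterm q r s * (d r * (1 - d s) + (1 - d r) * d s)) has_sum H1) (UNIV \<times> UNIV)"
    using has_sum_infsum[OF hterm_summable[of "\<lambda>r s. d r * (1 - d s) + (1 - d r) * d s", OF bound(2)]] by blast
  obtain H2 where H2: "((\<lambda>(r, s). hterm q r s * (d r * d s)) has_sum H2) (UNIV \<times> UNIV)"
    using has_sum_infsum[OF hterm_summable[of "\<lambda>r s. d r * d s", OF bound(3)]] by blast
  show ?thesis
  proof
    fix \<alpha> \<beta>
    have "((\<lambda>x. \<alpha> ^ 2 * (case x of (r, s) \<Rightarrow> hterm q r s * ((1 - d r) * (1 - d s)))
        + \<alpha> * \<beta> * (case x of (r, s) \<Rightarrow> hterm q r s * (d r * (1 - d s) + (1 - d r) * d s))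
        + \<beta> ^ 2 * (case x of (r, s) \<Rightarrow> hterm q r s * (d r * d s))) has_sum
        (\<alpha> ^ 2 * H0 + \<alpha> * \<beta> * H1 + \<beta> ^ 2 * H2)) (UNIV \<times> UNIV)"
      by (intro has_sum_add has_sum_cmult_right H0 H1 H2)
    also have "(\<lambda>x. \<alpha> ^ 2 * (case x of (r, s) \<Rightarrow> hterm q r s * ((1 - d r) * (1 - d s)))
        + \<alpha> * \<beta> * (case x of (r, s) \<Rightarrow> hterm q r s * (d r * (1 - d s) + (1 - d r) * d s))
        + \<beta> ^ 2 * (case x of (r, s) \<Rightarrow> hterm q r s * (d r * d s))) =
        (\<lambda>(r, s). hterm q r s * ((if r mod 3 = 2 then \<beta> else \<alpha>) * (if s mod 3 = 2 then \<beta> else \<alpha>)))"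
      by (auto simp: d_def power2_eq_square)
    finally show "((\<lambda>(r, s). hterm q r s * ((if r mod 3 = 2 then \<beta> else \<alpha>) * (if s mod 3 = 2 then \<beta> else \<alpha>))) has_sum
        (\<alpha> ^ 2 * H0 + \<alpha> * \<beta> * H1 + \<beta> ^ 2 * H2)) (UNIV \<times> UNIV)" .
  next
    let ?M = "{n :: int. n mod 3 = 2}"
    have q9: "q ^ 9 \<noteq> 0" "norm (q ^ 9) < 1" using q by (auto simp: norm_power_less_1)
    have "((\<lambda>(r, s). hterm q r s) has_sum H2) (?M \<times> ?M) \<longleftrightarrow> ((\<lambda>(r, s). hterm q r s * (d r * d s)) has_sum H2) (UNIV \<times> UNIV)"
      by (rule has_sum_cong_neutral) (auto simp: d_def split: if_splits)
    with H2 have "((\<lambda>(r, s). hterm q r s) has_sum H2) (?M \<times> ?M)" by simp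
    hence "((\<lambda>x. (- q) * (case x of (r, s) \<Rightarrow> hterm q r s)) has_sum (- q) * H2) (?M \<times> ?M)"
      by (rule has_sum_cmult_right)
    also have "?this \<longleftrightarrow> ((\<lambda>(a, b). hsgn a b * (q ^ 9) powi (2 * a ^ 2 + 2 * b ^ 2 + 6 * a * b + 3 * a + 3 * b + 1)) has_sum (- q) * H2) (UNIV \<times> UNIV)"
    proof (rule has_sum_reindex_bij_witness[of _ "\<lambda>(a, b). (- 1 - 3 * a, - 1 - 3 * b)" "\<lambda>(r, s). ((- 1 - r) div 3, (- 1 - s) div 3)"])
      have inv: "- 1 - 3 * ((- 1 - r) div 3) = r" if "r mod 3 = 2" for r :: int
        using that by presburger
      fix x assume "x \<in> ?M \<times> ?M"
      then obtain r s where x: "x = (r, s)" "r mod 3 = 2" "s mod 3 = 2" by auto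
      show "(case (case x of (r, s) \<Rightarrow> ((- 1 - r) div 3, (- 1 - s) div 3)) of (a, b) \<Rightarrow> (- 1 - 3 * a, - 1 - 3 * b)) = x"
        using inv x by simp
      define a b where "a = (- 1 - r) div 3" and "b = (- 1 - s) div 3"
      have rs: "r = - 1 - 3 * a" "s = - 1 - 3 * b" using inv x by (simp_all add: a_def b_def)
      \<comment> \<open>r is negative exactly if a is nonnegative; the minus sign in the factor
        \<open>- q\<close> compensates.\<close>
      have sg: "hsgn r s = - hsgn a b" unfolding rs by (auto simp: hsgn_def)
      have e: "1 + (2 * r ^ 2 + 2 * s ^ 2 + 6 * r * s + r + s) = 9 * (2 * a ^ 2 + 2 * b ^ 2 + 6 * a * b + 3 * a + 3 * b + 1)"
        unfolding rs by (simp add: power2_eq_square algebra_simps)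
      have "q * q powi (2 * r ^ 2 + 2 * s ^ 2 + 6 * r * s + r + s) = (q ^ 9) powi (2 * a ^ 2 + 2 * b ^ 2 + 6 * a * b + 3 * a + 3 * b + 1)"
        using powi_add[OF q(1), of 1 "2 * r ^ 2 + 2 * s ^ 2 + 6 * r * s + r + s"] unfolding e by (simp add: power_int_power)
      thus "(case (case x of (r, s) \<Rightarrow> ((- 1 - r) div 3, (- 1 - s) div 3)) of (a, b) \<Rightarrow>
          hsgn a b * (q ^ 9) powi (2 * a ^ 2 + 2 * b ^ 2 + 6 * a * b + 3 * a + 3 * b + 1)) = (- q) * (case x of (r, s) \<Rightarrow> hterm q r s)"
        unfolding x(1) prod.case a_def[symmetric] b_def[symmetric] hterm_def sg by simp
    next
      fix y :: "int \<times> int"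
      obtain a b where y: "y = (a, b)" by (metis surj_pair)
      show "(case y of (a, b) \<Rightarrow> (- 1 - 3 * a, - 1 - 3 * b)) \<in> ?M \<times> ?M"
        unfolding y by simp presburger
    qed auto
    finally have "mock_chi (q ^ 9) = qpoch_inf (q ^ 9) ((q ^ 9) ^ 2) / qpoch_inf ((q ^ 9) ^ 2) ((q ^ 9) ^ 2) * ((- q) * H2)"
      by (rule mock_chi_hecke[OF q9])
    also have "\<dots> = - q * H2 / theta_j (- (q ^ 9)) ((q ^ 9) ^ 4)"
    proof -
      have "norm ((q ^ 9) ^ 2) < 1" by (rule norm_power_less_1[OF q9(2)]) simp
      thus ?thesis
        unfolding theta_psi[OF q9] euler_split2[OF q9(2)]
        using euler_nz[of "(q ^ 9) ^ 2"] by (simp add: field_simps power2_eq_square)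
    qed
    finally show "mock_chi (q ^ 9) = - q * H2 / theta_j (- (q ^ 9)) ((q ^ 9) ^ 4)" .
  qed
qed

lemma powi_root_of_unity:
  fixes \<omega> :: complex
  assumes "\<omega> ^ 3 = 1"
  shows "(\<omega> * q) powi (2 * r ^ 2 + r) = q powi (2 * r ^ 2 + r) * (if r mod 3 = 2 then \<omega> else 1)"
proof -
  have w: "\<omega> powi (3 * m) = 1" for m using assms by (simp add: power_int_mult)
  have w0: "\<omega> \<noteq> 0" using assms by auto
  define t where "t = r div 3"
  have r: "r = 3 * t + r mod 3" by (simp add: t_def)
  have "r mod 3 \<in> {0, 1, 2}" by auto
  then consider "r mod 3 = 0" | "r mod 3 = 1" | "r mod 3 = 2" by auto
  hence "\<omega> powi (2 * r ^ 2 + r) = (if r mod 3 = 2 then \<omega> else 1)"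
  proof cases
    case 1
    hence "2 * r ^ 2 + r = 3 * (6 * t ^ 2 + t)" using r by (simp add: power2_eq_square algebra_simps)
    thus ?thesis using 1 by (simp only: w) simp
  next
    case 2
    hence "2 * r ^ 2 + r = 3 * (6 * t ^ 2 + 5 * t + 1)" using r by (simp add: power2_eq_square algebra_simps)
    thus ?thesis using 2 by (simp only: w) simp
  next
    case 3
    hence "2 * r ^ 2 + r = 3 * (6 * t ^ 2 + 9 * t + 3) + 1" using r by (simp add: power2_eq_square algebra_simps)
    thus ?thesis using 3 by (simp only: w powi_add[OF w0]) simp
  qed
  thus ?thesis by (simp add: power_int_mult_distrib)
qed

lemma hterm_root_of_unity:
  fixes \<omega> :: complex
  assumes "\<omega> ^ 3 = 1"
  shows "hsgn r s * (\<omega> * q) powi (2 * r ^ 2 + 2 * s ^ 2 + 6 * r * s + r + s) =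
     hterm q r s * ((if r mod 3 = 2 then \<omega> else 1) * (if s mod 3 = 2 then \<omega> else 1))"
proof -
  have wq: "\<omega> * q \<noteq> 0" using assms q by auto
  have e: "2 * r ^ 2 + 2 * s ^ 2 + 6 * r * s + r + s = (2 * r ^ 2 + r) + (2 * s ^ 2 + s) + 3 * (2 * r * s)"
    by simp
  have "\<omega> powi (3 * m) = 1" for m using assms by (simp add: power_int_mult)
  hence "(\<omega> * q) powi (3 * (2 * r * s)) = q powi (3 * (2 * r * s))"
    by (simp only: power_int_mult_distrib mult_1)
  thus ?thesis
    unfolding hterm_def e powi_add[OF wq, of "(2 * r ^ 2 + r) + (2 * s ^ 2 + s)"] powi_add[OF wq, of "2 * r ^ 2 + r"]
      powi_add[OF q(1), of "(2 * r ^ 2 + r) + (2 * s ^ 2 + s)"] powi_add[OF q(1), of "2 * r ^ 2 + r"]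
      powi_root_of_unity[OF assms] by (simp only: mult_ac)
qed

text \<open>The part \<open>a0\<close> over the residues 0 and 1 is left unidentified; the main
  proof finds it from the vanishing of a weighted sum.\<close>

lemma psi_dissection:
  obtains a0 where
    "\<And>\<alpha> \<beta>. ((\<lambda>n. q powi (2 * n ^ 2 + n) * (if n mod 3 = 2 then \<beta> else \<alpha>)) has_sum
        \<alpha> * a0 + \<beta> * (q * theta_j (- (q ^ 9)) ((q ^ 9) ^ 4))) UNIV"
proof -
  have s: "(\<lambda>n. q powi (2 * n ^ 2 + n) * (1 - d n)) summable_on UNIV"
  proof (rule summable_on_quadratic[where k = 1 and r = 1, OF q])
    fix n :: int
    have "0 \<le> n ^ 2" "- \<bar>n\<bar> \<le> n" by simp_all
    thus "n ^ 2 - int 1 * \<bar>n\<bar> \<le> 2 * n ^ 2 + n" by linarith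
  qed (auto simp: d_def)
  then obtain a0 where a0: "((\<lambda>n. q powi (2 * n ^ 2 + n) * (1 - d n)) has_sum a0) UNIV"
    by (auto simp: summable_on_def)
  have "((\<lambda>n. (q ^ 9) powi (2 * n ^ 2 + n)) has_sum theta_j (- (q ^ 9)) ((q ^ 9) ^ 4)) UNIV"
    by (rule psi_sum) (use q in \<open>auto simp: norm_power_less_1\<close>)
  hence "((\<lambda>n. q * (q ^ 9) powi (2 * n ^ 2 + n)) has_sum q * theta_j (- (q ^ 9)) ((q ^ 9) ^ 4)) UNIV"
    by (rule has_sum_cmult_right)
  also have "?this \<longleftrightarrow> ((\<lambda>n. q powi (2 * n ^ 2 + n)) has_sum q * theta_j (- (q ^ 9)) ((q ^ 9) ^ 4)) {n. n mod 3 = 2}"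
  proof (rule has_sum_reindex_bij_witness[of _ "\<lambda>r. (- 1 - r) div 3" "\<lambda>a. - 1 - 3 * a"])
    fix a :: int
    show "- 1 - 3 * a \<in> {n. n mod 3 = 2}" by simp presburger
    have "2 * (- 1 - 3 * a) ^ 2 + (- 1 - 3 * a) = 1 + 9 * (2 * a ^ 2 + a)"
      by (simp add: power2_eq_square algebra_simps)
    thus "q powi (2 * (- 1 - 3 * a) ^ 2 + (- 1 - 3 * a)) = q * (q ^ 9) powi (2 * a ^ 2 + a)"
      by (simp only: powi_add[OF q(1)]) (simp add: power_int_power powi_add[OF q(1)])
  next
    fix r :: int assume "r \<in> {n. n mod 3 = 2}"
    thus "- 1 - 3 * ((- 1 - r) div 3) = r" by simp presburger
  qed auto
  also have "\<dots> \<longleftrightarrow> ((\<lambda>n. q powi (2 * n ^ 2 + n) * d n) has_sum q * theta_j (- (q ^ 9)) ((q ^ 9) ^ 4)) UNIV"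
    by (rule has_sum_cong_neutral) (auto simp: d_def)
  finally have a2: "((\<lambda>n. q powi (2 * n ^ 2 + n) * d n) has_sum q * theta_j (- (q ^ 9)) ((q ^ 9) ^ 4)) UNIV" .
  show ?thesis
  proof
    fix \<alpha> \<beta>
    have "((\<lambda>n. \<alpha> * (q powi (2 * n ^ 2 + n) * (1 - d n)) + \<beta> * (q powi (2 * n ^ 2 + n) * d n)) has_sum
      \<alpha> * a0 + \<beta> * (q * theta_j (- (q ^ 9)) ((q ^ 9) ^ 4))) UNIV"
      by (intro has_sum_add has_sum_cmult_right a0 a2)
    also have "(\<lambda>n. \<alpha> * (q powi (2 * n ^ 2 + n) * (1 - d n)) + \<beta> * (q powi (2 * n ^ 2 + n) * d n)) =
        (\<lambda>n. q powi (2 * n ^ 2 + n) * (if n mod 3 = 2 then \<beta> else \<alpha>))"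
      by (auto simp: d_def)
    finally show "((\<lambda>n. q powi (2 * n ^ 2 + n) * (if n mod 3 = 2 then \<beta> else \<alpha>)) has_sum
        \<alpha> * a0 + \<beta> * (q * theta_j (- (q ^ 9)) ((q ^ 9) ^ 4))) UNIV" .
  qed
qed

end

section \<open>The identity\<close>

theorem mainTheorem4:
  fixes q \<omega> :: complex
  assumes "0 < norm q" and "norm q < 1"
    and "primitive_root_of_unity 3 \<omega>"
  shows "mock_chi (q ^ 9) + q ^ 2 * ((mock_X (\<omega> * q) - mock_X (\<omega> ^ 2 * q)) / (\<omega> - \<omega> ^ 2))
    = - (q ^ 3) * (theta_Jbar q 1 4 / theta_Jbar q 3 12)
        * (theta_J q 6 30 * theta_J1 q 3 / theta_J1 q 6)"
proof -
  have q: "q \<noteq> 0" "norm q < 1" using assms by auto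
  have qn: "q ^ n \<noteq> 0" "n > 0 \<Longrightarrow> norm (q ^ n) < 1" for n
    using q by (auto simp: norm_power_less_1)
  have w3: "\<omega> ^ 3 = 1" using assms(3) by (simp add: primitive_root_of_unity_def)
  have "\<forall>k\<in>{0<..<3}. \<omega> ^ k \<noteq> 1" using assms(3) unfolding primitive_root_of_unity_def by blast
  hence "\<omega> ^ 1 \<noteq> 1" by (rule bspec) simp
  hence w1: "\<omega> - 1 \<noteq> 0" by simp
  have "(\<omega> - 1) * (1 + \<omega> + \<omega> ^ 2) = 0" using w3 by algebra
  hence w: "1 + \<omega> + \<omega> ^ 2 = 0" using w1 by simp
  have w0: "\<omega> \<noteq> 0" using w3 by auto
  have w6: "(\<omega> ^ 2) ^ 3 = 1" using w by algebra
  have nw: "norm \<omega> = 1" by (metis norm_power norm_one w3 norm_ge_zero power_eq_1_iff zero_neq_numeral)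
  have ww: "\<omega> - \<omega> ^ 2 \<noteq> 0"
  proof -
    have "\<omega> - \<omega> ^ 2 = - (\<omega> * (\<omega> - 1))" by (simp add: power2_eq_square algebra_simps)
    thus ?thesis using w0 w1 by simp
  qed

  define E where "E = (\<lambda>n. euler (q ^ n))"
  have E: "E n \<noteq> 0" if "n > 0" for n
    unfolding E_def by (rule euler_nz) (use qn that in auto)
  define \<psi> where "\<psi> = (\<lambda>x. theta_j (- x) (x ^ 4))"
  define T where "T = theta_j (q ^ 6) (q ^ 30)"
  have psi: "\<psi> (q ^ n) = E (2 * n) ^ 2 / E n" if "n > 0" for n
    using theta_psi[OF qn(1) qn(2)[OF that]] by (simp add: \<psi>_def E_def mult.commute flip: power_mult)

  define \<phi> where "\<phi> = (\<Sum>\<^sub>\<infinity>m. (-1) powi m * q powi (9 * m ^ 2))"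
  have \<phi>: "((\<lambda>m. (-1) powi m * q powi (9 * m ^ 2)) has_sum \<phi>) UNIV"
  proof -
    have "(\<lambda>m. q powi (9 * m ^ 2) * (-1) powi m) summable_on UNIV"
      by (rule summable_on_quadratic[where k = 0 and r = 1, OF q]) auto
    thus ?thesis unfolding \<phi>_def by (intro has_sum_infsum) (simp add: mult.commute)
  qed
  define B where "B = q * theta_j (q ^ 3) (q ^ 18)"
  have B: "((\<lambda>m. (-1) powi m * q powi ((3 * m + 1) ^ 2)) has_sum B) UNIV"
  proof -
    have "((\<lambda>m. theta_coeff (q ^ 9) m * (q ^ 3) powi m) has_sum theta_j (q ^ 3) ((q ^ 9) ^ 2)) UNIV"
      by (rule jacobi_triple_product) (use qn in auto)
    hence "((\<lambda>m. q * (theta_coeff (q ^ 9) m * (q ^ 3) powi m)) has_sum B) UNIV"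
      unfolding B_def by (intro has_sum_cmult_right) (simp flip: power_mult)
    also have "?this \<longleftrightarrow> ?thesis"
    proof (rule has_sum_reindex_bij_witness[of _ uminus uminus])
      fix m :: int
      have e: "(3 * (- m) + 1) ^ 2 = 1 + (9 * (m ^ 2 - m) + 3 * m)"
        by (simp add: power2_eq_square algebra_simps)
      show "(-1) powi (- m) * q powi ((3 * (- m) + 1) ^ 2) = q * (theta_coeff (q ^ 9) m * (q ^ 3) powi m)"
        unfolding e powi_add[OF q(1)]
        by (simp add: theta_coeff_def power_int_power power_int_minus_one_minus)
    qed auto
    finally show ?thesis .
  qed

  \<comment> \<open>Chosen so that \<open>D * B\<close> is the part of psi(q) over the indices 2 mod
    3, namely q psi(q^9).\<close>
  define D where "D = E 6 / E 3"
  have D0: "D \<noteq> 0" using E by (simp add: D_def)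
  have DB: "D * B = q * \<psi> (q ^ 9)"
  proof -
    have "theta_j (q ^ 3) (q ^ 18) * E 6 * E 9 = E 3 * E 18 ^ 2"
      using theta_one_sixth[OF qn(1) qn(2), of 3] by (simp add: E_def flip: power_mult)
    hence j: "theta_j (q ^ 3) (q ^ 18) * E 6 = E 3 * E 18 ^ 2 / E 9"
      using E[of 9] by (metis nonzero_mult_div_cancel_right zero_less_numeral)
    have "D * B = q * (theta_j (q ^ 3) (q ^ 18) * E 6) / E 3"
      by (simp add: B_def D_def)
    thus ?thesis unfolding j using E[of 3] psi[of 9] by simp
  qed
  have psi9: "\<psi> (q ^ 9) \<noteq> 0" using psi[of 9] E[of 18] E[of 9] by simp
  have B0: "B \<noteq> 0" using DB psi9 q by auto

  define c where "c = (\<lambda>n :: int. if n mod 3 = 2 then \<phi> else - B)"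
  define W where "W = (\<lambda>n. q powi (2 * n ^ 2 + n - 1) * c n)"
  have W: "((\<lambda>k. q powi (6 * k ^ 2 - 3 * k) * theta_coeff (q ^ 3) (n + 1 - k)) has_sum W n) UNIV" for n
    unfolding W_def c_def by (rule theta_convolution[OF q \<phi> B])
  have qW: "q * W n = q powi (2 * n ^ 2 + n) * c n" for n
    using powi_add[OF q(1), of 1 "2 * n ^ 2 + n - 1"] by (simp add: W_def)

  have psi9_eq: "theta_j (- (q ^ 9)) ((q ^ 9) ^ 4) = \<psi> (q ^ 9)" by (simp add: \<psi>_def)
  have "\<exists>a0. \<forall>\<alpha> \<beta>. ((\<lambda>n. q powi (2 * n ^ 2 + n) * (if n mod 3 = 2 then \<beta> else \<alpha>)) has_sum
        \<alpha> * a0 + \<beta> * (q * \<psi> (q ^ 9))) UNIV"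
    by (rule psi_dissection[OF q, unfolded psi9_eq]) blast
  then obtain a0 where a: "((\<lambda>n. q powi (2 * n ^ 2 + n) * (if n mod 3 = 2 then \<beta> else \<alpha>)) has_sum
        \<alpha> * a0 + \<beta> * (q * \<psi> (q ^ 9))) UNIV" for \<alpha> \<beta>
    by blast
  \<comment> \<open>\<open>W\<close> has sum zero, so the weights \<open>c\<close> annihilate the
    dissected psi. One part being \<open>D * B\<close>, the other must be
    \<open>D * \<phi>\<close>.\<close>
  have a0: "a0 = D * \<phi>"
  proof -
    have "((\<lambda>n. q * W n) has_sum q * 0) UNIV"
      by (intro has_sum_cmult_right theta_convolution_total[OF q W])
    hence "((\<lambda>n. q powi (2 * n ^ 2 + n) * c n) has_sum 0) UNIV"
      by (simp only: qW mult_zero_right)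
    moreover have "((\<lambda>n. q powi (2 * n ^ 2 + n) * c n) has_sum - B * a0 + \<phi> * (q * \<psi> (q ^ 9))) UNIV"
      unfolding c_def by (rule a)
    ultimately have "- B * a0 + \<phi> * (q * \<psi> (q ^ 9)) = 0" using has_sum_unique by blast
    hence "B * (D * \<phi> - a0) = 0" unfolding DB[symmetric] by (simp add: algebra_simps)
    thus ?thesis using B0 by simp
  qed
  have psi_root: "\<psi> (\<zeta> * q) = D * (\<phi> + \<zeta> * B)" if "\<zeta> ^ 3 = 1" "norm \<zeta> = 1" for \<zeta>
  proof -
    have "((\<lambda>n. (\<zeta> * q) powi (2 * n ^ 2 + n)) has_sum \<psi> (\<zeta> * q)) UNIV"
      unfolding \<psi>_def by (rule psi_sum) (use that q in \<open>auto simp: norm_mult\<close>)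
    moreover have "((\<lambda>n. (\<zeta> * q) powi (2 * n ^ 2 + n)) has_sum 1 * a0 + \<zeta> * (q * \<psi> (q ^ 9))) UNIV"
      unfolding powi_root_of_unity[OF q that(1)] by (rule a)
    ultimately have "\<psi> (\<zeta> * q) = 1 * a0 + \<zeta> * (q * \<psi> (q ^ 9))" using has_sum_unique by blast
    thus ?thesis unfolding a0 DB[symmetric] by (simp add: algebra_simps)
  qed

  have "\<exists>H0 H1 H2. (\<forall>\<alpha> \<beta>. ((\<lambda>(r, s). hterm q r s * ((if r mod 3 = 2 then \<beta> else \<alpha>) *
        (if s mod 3 = 2 then \<beta> else \<alpha>))) has_sum (\<alpha> ^ 2 * H0 + \<alpha> * \<beta> * H1 + \<beta> ^ 2 * H2)) (UNIV \<times> UNIV)) \<and>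
      mock_chi (q ^ 9) = - q * H2 / \<psi> (q ^ 9)"
    by (rule hecke_dissection[OF q, unfolded psi9_eq]) blast
  then obtain H0 H1 H2 where H: "((\<lambda>(r, s). hterm q r s * ((if r mod 3 = 2 then \<beta> else \<alpha>) *
        (if s mod 3 = 2 then \<beta> else \<alpha>))) has_sum (\<alpha> ^ 2 * H0 + \<alpha> * \<beta> * H1 + \<beta> ^ 2 * H2)) (UNIV \<times> UNIV)"
    and chi: "mock_chi (q ^ 9) = - q * H2 / \<psi> (q ^ 9)" for \<alpha> \<beta>
    by blast
  have X: "mock_X (\<zeta> * q) = (H0 + \<zeta> * H1 + \<zeta> ^ 2 * H2) / (D * (\<phi> + \<zeta> * B))"
    and X0: "D * (\<phi> + \<zeta> * B) \<noteq> 0" if "\<zeta> ^ 3 = 1" "norm \<zeta> = 1" for \<zeta>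
  proof -
    have zq: "\<zeta> * q \<noteq> 0" "norm (\<zeta> * q) < 1" using that q by (auto simp: norm_mult)
    have n2: "norm ((\<zeta> * q) ^ 2) < 1" using zq by (intro norm_power_less_1) auto
    have "((\<lambda>(r, s). hsgn r s * (\<zeta> * q) powi (2 * r ^ 2 + 2 * s ^ 2 + 6 * r * s + r + s)) has_sum
        (1 ^ 2 * H0 + 1 * \<zeta> * H1 + \<zeta> ^ 2 * H2)) (UNIV \<times> UNIV)"
      unfolding hterm_root_of_unity[OF q that(1)] by (rule H)
    hence "mock_X (\<zeta> * q) = qpoch_inf (\<zeta> * q) ((\<zeta> * q) ^ 2) / euler ((\<zeta> * q) ^ 2) *
        (1 ^ 2 * H0 + 1 * \<zeta> * H1 + \<zeta> ^ 2 * H2)"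
      by (rule mock_X_hecke[OF zq])
    also have "\<dots> = (H0 + \<zeta> * H1 + \<zeta> ^ 2 * H2) / \<psi> (\<zeta> * q)"
    proof -
      have "euler (\<zeta> * q) \<noteq> 0" by (rule euler_nz[OF zq(2)])
      hence "qpoch_inf (\<zeta> * q) ((\<zeta> * q) ^ 2) \<noteq> 0" unfolding euler_split2[OF zq(2)] by simp
      thus ?thesis
        unfolding \<psi>_def theta_psi[OF zq] euler_split2[OF zq(2)] using euler_nz[OF n2]
        by (simp add: divide_simps power2_eq_square)
    qed
    finally show "mock_X (\<zeta> * q) = (H0 + \<zeta> * H1 + \<zeta> ^ 2 * H2) / (D * (\<phi> + \<zeta> * B))"
      unfolding psi_root[OF that] .
    \<comment> \<open>This is psi at \<zeta> q, a quotient of nonzero Euler products.\<close>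
    show "D * (\<phi> + \<zeta> * B) \<noteq> 0"
      unfolding psi_root[OF that, symmetric] \<psi>_def theta_psi[OF zq]
      using euler_nz[OF n2] euler_nz[OF zq(2)] by simp
  qed

  have key: "B ^ 2 * H0 - B * \<phi> * H1 + \<phi> ^ 2 * H2 = q ^ 2 * E 6 ^ 3 * T"
  proof -
    \<comment> \<open>The factor q^2 restores the exponents 2n^2 + n, which \<open>W r\<close> and
      \<open>W s\<close> each carry lowered by one.\<close>
    have "((\<lambda>x. q ^ 2 * (case x of (r, s) \<Rightarrow> hsgn r s * (q powi (6 * (r * s)) * (W r * W s)))) has_sum
        q ^ 2 * (qpoch_inf (q ^ 6) (q ^ 6) ^ 3 * theta_j (q ^ 6) (q ^ 30))) (UNIV \<times> UNIV)"
      by (intro has_sum_cmult_right theta_pairing q W)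
    also have "(\<lambda>x. q ^ 2 * (case x of (r, s) \<Rightarrow> hsgn r s * (q powi (6 * (r * s)) * (W r * W s)))) =
        (\<lambda>(r, s). hterm q r s * (c r * c s))"
    proof (intro ext, clarify)
      fix r s :: int
      have e: "2 * r ^ 2 + 2 * s ^ 2 + 6 * r * s + r + s = (2 * r ^ 2 + r) + (2 * s ^ 2 + s) + 6 * (r * s)"
        by simp
      have "q ^ 2 * (hsgn r s * (q powi (6 * (r * s)) * (W r * W s))) =
          hsgn r s * (q powi (6 * (r * s)) * ((q * W r) * (q * W s)))"
        by (simp add: power2_eq_square mult_ac)
      also have "\<dots> = hterm q r s * (c r * c s)"
        unfolding qW hterm_def e powi_add[OF q(1), of "(2 * r ^ 2 + r) + (2 * s ^ 2 + s)"]
          powi_add[OF q(1), of "2 * r ^ 2 + r"] by (simp only: mult_ac)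
      finally show "q ^ 2 * (hsgn r s * (q powi (6 * (r * s)) * (W r * W s))) = hterm q r s * (c r * c s)" .
    qed
    finally have "((\<lambda>(r, s). hterm q r s * (c r * c s)) has_sum q ^ 2 * (E 6 ^ 3 * T)) (UNIV \<times> UNIV)"
      by (simp only: E_def T_def)
    moreover have "((\<lambda>(r, s). hterm q r s * (c r * c s)) has_sum
        ((- B) ^ 2 * H0 + (- B) * \<phi> * H1 + \<phi> ^ 2 * H2)) (UNIV \<times> UNIV)"
      unfolding c_def by (rule H)
    ultimately have "(- B) ^ 2 * H0 + (- B) * \<phi> * H1 + \<phi> ^ 2 * H2 = q ^ 2 * (E 6 ^ 3 * T)"
      using has_sum_unique by blast
    thus ?thesis by (simp add: mult.assoc)
  qed

  define P where "P = (\<phi> + \<omega> * B) * (\<phi> + \<omega> ^ 2 * B)"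
  have nw2: "norm (\<omega> ^ 2) = 1" using nw by (simp add: norm_power)
  have nz: "\<phi> + \<omega> * B \<noteq> 0" "\<phi> + \<omega> ^ 2 * B \<noteq> 0" "\<phi> + B \<noteq> 0"
    using X0[OF w3 nw] X0[OF w6 nw2] X0[of 1] by auto
  have P0: "P \<noteq> 0" using nz by (simp add: P_def)
  \<comment> \<open>The product of psi over the three points \<zeta> q. It trades \<open>P\<close>
    for \<open>D * (\<phi> + B)\<close>, which is psi(q), the numerator on the right-hand side of
    the theorem.\<close>
  have prod3: "D ^ 3 * (\<phi> + B) * P = E 6 ^ 8 / E 3 ^ 4 / \<psi> (q ^ 9)"
  proof -
    have "(\<omega> ^ 2) ^ 2 = \<omega>" using w by algebra
    hence q2w: "(\<omega> * q) ^ 2 = \<omega> ^ 2 * q ^ 2" "(\<omega> ^ 2 * q) ^ 2 = \<omega> * q ^ 2"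
      by (simp_all add: power_mult_distrib)
    have "D ^ 3 * (\<phi> + B) * P = \<psi> (1 * q) * \<psi> (\<omega> * q) * \<psi> (\<omega> ^ 2 * q)"
      using psi_root[of 1] psi_root[OF w3 nw] psi_root[OF w6 nw2] by (simp add: P_def power3_eq_cube mult_ac)
    also have "\<dots> = (euler (q ^ 2) * euler (\<omega> * q ^ 2) * euler (\<omega> ^ 2 * q ^ 2)) ^ 2 /
        (euler q * euler (\<omega> * q) * euler (\<omega> ^ 2 * q))"
    proof -
      have "\<psi> (\<omega> * q) = euler (\<omega> ^ 2 * q ^ 2) ^ 2 / euler (\<omega> * q)"
        unfolding \<psi>_def q2w[symmetric] by (rule theta_psi) (use w0 q nw in \<open>auto simp: norm_mult\<close>)
      moreover have "\<psi> (\<omega> ^ 2 * q) = euler (\<omega> * q ^ 2) ^ 2 / euler (\<omega> ^ 2 * q)"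
        unfolding \<psi>_def q2w[symmetric] by (rule theta_psi) (use w0 q nw2 in \<open>auto simp: norm_mult\<close>)
      moreover have "\<psi> (1 * q) = euler (q ^ 2) ^ 2 / euler q"
        unfolding \<psi>_def using theta_psi[OF q] by simp
      ultimately show ?thesis by (simp add: power_mult_distrib mult_ac)
    qed
    also have "euler q * euler (\<omega> * q) * euler (\<omega> ^ 2 * q) = E 3 ^ 4 / E 9"
      using euler_cube[OF q(2) w] E[of 9] unfolding E_def
      by (metis nonzero_mult_div_cancel_right zero_less_numeral)
    also have "euler (q ^ 2) * euler (\<omega> * q ^ 2) * euler (\<omega> ^ 2 * q ^ 2) = E 6 ^ 4 / E 18"
    proof -
      have "euler (q ^ 2) * euler (\<omega> * q ^ 2) * euler (\<omega> ^ 2 * q ^ 2) * E 18 = E 6 ^ 4"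
        using euler_cube[OF qn(2) w, of 2] by (simp add: E_def flip: power_mult)
      thus ?thesis using E[of 18] by (metis nonzero_mult_div_cancel_right zero_less_numeral)
    qed
    also have "(E 6 ^ 4 / E 18) ^ 2 / (E 3 ^ 4 / E 9) = E 6 ^ 8 / E 3 ^ 4 / \<psi> (q ^ 9)"
      using psi[of 9] by (simp add: power_divide flip: power_mult)
    finally show ?thesis .
  qed

  have chi': "mock_chi (q ^ 9) = - (q ^ 2) * H2 / (D * B)"
    unfolding chi DB using q by (simp add: power2_eq_square)
  have frac: "a / (D * x) - b / (D * y) = (a * y - b * x) / (D * (x * y))" if "x \<noteq> 0" "y \<noteq> 0" for a b x y
    using that D0 by (simp add: field_simps)
  have Xdiff: "(mock_X (\<omega> * q) - mock_X (\<omega> ^ 2 * q)) / (\<omega> - \<omega> ^ 2) =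
      (H1 * \<phi> - H2 * \<phi> - H0 * B + H2 * B) / (D * P)"
  proof -
    have "mock_X (\<omega> * q) - mock_X (\<omega> ^ 2 * q) =
        ((H0 + \<omega> * H1 + \<omega> ^ 2 * H2) * (\<phi> + \<omega> ^ 2 * B) - (H0 + \<omega> ^ 2 * H1 + (\<omega> ^ 2) ^ 2 * H2) * (\<phi> + \<omega> * B)) / (D * P)"
      unfolding X[OF w3 nw] X[OF w6 nw2] P_def by (rule frac[OF nz(1,2)])
    \<comment> \<open>The difference changes sign when \<omega> and \<omega>^2 are exchanged, hence
      is divisible by \<open>\<omega> - \<omega> ^ 2\<close>.\<close>
    also have "(H0 + \<omega> * H1 + \<omega> ^ 2 * H2) * (\<phi> + \<omega> ^ 2 * B) - (H0 + \<omega> ^ 2 * H1 + (\<omega> ^ 2) ^ 2 * H2) * (\<phi> + \<omega> * B) =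
        (\<omega> - \<omega> ^ 2) * (H1 * \<phi> - H2 * \<phi> - H0 * B + H2 * B)"
      using w by algebra
    finally show ?thesis using ww by simp
  qed
  have P': "P = \<phi> ^ 2 - \<phi> * B + B ^ 2"
    unfolding P_def using w by algebra
  define Y where "Y = H1 * \<phi> - H2 * \<phi> - H0 * B + H2 * B"
  have "mock_chi (q ^ 9) + q ^ 2 * ((mock_X (\<omega> * q) - mock_X (\<omega> ^ 2 * q)) / (\<omega> - \<omega> ^ 2)) =
      q ^ 2 * (- (H2 * P) + B * Y) / (D * B * P)"
    unfolding chi' Xdiff Y_def[symmetric] using D0 B0 P0 by (simp add: divide_simps) (simp add: algebra_simps)
  also have "- (H2 * P) + B * Y = - (B ^ 2 * H0 - B * \<phi> * H1 + \<phi> ^ 2 * H2)"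
    unfolding P' Y_def by algebra
  also have "q ^ 2 * - (B ^ 2 * H0 - B * \<phi> * H1 + \<phi> ^ 2 * H2) / (D * B * P) =
      - (q ^ 4 * E 6 ^ 3 * T / (D * B * P))"
    unfolding key by (simp add: eval_nat_numeral mult_ac)
  finally have lhs: "mock_chi (q ^ 9) + q ^ 2 * ((mock_X (\<omega> * q) - mock_X (\<omega> ^ 2 * q)) / (\<omega> - \<omega> ^ 2)) =
      - (q ^ 4 * E 6 ^ 3 * T / (D * B * P))" .

  have J: "theta_Jbar q 1 4 = D * (\<phi> + B)" "theta_Jbar q 3 12 = E 6 ^ 2 / E 3" "theta_J q 6 30 = T"
      "theta_J1 q 3 = E 3" "theta_J1 q 6 = E 6"
    using psi_root[of 1] psi[of 3] theta_J1_eq[OF q, of 3] theta_J1_eq[OF q, of 6]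
    by (simp_all add: theta_Jbar_def theta_J_def T_def \<psi>_def E_def flip: power_mult)
  \<comment> \<open>The extra \<open>D ^ 2\<close> completes the cube of \<open>D\<close> that
    occurs in \<open>prod3\<close> and is cancelled afterwards.\<close>
  have "D * B * P * (D * (\<phi> + B)) * D ^ 2 = (D * B) * (D ^ 3 * (\<phi> + B) * P)"
    by (simp add: power2_eq_square power3_eq_cube mult_ac)
  also have "\<dots> = q * E 6 ^ 8 / E 3 ^ 4"
    unfolding prod3 DB using psi9 by simp
  also have "\<dots> = (q * E 6 ^ 6 / E 3 ^ 2) * D ^ 2"
    using E[of 3] by (simp add: D_def power_divide divide_simps flip: power_add)
  finally have "D * B * P * (D * (\<phi> + B)) = q * E 6 ^ 6 / E 3 ^ 2"
    by (rule mult_right_cancel[OF power_not_zero[OF D0], THEN iffD1])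
  moreover have DBP0: "D * B * P \<noteq> 0" using D0 B0 P0 by simp
  ultimately have DBP: "D * (\<phi> + B) = q * E 6 ^ 6 / E 3 ^ 2 / (D * B * P)"
    by (metis nonzero_mult_div_cancel_left)
  \<comment> \<open>With \<open>D * B * P\<close> abstracted to \<open>Z\<close>, only a rational
    identity in \<open>q\<close>, \<open>E 3\<close>, \<open>E 6\<close>, \<open>T\<close> and
    \<open>Z\<close> remains.\<close>
  have "- (q ^ 4 * E 6 ^ 3 * T / Z) = - (q ^ 3) * (q * E 6 ^ 6 / E 3 ^ 2 / Z / (E 6 ^ 2 / E 3)) * (T * E 3 / E 6)"
    if "Z \<noteq> 0" for Z
    using that E[of 3] E[of 6] by (simp add: divide_simps) (simp add: eval_nat_numeral)
  from this[OF DBP0] show ?thesis unfolding lhs J DBP .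
qed

end
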